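(* Let $n\ge 2$ and let $\Omega\subset\mathbb{R}^n$ be an open set with finite Lebesgue measure $|\Omega|<\infty$. Let $0<\lambda_1\le\lambda_2\le\dots$ be the eigenvalues (counted with multiplicity) of the Stokes operator $A$ on $\Omega$ with Dirichlet boundary conditions, and let $\mu_1$ be the first eigenvalue of the scalar Dirichlet Laplacian on $\Omega$. Then for every $k=1,2,\dots$ $$ \lambda_k\,\ge\,\frac{n}{2+n}\left(\frac{(2\pi)^n}{\omega_n(n-1)|\Omega|}\right)^{2/n}k^{2/n}, $$ while $\lambda_1$ satisfies $$ \lambda_1>\mu_1\ge\frac{n}{2+n}\left(\frac{(2\pi)^n}{\omega_n|\Omega|}\right)^{2/n}. $$
   Context: $\omega_n=\pi^{n/2}/\Gamma(1+n/2)$ is the volume of the unit ball in $\mathbb{R}^n$ and $|\Omega|$ is the $n$-dimensional Lebesgue measure. Let $\mathcal{V}$ be the set of smooth compactly supported divergence-free vector functions $u:\Omega\to\mathbb{R}^n$, $u\in C_0^\infty(\Omega)^n$, $\operatorname{div}u=0$. Let $H$ and $V$ be the closures of $\mathcal{V}$ in $L_2(\Omega)^n$ and $H^1(\Omega)^n$, respectively. The Stokes operator $A:V\to V'$ is defined by $(Au,v)=(\nabla u,\nabla v)$ for all $u,v\in V$, where $(\nabla u,\nabla v)=\int_\Omega\sum_{i,j=1}^n\partial_iu^j\,\partial_iv^j\,dx$. Viewed in $H$, it is an unbounded self-adjoint positive operator with compact inverse. It has a system of eigenfunctions $\{v_k\}_{k=1}^\infty\subset V$, orthonormal in $H$ and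 complete in $H$ and $V$, with $Av_k=\lambda_kv_k$, $0<\lambda_1\le\lambda_2\le\dots$, $\lambda_k\to\infty$. The number $\mu_1$ is the smallest eigenvalue of the (weakly formulated) problem $-\Delta\varphi=\mu\varphi$, $\varphi|_{\partial\Omega}=0$, i.e. $\mu_1=\min\{\|\nabla\varphi\|^2/\|\varphi\|^2:\ 0\ne\varphi\in H_0^1(\Omega)\}$, with $\|\cdot\|$ the $L_2(\Omega)$ norm. *)

theory Defs
  imports "HOL-Analysis.Analysis"
begin

definition partial_deriv :: "'n \<Rightarrow> (real^'n \<Rightarrow> 'b) \<Rightarrow> real^'n \<Rightarrow> 'b::real_normed_vector" where
  "partial_deriv i f x = frechet_derivative f (at x) (axis i 1)"

primrec cont_diff :: "nat \<Rightarrow> (real^'n \<Rightarrow> 'b::real_normed_vector) \<Rightarrow> bool" where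
  "cont_diff 0 f \<longleftrightarrow> continuous_on UNIV f"
| "cont_diff (Suc k) f \<longleftrightarrow>
     (\<forall>x. f differentiable (at x)) \<and> (\<forall>i. cont_diff k (partial_deriv i f))"

(* C_0^infinity(Omega): each such function is identified with its extension by zero, which is
   smooth on the whole space. *)
definition test_functions :: "(real^'n) set \<Rightarrow> (real^'n \<Rightarrow> 'b::real_normed_vector) set" where
  "test_functions \<Omega> =
     {\<phi>. (\<forall>k. cont_diff k \<phi>) \<and> compact (closure {x. \<phi> x \<noteq> 0}) \<and> closure {x. \<phi> x \<noteq> 0} \<subseteq> \<Omega>}"

definition divergence :: "(real^'n \<Rightarrow> real^'n) \<Rightarrow> real^'n \<Rightarrow> real" where
  "divergence u x = (\<Sum>i\<in>UNIV. partial_deriv i u x $ i)"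

definition solenoidal_test_functions :: "(real^'n) set \<Rightarrow> (real^'n \<Rightarrow> real^'n) set" where
  "solenoidal_test_functions \<Omega> = {u \<in> test_functions \<Omega>. \<forall>x\<in>\<Omega>. divergence u x = 0}"

(* Elements of the function spaces below are representatives defined on the whole space; only
   their values on Omega, up to null sets, matter. The value type 'b is real for scalar functions
   and real^'n for vector fields, so that L2 Omega is L_2(Omega) or L_2(Omega)^n, etc. *)
definition L2 :: "(real^'n) set \<Rightarrow> (real^'n \<Rightarrow> 'b::euclidean_space) set" where
  "L2 \<Omega> = {f \<in> borel_measurable (lebesgue_on \<Omega>). integrable (lebesgue_on \<Omega>) (\<lambda>x. (norm (f x))\<^sup>2)}"

definition L2_inner ::
    "(real^'n) set \<Rightarrow> (real^'n \<Rightarrow> 'b) \<Rightarrow> (real^'n \<Rightarrow> 'b::euclidean_space) \<Rightarrow> real" where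
  "L2_inner \<Omega> f g = (\<integral>x. f x \<bullet> g x \<partial>lebesgue_on \<Omega>)"

definition L2_norm :: "(real^'n) set \<Rightarrow> (real^'n \<Rightarrow> 'b::euclidean_space) \<Rightarrow> real" where
  "L2_norm \<Omega> f = sqrt (L2_inner \<Omega> f f)"

definition has_weak_partial ::
    "(real^'n) set \<Rightarrow> 'n \<Rightarrow> (real^'n \<Rightarrow> 'b) \<Rightarrow> (real^'n \<Rightarrow> 'b::euclidean_space) \<Rightarrow> bool" where
  "has_weak_partial \<Omega> i f g \<longleftrightarrow>
     (\<forall>\<phi>\<in>test_functions \<Omega>.
        (\<integral>x. partial_deriv i \<phi> x *\<^sub>R f x \<partial>lebesgue_on \<Omega>) = - (\<integral>x. \<phi> x *\<^sub>R g x \<partial>lebesgue_on \<Omega>))"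

definition H1 :: "(real^'n) set \<Rightarrow> (real^'n \<Rightarrow> 'b::euclidean_space) set" where
  "H1 \<Omega> = {f \<in> L2 \<Omega>. \<forall>i. \<exists>g\<in>L2 \<Omega>. has_weak_partial \<Omega> i f g}"

(* For f in H1 Omega the choice is unique up to null subsets of Omega. *)
definition weak_partial ::
    "(real^'n) set \<Rightarrow> 'n \<Rightarrow> (real^'n \<Rightarrow> 'b) \<Rightarrow> real^'n \<Rightarrow> 'b::euclidean_space" where
  "weak_partial \<Omega> i f = (SOME g. g \<in> L2 \<Omega> \<and> has_weak_partial \<Omega> i f g)"

(* For vector fields the inner product of the values supplies the sum over the components j in
   (grad u, grad v) = integral of sum_{i,j} d_i u^j d_i v^j. *)
definition dirichlet_form ::
    "(real^'n) set \<Rightarrow> (real^'n \<Rightarrow> 'b) \<Rightarrow> (real^'n \<Rightarrow> 'b::euclidean_space) \<Rightarrow> real" where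
  "dirichlet_form \<Omega> u v = (\<Sum>i\<in>UNIV. L2_inner \<Omega> (weak_partial \<Omega> i u) (weak_partial \<Omega> i v))"

definition H1_norm :: "(real^'n) set \<Rightarrow> (real^'n \<Rightarrow> 'b::euclidean_space) \<Rightarrow> real" where
  "H1_norm \<Omega> u = sqrt ((L2_norm \<Omega> u)\<^sup>2 + dirichlet_form \<Omega> u u)"

definition L2_closure ::
    "(real^'n) set \<Rightarrow> (real^'n \<Rightarrow> 'b::euclidean_space) set \<Rightarrow> (real^'n \<Rightarrow> 'b) set" where
  "L2_closure \<Omega> S = {u \<in> L2 \<Omega>. \<forall>\<epsilon>>0. \<exists>w\<in>S. L2_norm \<Omega> (\<lambda>x. u x - w x) < \<epsilon>}"

definition H1_closure ::
    "(real^'n) set \<Rightarrow> (real^'n \<Rightarrow> 'b::euclidean_space) set \<Rightarrow> (real^'n \<Rightarrow> 'b) set" where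
  "H1_closure \<Omega> S = {u \<in> H1 \<Omega>. \<forall>\<epsilon>>0. \<exists>w\<in>S. H1_norm \<Omega> (\<lambda>x. u x - w x) < \<epsilon>}"

definition H_space :: "(real^'n) set \<Rightarrow> (real^'n \<Rightarrow> real^'n) set" where
  "H_space \<Omega> = L2_closure \<Omega> (solenoidal_test_functions \<Omega>)"

definition V_space :: "(real^'n) set \<Rightarrow> (real^'n \<Rightarrow> real^'n) set" where
  "V_space \<Omega> = H1_closure \<Omega> (solenoidal_test_functions \<Omega>)"

definition H10 :: "(real^'n) set \<Rightarrow> (real^'n \<Rightarrow> real) set" where
  "H10 \<Omega> = H1_closure \<Omega> (test_functions \<Omega>)"

(* A : V -> V', a functional on V being given by its values on V_space Omega. *)
definition stokes_op ::
    "(real^'n) set \<Rightarrow> (real^'n \<Rightarrow> real^'n) \<Rightarrow> ((real^'n \<Rightarrow> real^'n) \<Rightarrow> real)" where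
  "stokes_op \<Omega> u = (\<lambda>w. dirichlet_form \<Omega> u w)"

(* A v = l v as an identity in V', where H is embedded in V' by the L_2 inner product. *)
definition stokes_eigenpair :: "(real^'n) set \<Rightarrow> real \<Rightarrow> (real^'n \<Rightarrow> real^'n) \<Rightarrow> bool" where
  "stokes_eigenpair \<Omega> l v \<longleftrightarrow>
     v \<in> V_space \<Omega> \<and> L2_norm \<Omega> v \<noteq> 0 \<and> (\<forall>w\<in>V_space \<Omega>. stokes_op \<Omega> v w = l * L2_inner \<Omega> v w)"

(* An enumeration, starting at index 1, of the whole spectrum with multiplicities: eigenfunctions
   v k orthonormal in H and complete (with dense linear span) in H and in V, with eigenvalues
   lam k in nondecreasing order. The values at index 0 are irrelevant. *)
definition stokes_eigensystem ::
    "(real^'n) set \<Rightarrow> (nat \<Rightarrow> real) \<Rightarrow> (nat \<Rightarrow> real^'n \<Rightarrow> real^'n) \<Rightarrow> bool" where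
  "stokes_eigensystem \<Omega> lam v \<longleftrightarrow>
     (\<forall>k\<ge>1. stokes_eigenpair \<Omega> (lam k) (v k)) \<and>
     (\<forall>j\<ge>1. \<forall>k\<ge>1. L2_inner \<Omega> (v j) (v k) = (if j = k then 1 else 0)) \<and>
     (\<forall>u\<in>H_space \<Omega>. \<forall>\<epsilon>>0. \<exists>N c. L2_norm \<Omega> (\<lambda>x. u x - (\<Sum>k=1..N. c k *\<^sub>R v k x)) < \<epsilon>) \<and>
     (\<forall>u\<in>V_space \<Omega>. \<forall>\<epsilon>>0. \<exists>N c. H1_norm \<Omega> (\<lambda>x. u x - (\<Sum>k=1..N. c k *\<^sub>R v k x)) < \<epsilon>) \<and>
     0 < lam 1 \<and> (\<forall>k\<ge>1. lam k \<le> lam (Suc k)) \<and> filterlim lam at_top sequentially"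

definition dirichlet_eigenvalue :: "(real^'n) set \<Rightarrow> real \<Rightarrow> bool" where
  "dirichlet_eigenvalue \<Omega> \<mu> \<longleftrightarrow>
     (\<exists>\<phi>\<in>H10 \<Omega>. L2_norm \<Omega> \<phi> \<noteq> 0 \<and> (\<forall>\<psi>\<in>H10 \<Omega>. dirichlet_form \<Omega> \<phi> \<psi> = \<mu> * L2_inner \<Omega> \<phi> \<psi>))"

definition rayleigh_quotients :: "(real^'n) set \<Rightarrow> real set" where
  "rayleigh_quotients \<Omega> =
     {dirichlet_form \<Omega> \<phi> \<phi> / (L2_norm \<Omega> \<phi>)\<^sup>2 | \<phi>. \<phi> \<in> H10 \<Omega> \<and> L2_norm \<Omega> \<phi> \<noteq> 0}"

(* \<mu> is the smallest eigenvalue and the minimum of the Rayleigh quotient. The second line alone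
   implies the first, by the usual variational argument; both are recorded because the number is
   introduced by both descriptions. *)
definition first_dirichlet_eigenvalue :: "(real^'n) set \<Rightarrow> real \<Rightarrow> bool" where
  "first_dirichlet_eigenvalue \<Omega> \<mu> \<longleftrightarrow>
     dirichlet_eigenvalue \<Omega> \<mu> \<and> (\<forall>\<nu>. dirichlet_eigenvalue \<Omega> \<nu> \<longrightarrow> \<mu> \<le> \<nu>) \<and>
     \<mu> \<in> rayleigh_quotients \<Omega> \<and> (\<forall>r\<in>rayleigh_quotients \<Omega>. \<mu> \<le> r)"

end

theory Submission
  imports Defs "HOL-Probability.Characteristic_Functions"
begin

text \<open>
  \<^bold>\<open>Lower bounds for the eigenvalues.\<close> Extend the eigenfields by zero to the whole space and add up the
  squared moduli of their Fourier transforms. By Plancherel, the resulting density \<open>F\<close> on frequency space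
  has total mass \<open>(2 \<pi>)\<^sup>n k\<close> and second moment \<open>(2 \<pi>)\<^sup>n (\<lambda>\<^sub>1 + \<dots> + \<lambda>\<^sub>k)\<close>.
  Orthonormality bounds \<open>F\<close> pointwise: Bessel's inequality, applied to polarised plane waves restricted to
  \<open>\<Omega>\<close>, contributes at most \<open>\<bar>\<Omega>\<bar>\<close> for every direction of polarisation. A divergence-free field has
  a Fourier transform orthogonal to \<open>\<xi>\<close>, so only \<open>n - 1\<close> directions count and
  \<open>F \<le> (n - 1) \<bar>\<Omega>\<bar>\<close> (\<open>solenoidal_spectrum_bound\<close>). Among densities with given mass and given upper bound
  the second moment is smallest when the mass fills a ball around the origin. This is used in the dual
  form of Berezin: integrate \<open>(\<Lambda> - \<bar>\<xi>\<bar>\<^sup>2)\<close> against \<open>F\<close>, estimate by the positive part and optimise in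
  \<open>\<Lambda>\<close> (\<open>berezin_li_yau\<close>). Since \<open>\<lambda>\<^sub>k\<close> is at least the mean of \<open>\<lambda>\<^sub>1, \<dots>, \<lambda>\<^sub>k\<close>, the bound
  follows. The bound for \<open>\<mu>\<^sub>1\<close> is the case of one scalar function, whose spectrum is at most
  \<open>\<bar>\<Omega>\<bar>\<close> times its squared norm (\<open>scalar_spectrum_bound\<close>).

  Plancherel's identity is derived for continuous functions of compact support from the Gaussian integral,
  by regularising the inverse transform of the autocorrelation (\<open>plancherel\<close>). Eigenfields are reached by
  approximation with test functions (\<open>H1_closure_approximation\<close>), which needs the uniqueness of weak
  derivatives (\<open>fundamental_lemma\<close>).

  \<^bold>\<open>The strict inequality.\<close> Let \<open>u\<close> be the first eigenfield. The modulus of \<open>u\<close> is an admissible scalar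
  function and \<open>\<bar>\<nabla>\<bar>u\<bar>\<bar> \<le> \<bar>\<nabla>u\<bar>\<close>, so \<open>\<lambda>\<^sub>1 \<ge> \<mu>\<^sub>1\<close>. In the case of equality every derivative
  \<open>\<partial>\<^sub>i u\<close> is parallel to \<open>u\<close>, say \<open>\<partial>\<^sub>i u = p\<^sub>i u\<close>; then \<open>div u = \<Sum> p\<^sub>i u\<^sub>i = 0\<close> yields
  \<open>(u \<cdot> \<nabla>) u = (\<Sum> p\<^sub>i u\<^sub>i) u = 0\<close>. So \<open>u\<close> would be a stationary flow without pressure and with finite
  energy, which must vanish: testing \<open>(u \<cdot> \<nabla>) u\<^sub>j = 0\<close> with \<open>arctan x\<^sub>j\<close> and integrating by parts gives
  \<open>\<integral> u\<^sub>j\<^sup>2 / (1 + x\<^sub>j\<^sup>2) = 0\<close>. The proof carries this out quantitatively for test fields, with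
  \<open>sqrt (\<bar>w\<bar>\<^sup>2 + \<epsilon>\<^sup>2) - \<epsilon>\<close> in place of the modulus (\<open>transport_bound\<close>, \<open>transport_estimate\<close>), and
  passes to the limit (\<open>solenoidal_rayleigh_strict\<close>).
\<close>

section \<open>Calculus of continuously differentiable functions\<close>

lemma partial_deriv_eq:
  "(f has_derivative f') (at x) \<Longrightarrow> partial_deriv i f x = f' (axis i 1)"
  unfolding partial_deriv_def using frechet_derivative_at by metis

lemma cont_diff_continuous: "cont_diff k f \<Longrightarrow> continuous_on UNIV f"
  by (cases k) (auto intro!: differentiable_imp_continuous_on simp: differentiable_on_def
      intro: differentiable_at_withinI)

lemma cont_diff_lower: "cont_diff (Suc k) f \<Longrightarrow> cont_diff k f"
proof (induction k arbitrary: f)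
  case 0
  then show ?case using cont_diff_continuous[OF 0] by simp
next
  case (Suc k)
  then show ?case by (metis cont_diff.simps(2))
qed

lemma cont_diff_const:
  fixes c :: "'b::real_normed_vector"
  shows "cont_diff k (\<lambda>x::real^'n. c)"
proof (induction k arbitrary: c)
  case (Suc k)
  have "partial_deriv i (\<lambda>x. c) = (\<lambda>x::real^'n. 0::'b)" for i
    by (rule ext, rule trans[OF partial_deriv_eq[OF has_derivative_const]]) auto
  then show ?case using Suc by simp
qed simp

lemma partial_deriv_bounded_bilinear:
  assumes "bounded_bilinear pr" "f differentiable (at x)" "g differentiable (at x)"
  shows "partial_deriv i (\<lambda>x. pr (f x) (g x)) x
    = pr (f x) (partial_deriv i g x) + pr (partial_deriv i f x) (g x)"
proof -
  obtain f' g' where d: "(f has_derivative f') (at x)" "(g has_derivative g') (at x)"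
    using assms unfolding differentiable_def by blast
  from partial_deriv_eq[OF bounded_bilinear.FDERIV[OF assms(1) d]] partial_deriv_eq[OF d(1)]
    partial_deriv_eq[OF d(2)]
  show ?thesis by simp
qed

lemma partial_deriv_add:
  assumes "f differentiable (at x)" "g differentiable (at x)"
  shows "partial_deriv i (\<lambda>x. f x + g x) x = partial_deriv i f x + partial_deriv i g x"
proof -
  obtain f' g' where d: "(f has_derivative f') (at x)" "(g has_derivative g') (at x)"
    using assms unfolding differentiable_def by blast
  from partial_deriv_eq[OF has_derivative_add[OF d]] partial_deriv_eq[OF d(1)]
    partial_deriv_eq[OF d(2)]
  show ?thesis by simp
qed

lemma partial_deriv_bounded_linear:
  assumes "bounded_linear L" "f differentiable (at x)"
  shows "partial_deriv i (\<lambda>x. L (f x)) x = L (partial_deriv i f x)"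
proof -
  obtain f' where d: "(f has_derivative f') (at x)"
    using assms unfolding differentiable_def by blast
  from partial_deriv_eq[OF bounded_linear.has_derivative[OF assms(1) d]] partial_deriv_eq[OF d]
  show ?thesis by simp
qed

lemma cont_diff_add:
  "cont_diff k f \<Longrightarrow> cont_diff k g \<Longrightarrow> cont_diff k (\<lambda>x. f x + g x)"
proof (induction k arbitrary: f g)
  case (Suc k)
  have "partial_deriv i (\<lambda>x. f x + g x) = (\<lambda>x. partial_deriv i f x + partial_deriv i g x)" for i
    using Suc.prems by (intro ext partial_deriv_add) auto
  then show ?case using Suc by auto
qed (auto intro: continuous_intros)

lemma cont_diff_bounded_linear:
  assumes "bounded_linear L"
  shows "cont_diff k f \<Longrightarrow> cont_diff k (\<lambda>x. L (f x))"
proof (induction k arbitrary: f)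
  case 0
  then show ?case using bounded_linear.continuous_on[OF assms] by auto
next
  case (Suc k)
  have "partial_deriv i (\<lambda>x. L (f x)) = (\<lambda>x. L (partial_deriv i f x))" for i
    using Suc.prems by (intro ext partial_deriv_bounded_linear assms) auto
  moreover have "(\<lambda>x. L (f x)) differentiable at x" for x
    using Suc.prems bounded_linear.has_derivative[OF assms] unfolding differentiable_def cont_diff.simps
    by blast
  ultimately show ?case using Suc by auto
qed

lemma cont_diff_bounded_bilinear:
  assumes "bounded_bilinear pr"
  shows "cont_diff k f \<Longrightarrow> cont_diff k g \<Longrightarrow> cont_diff k (\<lambda>x. pr (f x) (g x))"
proof (induction k arbitrary: f g)
  case 0
  then show ?case using bounded_bilinear.continuous_on[OF assms] by auto
next
  case (Suc k)
  have "partial_deriv i (\<lambda>x. pr (f x) (g x))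
      = (\<lambda>x. pr (f x) (partial_deriv i g x) + pr (partial_deriv i f x) (g x))" for i
    using Suc.prems by (intro ext partial_deriv_bounded_bilinear assms) auto
  moreover have "(\<lambda>x. pr (f x) (g x)) differentiable at x" for x
    using Suc.prems bounded_bilinear.FDERIV[OF assms]
    unfolding differentiable_def cont_diff.simps by blast
  moreover have "cont_diff k f" "cont_diff k g" using Suc.prems cont_diff_lower by auto
  ultimately show ?case using Suc by (auto intro!: cont_diff_add)
qed

lemmas cont_diff_mult = cont_diff_bounded_bilinear[OF bounded_bilinear_mult]
lemmas cont_diff_scaleR = cont_diff_bounded_bilinear[OF bounded_bilinear_scaleR]
lemmas cont_diff_inner = cont_diff_bounded_bilinear[OF bounded_bilinear_inner]

lemma cont_diff_diff:
  assumes "cont_diff k f" "cont_diff k g" shows "cont_diff k (\<lambda>x. f x - g x)"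
  using cont_diff_add[OF assms(1) cont_diff_bounded_linear[OF bounded_linear_minus[OF bounded_linear_ident] assms(2)]]
  by simp

lemma cont_diff_prod:
  fixes f :: "'a \<Rightarrow> real^'n \<Rightarrow> real"
  shows "(\<And>i. i \<in> A \<Longrightarrow> cont_diff k (f i)) \<Longrightarrow> cont_diff k (\<lambda>x. \<Prod>i\<in>A. f i x)"
  by (induction A rule: infinite_finite_induct)
    (auto intro: cont_diff_mult cont_diff_const)

lemma cont_diff_ident: "cont_diff k (\<lambda>x. x)"
proof (cases k)
  case (Suc m)
  have "partial_deriv i (\<lambda>x. x) = (\<lambda>x::real^'a. axis i 1)" for i
    by (rule ext, rule trans[OF partial_deriv_eq[OF has_derivative_ident]]) auto
  then show ?thesis using Suc by (simp add: cont_diff_const)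
qed (auto intro: continuous_intros)

text \<open>Closure of \<open>C\<^sup>k\<close> under composition with a smooth scalar function. A single function \<open>h\<close> is
  smooth as soon as it lies in some family of functions closed under differentiation, and the
  induction on \<open>k\<close> runs over the family. Powers and the bump profile below have obvious such families,
  whereas explicit formulas for all their derivatives would be unwieldy.\<close>

lemma cont_diff_compose_family:
  fixes f :: "real^'n \<Rightarrow> real" and \<H> :: "(real \<Rightarrow> real) set"
  assumes cl: "\<And>h. h \<in> \<H> \<Longrightarrow> \<exists>h'\<in>\<H>. \<forall>t\<in>D. (h has_real_derivative h' t) (at t)"
    and D: "\<And>x. f x \<in> D"
  shows "cont_diff k f \<Longrightarrow> h \<in> \<H> \<Longrightarrow> cont_diff k (\<lambda>x. h (f x))"
proof (induction k arbitrary: h)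
  case 0
  obtain h' where h': "\<And>t. t \<in> D \<Longrightarrow> (h has_real_derivative h' t) (at t)" using cl 0 by blast
  have "continuous_on D h"
    by (rule DERIV_continuous_on[where D=h']) (use h' in \<open>auto intro: has_field_derivative_at_within\<close>)
  then show ?case using 0 D by (auto intro: continuous_on_compose2)
next
  case (Suc k)
  obtain h' where h': "\<And>t. t \<in> D \<Longrightarrow> (h has_real_derivative h' t) (at t)" "h' \<in> \<H>"
    using cl Suc by blast
  have d: "((\<lambda>x. h (f x)) has_derivative (\<lambda>y. frechet_derivative f (at x) y * h' (f x))) (at x)" for x
  proof -
    have "(f has_derivative frechet_derivative f (at x)) (at x)"
      using Suc.prems(1) by (simp add: frechet_derivative_works)
    from DERIV_compose_FDERIV[OF h'(1)[OF D] this] show ?thesis .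
  qed
  have p: "partial_deriv i (\<lambda>x. h (f x)) = (\<lambda>x. h' (f x) * partial_deriv i f x)" for i
    by (rule ext, subst partial_deriv_eq[OF d]) (simp add: partial_deriv_def)
  have "cont_diff k (\<lambda>x. h' (f x) * partial_deriv i f x)" for i
    using Suc.prems by (intro cont_diff_mult[OF Suc.IH[OF _ h'(2)]]) (auto intro: cont_diff_lower)
  moreover have "(\<lambda>x. h (f x)) differentiable at x" for x
    using d unfolding differentiable_def by blast
  ultimately show ?case by (auto simp: p)
qed

lemma cont_diff_powr:
  fixes f :: "real^'n \<Rightarrow> real"
  assumes "\<And>x. f x > 0" "cont_diff k f"
  shows "cont_diff k (\<lambda>x. f x powr a)"
proof -
  define \<H> :: "(real \<Rightarrow> real) set" where "\<H> = {\<lambda>t. c * t powr a | c a. True}"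
  have "cont_diff k (\<lambda>x. (\<lambda>t. 1 * t powr a) (f x))"
  proof (rule cont_diff_compose_family[of \<H> "{0<..}" f k "\<lambda>t. 1 * t powr a"])
    fix h assume "h \<in> \<H>"
    then obtain c a where h: "h = (\<lambda>t. c * t powr a)" by (auto simp: \<H>_def)
    have "(\<lambda>t. (c * a) * t powr (a - 1)) \<in> \<H>" unfolding \<H>_def by blast
    moreover have "\<forall>t\<in>{0<..}. (h has_real_derivative (c * a) * t powr (a - 1)) (at t)"
      unfolding h by (auto intro!: derivative_eq_intros simp: field_simps powr_diff)
    ultimately show "\<exists>h'\<in>\<H>. \<forall>t\<in>{0<..}. (h has_real_derivative h' t) (at t)"
      by (intro bexI[where x = "\<lambda>t. c * a * t powr (a - 1)"])
  next
    show "(\<lambda>t. 1 * t powr a) \<in> \<H>" unfolding \<H>_def by blast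
  qed (use assms in auto)
  then show ?thesis by simp
qed

text \<open>The classical smooth function that is flat to infinite order at the origin.\<close>

definition smooth_step :: "real \<Rightarrow> real" where
  "smooth_step t = (if t \<le> 0 then 0 else exp (- (1 / t)))"

lemma poly_times_exp_minus_tendsto_0:
  "((\<lambda>y. poly p y * exp (- y)) \<longlongrightarrow> 0) (at_top :: real filter)"
proof -
  have "((\<lambda>y. \<Sum>i\<le>degree p. coeff p i * (y ^ i / exp y)) \<longlongrightarrow> (\<Sum>i\<le>degree p. coeff p i * 0)) at_top"
    by (intro tendsto_sum tendsto_mult tendsto_const tendsto_power_div_exp_0)
  then show ?thesis
    by (simp add: poly_altdef sum_distrib_right exp_minus divide_inverse mult.assoc)
qed

text \<open>The derivative-closed family consists of \<open>p (1/t) exp (-1/t)\<close> with \<open>p\<close> a polynomial: differentiating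
  replaces \<open>p\<close> by \<open>X\<^sup>2 (p - p')\<close>. At the origin all difference quotients vanish because the
  exponential beats every polynomial in \<open>1/t\<close>.\<close>

lemma cont_diff_smooth_step:
  fixes f :: "real^'n \<Rightarrow> real"
  assumes "cont_diff k f"
  shows "cont_diff k (\<lambda>x. smooth_step (f x))"
proof -
  define e where "e p t = (if t \<le> 0 then 0 else poly p (1 / t) * exp (- (1 / t)))" for p and t :: real
  define \<H> where "\<H> = range e"
  have lim0: "((\<lambda>t. e p t) \<longlongrightarrow> 0) (at 0)" for p
  proof -
    have "((\<lambda>t. poly p (inverse t) * exp (- inverse t)) \<longlongrightarrow> 0) (at_right 0)"
      by (rule filterlim_compose[OF poly_times_exp_minus_tendsto_0 filterlim_inverse_at_top_right])
    then have "(e p \<longlongrightarrow> 0) (at_right 0)"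
      by (rule Lim_transform_eventually)
        (auto simp: e_def eventually_at_filter divide_inverse)
    moreover have "(e p \<longlongrightarrow> 0) (at_left 0)"
      by (rule Lim_transform_eventually[OF tendsto_const])
        (auto simp: e_def eventually_at_filter)
    ultimately show ?thesis using filterlim_split_at_real by blast
  qed
  have der: "(e p has_real_derivative e ([:0,0,1:] * (p - pderiv p)) t) (at t)" for p t
  proof (cases t "0::real" rule: linorder_cases)
    case less
    have "((\<lambda>t. 0) has_real_derivative 0) (at t)" by auto
    then have "(e p has_real_derivative 0) (at t)"
      by (rule has_field_derivative_transform_within_open[of _ _ _ "{..<0}"])
        (use less in \<open>auto simp: e_def\<close>)
    then show ?thesis using less by (simp add: e_def)
  next
    case equal
    \<comment> \<open>The quotient \<open>e p y / y\<close> is again a member of the family, with \<open>X p\<close> in place of \<open>p\<close>.\<close>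
    have "((\<lambda>y. (e p y - e p 0) / (y - 0)) \<longlongrightarrow> 0) (at 0)"
      by (rule Lim_transform_eventually[OF lim0[of "[:0,1:] * p"]])
        (auto simp: e_def eventually_at_filter)
    then show ?thesis unfolding equal by (simp add: has_field_derivative_iff e_def)
  next
    case greater
    have "((\<lambda>t. poly p (1 / t) * exp (- (1 / t))) has_real_derivative
       poly ([:0,0,1:] * (p - pderiv p)) (1 / t) * exp (- (1 / t))) (at t)"
      using greater
      by (auto intro!: derivative_eq_intros DERIV_chain2[OF poly_DERIV]
          simp: field_simps power2_eq_square)
    then have "(e p has_real_derivative poly ([:0,0,1:] * (p - pderiv p)) (1 / t) * exp (- (1 / t))) (at t)"
      by (rule has_field_derivative_transform_within_open[of _ _ _ "{0<..}"])
        (use greater in \<open>auto simp: e_def\<close>)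
    then show ?thesis using greater by (simp add: e_def)
  qed
  have "cont_diff k (\<lambda>x. e 1 (f x))"
  proof (rule cont_diff_compose_family[of \<H> UNIV f k "e 1"])
    fix h assume "h \<in> \<H>"
    then obtain p where "h = e p" by (auto simp: \<H>_def)
    then show "\<exists>h'\<in>\<H>. \<forall>t\<in>UNIV. (h has_real_derivative h' t) (at t)"
      using der[of p] unfolding \<H>_def by blast
  qed (use assms in \<open>auto simp: \<H>_def\<close>)
  moreover have "e 1 = smooth_step" by (auto simp: e_def smooth_step_def fun_eq_iff)
  ultimately show ?thesis by simp
qed

section \<open>Integration by parts\<close>

lemma compact_closure_subset: "compact K \<Longrightarrow> closure A \<subseteq> K \<Longrightarrow> compact (closure A)"
  using closed_Int_compact[OF closed_closure[of A], of K] by (simp add: Int_absorb2)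

lemma integrable_continuous_compact_support:
  fixes f :: "real^'n \<Rightarrow> 'b::euclidean_space"
  assumes "continuous_on UNIV f" "compact K" "\<And>x. x \<notin> K \<Longrightarrow> f x = 0"
  shows "integrable lborel f"
proof -
  have "integrable lborel (\<lambda>x. indicator K x *\<^sub>R f x)"
    by (rule borel_integrable_compact) (use assms in \<open>auto intro: continuous_on_subset\<close>)
  moreover have "(\<lambda>x. indicator K x *\<^sub>R f x) = f"
    using assms(3) by (auto simp: indicator_def fun_eq_iff)
  ultimately show ?thesis by simp
qed

lemma bounded_continuous_compact_support:
  fixes f :: "real^'n \<Rightarrow> 'b::euclidean_space"
  assumes "continuous_on UNIV f" "compact K" "\<And>x. x \<notin> K \<Longrightarrow> f x = 0"
  obtains B where "B \<ge> 0" "\<And>x. norm (f x) \<le> B"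
proof -
  have "compact (f ` K)" using assms by (intro compact_continuous_image) (auto intro: continuous_on_subset)
  then obtain B where "\<forall>y\<in>f ` K. norm y \<le> B" using compact_imp_bounded bounded_iff by metis
  then have "norm (f x) \<le> max B 0" for x
    using assms(3)[of x] by (cases "x \<in> K") auto
  then show ?thesis by (intro that[of "max B 0"]) auto
qed

lemma lborel_integral_translate:
  fixes f :: "real^'n \<Rightarrow> 'b::euclidean_space"
  assumes "f \<in> borel_measurable borel"
  shows "(\<integral>x. f (x + a) \<partial>lborel) = (\<integral>x. f x \<partial>lborel)"
proof -
  have "(\<integral>x. f x \<partial>distr lborel borel ((+) a)) = (\<integral>x. f (a + x) \<partial>lborel)"
    by (rule integral_distr) (use assms in auto)
  then show ?thesis by (simp add: lborel_distr_plus add.commute)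
qed

lemma lborel_integrable_translate:
  fixes f :: "real^'n \<Rightarrow> 'b::euclidean_space"
  assumes "integrable lborel f"
  shows "integrable lborel (\<lambda>x. f (x + a))"
proof -
  have "integrable (distr lborel borel ((+) a)) f" using assms by (simp add: lborel_distr_plus)
  then have "integrable lborel (\<lambda>x. f (a + x))"
    by (subst (asm) integrable_distr_eq) (use assms in auto)
  then show ?thesis by (simp add: add.commute)
qed

lemma zero_outside_support: "x \<notin> closure {x. \<phi> x \<noteq> 0} \<Longrightarrow> \<phi> x = 0"
  using subsetD[OF closure_subset[of "{x. \<phi> x \<noteq> 0}"], of x] by auto

lemma partial_deriv_outside_support:
  assumes "x \<notin> closure {x. f x \<noteq> 0}"
  shows "partial_deriv i f x = 0"
proof -
  have "(f has_derivative (\<lambda>_. 0)) (at x)"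
    by (rule has_derivative_transform_within_open[of "\<lambda>_. 0" _ _ _ "- closure {x. f x \<noteq> 0}"])
      (use assms in \<open>auto dest: zero_outside_support\<close>)
  from partial_deriv_eq[OF this] show ?thesis .
qed

lemma has_derivative_cont_diff:
  assumes "cont_diff (Suc k) f"
  shows "(f has_derivative frechet_derivative f (at x)) (at x)"
  using assms by (simp add: frechet_derivative_works)

lemma DERIV_along_axis:
  fixes f :: "real^'n \<Rightarrow> real"
  assumes "cont_diff 1 f"
  shows "((\<lambda>s. f (x + s *\<^sub>R axis i 1)) has_real_derivative partial_deriv i f (x + s *\<^sub>R axis i 1)) (at s)"
proof -
  let ?e = "axis i 1 :: real^'n"
  have f: "(f has_derivative frechet_derivative f (at y)) (at y)" for y
    using has_derivative_cont_diff[of 0 f] assms by simp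
  have "((\<lambda>s. f (x + s *\<^sub>R ?e)) has_derivative
      (\<lambda>h. frechet_derivative f (at (x + s *\<^sub>R ?e)) (h *\<^sub>R ?e))) (at s)"
    by (rule has_derivative_compose[of "\<lambda>s. x + s *\<^sub>R ?e", OF _ f])
      (auto intro!: derivative_eq_intros)
  moreover have "frechet_derivative f (at (x + s *\<^sub>R ?e)) (h *\<^sub>R ?e)
      = partial_deriv i f (x + s *\<^sub>R ?e) * h" for h
    using linear_scale[OF has_derivative_linear[OF f]] by (simp add: partial_deriv_def)
  ultimately show ?thesis by (simp add: has_field_derivative_def)
qed

text \<open>Translation invariance of Lebesgue measure makes the integral of every difference quotient
  vanish; the quotients converge to the derivative and are dominated by its supremum on a slightly
  enlarged ball. This avoids splitting the integral into one-dimensional ones.\<close>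

lemma integral_partial_deriv_real:
  fixes f :: "real^'n \<Rightarrow> real"
  assumes f: "cont_diff 1 f" and c: "compact (closure {x. f x \<noteq> 0})"
  shows "(\<integral>x. partial_deriv i f x \<partial>lborel) = 0"
proof -
  let ?K = "closure {x. f x \<noteq> 0}" and ?D = "partial_deriv i f"
  let ?e = "axis i 1 :: real^'n"
  define t where "t m = 1 / real (Suc m)" for m
  define q where "q m x = (f (x + t m *\<^sub>R ?e) - f x) / t m" for m x
  have t: "0 < t m" "t m \<le> 1" for m by (auto simp: t_def)
  have t0: "t \<longlonglongrightarrow> 0" unfolding t_def by (rule LIMSEQ_inverse_real_of_nat[unfolded inverse_eq_divide])
  have cf: "continuous_on UNIV f" using f cont_diff_continuous by blast
  have cD: "continuous_on UNIV ?D" using f by auto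
  have f0: "f x = 0" if "x \<notin> ?K" for x using zero_outside_support[OF that] .
  obtain B where B: "B \<ge> 0" "\<And>x. norm (?D x) \<le> B"
    using bounded_continuous_compact_support[OF cD c partial_deriv_outside_support] by blast
  obtain R where R: "\<And>x. x \<in> ?K \<Longrightarrow> norm x \<le> R"
    using compact_imp_bounded[OF c] bounded_iff by metis
  have intf: "integrable lborel f" by (rule integrable_continuous_compact_support[OF cf c f0])
  have "(\<lambda>m. integral\<^sup>L lborel (q m)) \<longlonglongrightarrow> integral\<^sup>L lborel ?D"
  proof (rule integral_dominated_convergence)
    show "?D \<in> borel_measurable lborel" using cD by (simp add: borel_measurable_continuous_onI)
    have "f \<in> borel_measurable borel" using cf by (simp add: borel_measurable_continuous_onI)
    then show "q m \<in> borel_measurable lborel" for m unfolding q_def by measurable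
    \<comment> \<open>The step lengths are at most 1, so the quotients vanish outside the ball of radius \<open>R + 1\<close>.\<close>
    show "integrable lborel (\<lambda>x. indicator (cball 0 (R + 1)) x *\<^sub>R B)"
      by (rule borel_integrable_compact) auto
    show "AE x in lborel. norm (q m x) \<le> indicator (cball 0 (R + 1)) x *\<^sub>R B" for m
    proof (rule AE_I2)
      fix x :: "real^'n"
      show "norm (q m x) \<le> indicator (cball 0 (R + 1)) x *\<^sub>R B"
      proof (cases "norm x \<le> R + 1")
        case True
        obtain z where z: "f (x + t m *\<^sub>R ?e) - f (x + 0 *\<^sub>R ?e) = (t m - 0) * ?D (x + z *\<^sub>R ?e)"
          using MVT2[OF t(1)[of m], of "\<lambda>s. f (x + s *\<^sub>R ?e)" "\<lambda>s. ?D (x + s *\<^sub>R ?e)"] DERIV_along_axis[OF f] by blast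
        then have "q m x = ?D (x + z *\<^sub>R ?e)" using t(1)[of m] by (simp add: q_def)
        then show ?thesis using B(2) True by (simp add: indicator_def)
      next
        case False
        have "norm x \<le> norm (x + t m *\<^sub>R ?e) + norm (t m *\<^sub>R ?e)"
          using norm_triangle_ineq4[of "x + t m *\<^sub>R ?e" "t m *\<^sub>R ?e"] by simp
        also have "norm (t m *\<^sub>R ?e) \<le> 1" using t[of m] by simp
        finally have "\<not> norm (x + t m *\<^sub>R ?e) \<le> R" "\<not> norm x \<le> R" using False by auto
        then have "f (x + t m *\<^sub>R ?e) = 0" "f x = 0" using R f0 by blast+
        then show ?thesis using B by (simp add: q_def)
      qed
    qed
    show "AE x in lborel. (\<lambda>m. q m x) \<longlonglongrightarrow> ?D x"
    proof (rule AE_I2)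
      fix x :: "real^'n"
      have "((\<lambda>h. (f (x + (0 + h) *\<^sub>R ?e) - f (x + 0 *\<^sub>R ?e)) / h) \<longlongrightarrow> ?D (x + 0 *\<^sub>R ?e)) (at 0)"
        using DERIV_along_axis[OF f, of x i 0] unfolding DERIV_def by blast
      moreover have "filterlim t (at 0) sequentially"
        using t0 t(1) by (auto simp: filterlim_at intro!: always_eventually less_imp_neq[symmetric])
      ultimately have "(\<lambda>m. (f (x + (0 + t m) *\<^sub>R ?e) - f (x + 0 *\<^sub>R ?e)) / t m) \<longlonglongrightarrow> ?D (x + 0 *\<^sub>R ?e)"
        by (rule filterlim_compose)
      then show "(\<lambda>m. q m x) \<longlonglongrightarrow> ?D x" by (simp add: q_def)
    qed
  qed
  moreover have "integral\<^sup>L lborel (q m) = 0" for m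
  proof -
    have "integral\<^sup>L lborel (q m) = ((\<integral>x. f (x + t m *\<^sub>R ?e) \<partial>lborel) - (\<integral>x. f x \<partial>lborel)) / t m"
      unfolding q_def using intf lborel_integrable_translate[OF intf]
      by (simp add: Bochner_Integration.integral_diff)
    also have "(\<integral>x. f (x + t m *\<^sub>R ?e) \<partial>lborel) = (\<integral>x. f x \<partial>lborel)"
      by (rule lborel_integral_translate) (use intf in auto)
    finally show ?thesis by simp
  qed
  ultimately show ?thesis by (simp add: LIMSEQ_const_iff)
qed

lemma integral_partial_deriv:
  fixes f :: "real^'n \<Rightarrow> 'b::euclidean_space"
  assumes f: "cont_diff 1 f" and c: "compact (closure {x. f x \<noteq> 0})"
  shows "(\<integral>x. partial_deriv i f x \<partial>lborel) = 0"
proof (rule euclidean_eqI)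
  fix b :: 'b assume "b \<in> Basis"
  let ?g = "\<lambda>x. f x \<bullet> b"
  have g: "cont_diff 1 ?g" by (rule cont_diff_bounded_linear[OF bounded_linear_inner_left f])
  have c': "compact (closure {x. ?g x \<noteq> 0})"
    by (rule compact_closure_subset[OF c closure_mono]) auto
  have int: "integrable lborel (partial_deriv i f)"
    by (rule integrable_continuous_compact_support[OF _ c partial_deriv_outside_support]) (use f in auto)
  have "partial_deriv i ?g = (\<lambda>x. partial_deriv i f x \<bullet> b)"
    using f by (intro ext partial_deriv_bounded_linear[OF bounded_linear_inner_left]) auto
  then show "(\<integral>x. partial_deriv i f x \<partial>lborel) \<bullet> b = 0 \<bullet> b"
    using integral_partial_deriv_real[OF g c', of i] int by simp
qed

lemma closure_support_subset:
  assumes "\<And>x. f x = 0 \<Longrightarrow> g x = 0" "compact (closure {x. f x \<noteq> 0})"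
  shows "closure {x. g x \<noteq> 0} \<subseteq> closure {x. f x \<noteq> 0}" "compact (closure {x. g x \<noteq> 0})"
proof -
  show *: "closure {x. g x \<noteq> 0} \<subseteq> closure {x. f x \<noteq> 0}" by (rule closure_mono) (use assms in auto)
  show "compact (closure {x. g x \<noteq> 0})"
    by (rule compact_closure_subset[OF assms(2) *])
qed

text \<open>One compactly supported factor suffices: both integrands and the product being
  differentiated then vanish off its support. This lets the other factor be a plane wave.\<close>

lemma integral_by_parts:
  fixes f :: "real^'n \<Rightarrow> real" and g :: "real^'n \<Rightarrow> 'b::euclidean_space"
  assumes f: "cont_diff 1 f" and g: "cont_diff 1 g"
    and c: "compact (closure {x. f x \<noteq> 0}) \<or> compact (closure {x. g x \<noteq> 0})"
  shows "(\<integral>x. partial_deriv i f x *\<^sub>R g x \<partial>lborel) = - (\<integral>x. f x *\<^sub>R partial_deriv i g x \<partial>lborel)"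
proof -
  obtain K where K: "compact K" "\<And>x. x \<notin> K \<Longrightarrow> f x *\<^sub>R partial_deriv i g x = 0"
    "\<And>x. x \<notin> K \<Longrightarrow> partial_deriv i f x *\<^sub>R g x = 0"
    "closure {x. f x *\<^sub>R g x \<noteq> 0} \<subseteq> K"
  proof -
    consider "compact (closure {x. f x \<noteq> 0})" | "compact (closure {x. g x \<noteq> 0})" using c by blast
    then show ?thesis
    proof cases
      case 1
      have *: "f x = 0 \<and> partial_deriv i f x = 0" if "x \<notin> closure {x. f x \<noteq> 0}" for x
        using partial_deriv_outside_support[OF that] zero_outside_support[OF that] by simp
      have a: "f x *\<^sub>R partial_deriv i g x = 0" "partial_deriv i f x *\<^sub>R g x = 0"
        if out: "x \<notin> closure {x. f x \<noteq> 0}" for x by (simp_all only: *[OF out] scaleR_zero_left scaleR_zero_right)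
      have cl: "closure {x. f x *\<^sub>R g x \<noteq> 0} \<subseteq> closure {x. f x \<noteq> 0}" by (rule closure_mono) auto
      show ?thesis by (rule that[OF 1 _ _ cl]; rule a)
    next
      case 2
      have *: "g x = 0 \<and> partial_deriv i g x = 0" if "x \<notin> closure {x. g x \<noteq> 0}" for x
        using partial_deriv_outside_support[OF that] zero_outside_support[OF that] by simp
      have a: "f x *\<^sub>R partial_deriv i g x = 0" "partial_deriv i f x *\<^sub>R g x = 0"
        if out: "x \<notin> closure {x. g x \<noteq> 0}" for x by (simp_all only: *[OF out] scaleR_zero_left scaleR_zero_right)
      have cl: "closure {x. f x *\<^sub>R g x \<noteq> 0} \<subseteq> closure {x. g x \<noteq> 0}" by (rule closure_mono) auto
      show ?thesis by (rule that[OF 2 _ _ cl]; rule a)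
    qed
  qed
  have cont: "continuous_on UNIV f" "continuous_on UNIV g"
    "continuous_on UNIV (partial_deriv i f)" "continuous_on UNIV (partial_deriv i g)"
    using cont_diff_continuous[OF f] cont_diff_continuous[OF g] f g by auto
  have int: "integrable lborel (\<lambda>x. f x *\<^sub>R partial_deriv i g x)"
    "integrable lborel (\<lambda>x. partial_deriv i f x *\<^sub>R g x)"
    by (rule integrable_continuous_compact_support[OF _ K(1)]; use cont K in \<open>auto intro!: continuous_intros\<close>)+
  have "partial_deriv i (\<lambda>x. f x *\<^sub>R g x)
      = (\<lambda>x. f x *\<^sub>R partial_deriv i g x + partial_deriv i f x *\<^sub>R g x)"
    by (intro ext partial_deriv_bounded_bilinear bounded_bilinear_scaleR) (use f g in auto)
  moreover have "(\<integral>x. partial_deriv i (\<lambda>x. f x *\<^sub>R g x) x \<partial>lborel) = 0"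
  proof (rule integral_partial_deriv)
    show "cont_diff 1 (\<lambda>x. f x *\<^sub>R g x)" by (intro cont_diff_scaleR f g)
    show "compact (closure {x. f x *\<^sub>R g x \<noteq> 0})"
      by (rule compact_closure_subset[OF K(1,4)])
  qed
  ultimately show ?thesis using int by (simp add: add_eq_0_iff)
qed

section \<open>Test functions\<close>

lemma test_functions_cont_diff: "\<phi> \<in> test_functions \<Omega> \<Longrightarrow> cont_diff k \<phi>"
  unfolding test_functions_def by blast

lemma test_functions_continuous: "\<phi> \<in> test_functions \<Omega> \<Longrightarrow> continuous_on UNIV \<phi>"
  using test_functions_cont_diff cont_diff_continuous by blast

lemma test_functions_compact: "\<phi> \<in> test_functions \<Omega> \<Longrightarrow> compact (closure {x. \<phi> x \<noteq> 0})"
  unfolding test_functions_def by blast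

lemma test_functions_outside: "\<phi> \<in> test_functions \<Omega> \<Longrightarrow> x \<notin> \<Omega> \<Longrightarrow> \<phi> x = 0"
  unfolding test_functions_def using zero_outside_support[of x \<phi>] by blast

lemma test_functions_subordinate:
  assumes "\<psi> \<in> test_functions \<Omega>" "\<And>k. cont_diff k \<phi>" "\<And>x. \<psi> x = 0 \<Longrightarrow> \<phi> x = 0"
  shows "\<phi> \<in> test_functions \<Omega>"
  using assms closure_support_subset[of \<psi> \<phi>] unfolding test_functions_def by blast

lemma test_functions_partial_deriv:
  assumes "\<phi> \<in> test_functions \<Omega>"
  shows "partial_deriv i \<phi> \<in> test_functions \<Omega>"
proof -
  have *: "closure {x. partial_deriv i \<phi> x \<noteq> 0} \<subseteq> closure {x. \<phi> x \<noteq> 0}"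
    by (rule closure_minimal) (use partial_deriv_outside_support[of _ \<phi> i] in auto)
  then have "compact (closure {x. partial_deriv i \<phi> x \<noteq> 0})"
    by (rule compact_closure_subset[OF test_functions_compact[OF assms]])
  moreover have "cont_diff k (partial_deriv i \<phi>)" for k
    using test_functions_cont_diff[OF assms, of "Suc k"] by simp
  ultimately show ?thesis using * assms unfolding test_functions_def by blast
qed

lemma test_functions_measurable:
  fixes \<phi> :: "real^'n \<Rightarrow> 'b::euclidean_space"
  assumes "\<phi> \<in> test_functions \<Omega>" shows "\<phi> \<in> borel_measurable borel"
  using test_functions_continuous[OF assms] by (rule borel_measurable_continuous_onI)

text \<open>A product of one-dimensional profiles, supported in the closed box. As \<open>j\<close> grows, each factor
  \<open>exp (- 1 / (j t))\<close> with \<open>t > 0\<close> tends to 1.\<close>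

definition box_bump :: "real^'n \<Rightarrow> real^'n \<Rightarrow> real \<Rightarrow> real^'n \<Rightarrow> real" where
  "box_bump a b j x = (\<Prod>i\<in>UNIV. smooth_step (j * (x $ i - a $ i)) * smooth_step (j * (b $ i - x $ i)))"

lemma smooth_step_bounds: "0 \<le> smooth_step t" "smooth_step t \<le> 1"
  by (auto simp: smooth_step_def)

lemma box_bump_bounds: "0 \<le> box_bump a b j x" "box_bump a b j x \<le> 1"
  unfolding box_bump_def
  by (auto intro!: prod_nonneg prod_le_1 mult_nonneg_nonneg mult_le_one smooth_step_bounds)

lemma cont_diff_box_bump: "cont_diff k (box_bump a b j)"
proof -
  have c: "cont_diff k (\<lambda>x::real^'a. x $ i)" for i
    by (rule cont_diff_bounded_linear[OF bounded_linear_vec_nth cont_diff_ident])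
  have "cont_diff k (\<lambda>x. box_bump a b j x)" unfolding box_bump_def
    by (intro cont_diff_prod cont_diff_mult[OF cont_diff_smooth_step cont_diff_smooth_step]
        cont_diff_mult[OF cont_diff_const] cont_diff_diff c cont_diff_const)
  then show ?thesis by simp
qed

lemma box_bump_outside:
  assumes "j > 0" "x \<notin> box a b" shows "box_bump a b j x = 0"
proof -
  obtain i where "x $ i \<le> a $ i \<or> b $ i \<le> x $ i" using assms by (auto simp: mem_box_cart not_less)
  then have "smooth_step (j * (x $ i - a $ i)) * smooth_step (j * (b $ i - x $ i)) = 0"
    using assms by (auto simp: smooth_step_def mult_le_0_iff)
  then show ?thesis unfolding box_bump_def by (meson UNIV_I finite prod_zero)
qed

lemma smooth_step_tendsto_1:
  assumes "t > 0" shows "(\<lambda>m. smooth_step (real (Suc m) * t)) \<longlonglongrightarrow> 1"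
proof -
  have "(\<lambda>m. exp (- ((1 / t) * inverse (real (Suc m))))) \<longlonglongrightarrow> exp (- ((1 / t) * 0))"
    by (intro tendsto_intros LIMSEQ_inverse_real_of_nat)
  moreover have "exp (- ((1 / t) * inverse (real (Suc m)))) = smooth_step (real (Suc m) * t)" for m
  proof -
    have "0 < real (Suc m) * t" using assms by simp
    then show ?thesis unfolding smooth_step_def by (simp add: field_simps del: of_nat_Suc)
  qed
  ultimately show ?thesis by simp
qed

lemma box_bump_tendsto_1:
  assumes "x \<in> box a b" shows "(\<lambda>m. box_bump a b (real (Suc m)) x) \<longlonglongrightarrow> 1"
proof -
  have "(\<lambda>m. \<Prod>i\<in>UNIV. smooth_step (real (Suc m) * (x $ i - a $ i)) * smooth_step (real (Suc m) * (b $ i - x $ i)))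
      \<longlonglongrightarrow> (\<Prod>i\<in>(UNIV::'a set). 1 * 1)"
    using assms by (intro tendsto_prod tendsto_mult smooth_step_tendsto_1) (auto simp: mem_box_cart)
  then show ?thesis by (simp add: box_bump_def)
qed

text \<open>Every open set is a countable union of boxes whose closures it contains, and
  \<open>1 - (1 - \<phi>\<^sub>1) \<dots> (1 - \<phi>\<^sub>m)\<close> is a smooth substitute for the maximum of the bumps
  \<open>\<phi>\<^sub>1, \<dots>, \<phi>\<^sub>m\<close>.\<close>

lemma test_functions_tendsto_indicator:
  fixes U :: "(real^'n) set"
  assumes "open U"
  obtains \<phi> :: "nat \<Rightarrow> real^'n \<Rightarrow> real" where "\<And>m. \<phi> m \<in> test_functions U"
    "\<And>m x. 0 \<le> \<phi> m x \<and> \<phi> m x \<le> 1" "\<And>x. (\<lambda>m. \<phi> m x) \<longlonglongrightarrow> indicator U x"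
proof -
  define \<F> where "\<F> = {box a b | a b. cbox a b \<subseteq> U}"
  have op: "open S" if "S \<in> \<F>" for S using that open_box by (auto simp: \<F>_def)
  obtain \<F>' where F': "\<F>' \<subseteq> \<F>" "countable \<F>'" "\<Union>\<F>' = \<Union>\<F>"
    by (rule Lindelof[OF op])
  have U: "\<Union>\<F>' = U"
  proof -
    have "x \<in> \<Union>\<F>" if xU: "x \<in> U" for x
    proof -
      obtain a b where "x \<in> box a b" "cbox a b \<subseteq> U"
        using open_contains_cbox[OF assms xU] by metis
      then show ?thesis unfolding \<F>_def by blast
    qed
    moreover have "X \<subseteq> U" if XF: "X \<in> \<F>" for X
    proof -
      obtain a b where "X = box a b" "cbox a b \<subseteq> U" using XF unfolding \<F>_def by blast
      then show ?thesis by (metis box_subset_cbox subset_trans)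
    qed
    ultimately show ?thesis unfolding F'(3) by (meson Sup_least subsetI subset_antisym)
  qed
  show ?thesis
  proof (cases "U = {}")
    case True
    show ?thesis
      by (rule that[of "\<lambda>_ _. 0"]) (auto simp: True test_functions_def cont_diff_const)
  next
    case False
    then have "\<F>' \<noteq> {}" using U by auto
    then have ex: "\<exists>a b. from_nat_into \<F>' l = box a b \<and> cbox a b \<subseteq> U" for l
      using F'(1) from_nat_into[of \<F>' l] unfolding \<F>_def by blast
    then obtain a b where ab: "\<And>l. from_nat_into \<F>' l = box (a l) (b l)" "\<And>l. cbox (a l) (b l) \<subseteq> U"
      by metis
    have cov: "\<exists>l. x \<in> box (a l) (b l)" if "x \<in> U" for x
      using that U from_nat_into_surj[OF F'(2)] ab(1) by (metis UnionE)
    define \<phi> where "\<phi> m x = 1 - (\<Prod>l\<le>m. 1 - box_bump (a l) (b l) (real (Suc m)) x)" for m x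
    have bnd: "0 \<le> \<phi> m x \<and> \<phi> m x \<le> 1" for m x
      unfolding \<phi>_def using box_bump_bounds by (auto intro!: prod_nonneg prod_le_1)
    have out: "\<phi> m x = 0" if "x \<notin> (\<Union>l\<le>m. cbox (a l) (b l))" for m x
    proof -
      have "box_bump (a l) (b l) (real (Suc m)) x = 0" if "l \<le> m" for l
        using that \<open>x \<notin> _\<close> box_subset_cbox[of "a l" "b l"] by (intro box_bump_outside) auto
      then show ?thesis by (simp add: \<phi>_def)
    qed
    show ?thesis
    proof
      show "\<phi> m \<in> test_functions U" for m
      proof -
        have "cont_diff k (\<phi> m)" for k
          unfolding \<phi>_def by (intro cont_diff_diff cont_diff_const cont_diff_prod cont_diff_box_bump)
        moreover have cl: "closure {x. \<phi> m x \<noteq> 0} \<subseteq> (\<Union>l\<le>m. cbox (a l) (b l))"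
          by (rule closure_minimal) (use out in \<open>auto intro!: closed_UN\<close>)
        moreover have "compact (\<Union>l\<le>m. cbox (a l) (b l))" by (intro compact_UN) auto
        then have "compact (closure {x. \<phi> m x \<noteq> 0})"
          by (rule compact_closure_subset[OF _ cl])
        ultimately show ?thesis using ab(2) unfolding test_functions_def by blast
      qed
      show "0 \<le> \<phi> m x \<and> \<phi> m x \<le> 1" for m x by (rule bnd)
      show "(\<lambda>m. \<phi> m x) \<longlonglongrightarrow> indicator U x" for x
      proof (cases "x \<in> U")
        case False
        then have "\<phi> m x = 0" for m using out ab(2) by blast
        then show ?thesis using False by simp
      next
        case True
        then obtain l where l: "x \<in> box (a l) (b l)" using cov by blast
        have "box_bump (a l) (b l) (real (Suc m)) x \<le> \<phi> m x" if "m \<ge> l" for m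
        proof -
          have "(\<Prod>l\<le>m. 1 - box_bump (a l) (b l) (real (Suc m)) x)
              = (1 - box_bump (a l) (b l) (real (Suc m)) x)
                * (\<Prod>l\<in>{..m} - {l}. 1 - box_bump (a l) (b l) (real (Suc m)) x)"
            using that by (intro prod.remove) auto
          also have "\<dots> \<le> (1 - box_bump (a l) (b l) (real (Suc m)) x) * 1"
            using box_bump_bounds by (intro mult_left_mono prod_le_1) auto
          finally show ?thesis by (simp add: \<phi>_def)
        qed
        then have "\<forall>\<^sub>F m in sequentially. box_bump (a l) (b l) (real (Suc m)) x \<le> \<phi> m x"
          by (auto simp: eventually_sequentially)
        moreover have "\<forall>\<^sub>F m in sequentially. \<phi> m x \<le> 1" using bnd by (intro always_eventually) blast
        ultimately have "(\<lambda>m. \<phi> m x) \<longlonglongrightarrow> 1"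
          by (rule tendsto_sandwich[OF _ _ box_bump_tendsto_1[OF l] tendsto_const])
        then show ?thesis using True by (simp only: indicator_simps)
      qed
    qed
  qed
qed

section \<open>Square-integrable functions and the fundamental lemma\<close>

locale open_finite_measure =
  fixes \<Omega> :: "(real^'n) set"
  assumes open_Omega: "open \<Omega>" and finite_Omega: "emeasure lebesgue \<Omega> < \<infinity>"
begin

lemma sets_Omega [measurable, simp]: "\<Omega> \<in> sets lebesgue" "\<Omega> \<in> sets borel"
  using open_Omega by (auto simp: lborelD)

lemma finite_measure_Omega: "finite_measure (lebesgue_on \<Omega>)"
  by (rule finite_measure_lebesgue_on) (use finite_Omega in \<open>simp add: fmeasurable_def\<close>)

lemma integral_lebesgue_on_eq_lborel:
  fixes f :: "real^'n \<Rightarrow> 'b::euclidean_space"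
  assumes "f \<in> borel_measurable borel" "\<And>x. x \<notin> \<Omega> \<Longrightarrow> f x = 0"
  shows "(\<integral>x. f x \<partial>lebesgue_on \<Omega>) = (\<integral>x. f x \<partial>lborel)"
proof -
  have eq: "(\<lambda>x. indicator \<Omega> x *\<^sub>R f x) = f" using assms(2) by (auto simp: indicator_def fun_eq_iff)
  have m: "f \<in> lborel \<rightarrow>\<^sub>M borel" using assms(1) by simp
  show "(\<integral>x. f x \<partial>lebesgue_on \<Omega>) = (\<integral>x. f x \<partial>lborel)"
    using integral_restrict_space[of \<Omega> lebesgue f] integral_completion[OF m] by (simp add: eq)
qed

lemma test_functions_mono: "\<phi> \<in> test_functions U \<Longrightarrow> U \<subseteq> \<Omega> \<Longrightarrow> \<phi> \<in> test_functions \<Omega>"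
  unfolding test_functions_def by blast

lemma measurable_lebesgue_on:
  fixes f :: "real^'n \<Rightarrow> 'b::euclidean_space"
  shows "f \<in> borel_measurable borel \<Longrightarrow> f \<in> borel_measurable (lebesgue_on \<Omega>)"
  by (simp add: measurable_completion measurable_restrict_space1)

text \<open>Testing against smooth approximations of indicators shows that \<open>g\<close> has integral zero over every
  open subset. Open sets form an intersection-stable generator of the Borel sets, so the integral
  vanishes over every Borel set, in particular over the sets where \<open>g\<close> is positive or negative.\<close>

lemma fundamental_lemma_real:
  fixes g :: "real^'n \<Rightarrow> real"
  assumes g: "integrable (lebesgue_on \<Omega>) g"
    and orth: "\<And>\<phi>. \<phi> \<in> test_functions \<Omega> \<Longrightarrow> (\<integral>x. \<phi> x * g x \<partial>lebesgue_on \<Omega>) = 0"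
  shows "AE x in lebesgue_on \<Omega>. g x = 0"
proof -
  define h where "h x = indicator \<Omega> x * g x" for x
  have h: "integrable lebesgue h"
    using g integrable_restrict_space[of \<Omega> lebesgue g] by (simp add: h_def[abs_def])
  \<comment> \<open>Dynkin's argument runs on the Borel sets, hence the passage to a Borel representative of the extension by zero.\<close>
  then obtain h' where h'[measurable]: "h' \<in> borel_measurable lborel" and ae: "AE x in lborel. h x = h' x"
    using completion_ex_borel_measurable_real[of h lborel] by auto
  have ae': "AE x in lebesgue. h x = h' x" using ae by (rule AE_completion)
  have mh': "h' \<in> borel_measurable lebesgue" using h' by (rule measurable_completion)
  have "integrable lebesgue h'"
    using integrable_cong_AE[OF borel_measurable_integrable[OF h] mh' ae'] h by simp
  then have int: "integrable lborel h'" using integrable_completion[of h' lborel] h' by simp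
  have *: "(\<integral>x. indicator U x * h' x \<partial>lborel) = 0" if U: "open U" for U
  proof -
    have "open (U \<inter> \<Omega>)" using U open_Omega by auto
    then obtain \<phi> :: "nat \<Rightarrow> real^'n \<Rightarrow> real" where \<phi>: "\<And>m. \<phi> m \<in> test_functions (U \<inter> \<Omega>)"
      "\<And>m x. 0 \<le> \<phi> m x \<and> \<phi> m x \<le> 1" "\<And>x. (\<lambda>m. \<phi> m x) \<longlonglongrightarrow> indicator (U \<inter> \<Omega>) x"
      using test_functions_tendsto_indicator by metis
    have [measurable]: "\<phi> m \<in> borel_measurable borel" for m
      by (rule test_functions_measurable[OF \<phi>(1)])
    have [measurable]: "U \<in> sets borel" using U by simp
    have zero: "(\<integral>x. \<phi> m x * h' x \<partial>lborel) = 0" for m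
    proof -
      have "\<phi> m \<in> test_functions \<Omega>" using test_functions_mono[OF \<phi>(1)] by simp
      then have "0 = (\<integral>x. \<phi> m x * g x \<partial>lebesgue_on \<Omega>)" using orth by simp
      also have "\<dots> = (\<integral>x. \<phi> m x * h x \<partial>lebesgue)"
        by (subst integral_restrict_space) (auto simp: h_def mult.left_commute)
      also have "\<dots> = (\<integral>x. \<phi> m x * h' x \<partial>lebesgue)"
      proof (rule integral_cong_AE)
        have m\<phi>: "\<phi> m \<in> borel_measurable lebesgue" by (rule measurable_completion) simp
        show "(\<lambda>x. \<phi> m x * h x) \<in> borel_measurable lebesgue"
          "(\<lambda>x. \<phi> m x * h' x) \<in> borel_measurable lebesgue"
          by (intro borel_measurable_times m\<phi> mh' borel_measurable_integrable[OF h])+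
        show "AE x in lebesgue. \<phi> m x * h x = \<phi> m x * h' x" using ae' by eventually_elim simp
      qed
      also have "\<dots> = (\<integral>x. \<phi> m x * h' x \<partial>lborel)"
        by (intro integral_completion) simp
      finally show ?thesis by simp
    qed
    have "(\<lambda>m. \<integral>x. \<phi> m x * h' x \<partial>lborel) \<longlonglongrightarrow> (\<integral>x. indicator (U \<inter> \<Omega>) x * h' x \<partial>lborel)"
    proof (rule integral_dominated_convergence[where w = "\<lambda>x. norm (h' x)"])
      show "AE x in lborel. (\<lambda>m. \<phi> m x * h' x) \<longlonglongrightarrow> indicator (U \<inter> \<Omega>) x * h' x"
        using \<phi>(3) by (intro AE_I2 tendsto_mult_right)
      show "AE x in lborel. norm (\<phi> m x * h' x) \<le> norm (h' x)" for m
        using \<phi>(2) by (intro AE_I2) (auto simp: abs_mult intro!: mult_left_le_one_le)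
    qed (use int in \<open>measurable, auto\<close>)
    then have "(\<integral>x. indicator (U \<inter> \<Omega>) x * h' x \<partial>lborel) = 0"
      by (simp add: zero LIMSEQ_const_iff)
    also have "(\<integral>x. indicator (U \<inter> \<Omega>) x * h' x \<partial>lborel) = (\<integral>x. indicator U x * h' x \<partial>lborel)"
    proof (rule integral_cong_AE)
      show "AE x in lborel. indicator (U \<inter> \<Omega>) x * h' x = indicator U x * h' x"
        using ae by eventually_elim (auto simp: h_def indicator_def split: if_splits)
    qed measurable
    finally show ?thesis .
  qed
  have **: "(\<integral>x. indicator A x * h' x \<partial>lborel) = 0" if A: "A \<in> sets borel" for A
  proof -
    have A': "A \<in> sigma_sets UNIV {S. open S}" using A by (simp add: sets_borel)
    have b: "B \<in> sigma_sets UNIV {S. open S} \<Longrightarrow> B \<in> sets borel" for B :: "(real^'n) set" by (simp add: sets_borel)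
    have i: "integrable lborel (\<lambda>x. indicator B x * h' x)" if "B \<in> sets borel" for B
      using integrable_real_mult_indicator[of B lborel h'] int that by (simp add: mult.commute)
    show ?thesis
    proof (rule sigma_sets_induct_disjoint[OF _ _ A'])
      show "Int_stable {S :: (real^'n) set. open S}" by (auto simp: Int_stable_def)
    next
      fix B assume "B \<in> sigma_sets UNIV {S :: (real^'n) set. open S}" and B: "(\<integral>x. indicator B x * h' x \<partial>lborel) = 0"
      then have "B \<in> sets borel" using b by simp
      have "(\<integral>x. indicator (UNIV - B) x * h' x \<partial>lborel)
        = (\<integral>x. indicator UNIV x * h' x - indicator B x * h' x \<partial>lborel)"
        by (rule Bochner_Integration.integral_cong) (auto simp: indicator_def)
      also have "\<dots> = 0" using B i[of UNIV] i[OF \<open>B \<in> sets borel\<close>] *[of UNIV]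
        by (subst Bochner_Integration.integral_diff) auto
      finally show "(\<integral>x. indicator (UNIV - B) x * h' x \<partial>lborel) = 0" .
    next
      fix B :: "nat \<Rightarrow> (real^'n) set"
      assume dis: "disjoint_family B" and "range B \<subseteq> sigma_sets UNIV {S. open S}"
        and z: "\<And>i. (\<integral>x. indicator (B i) x * h' x \<partial>lborel) = 0"
      then have B: "B i \<in> sets lborel" for i using b by auto
      have si: "set_integrable lborel (\<Union>i. B i) h'"
        unfolding set_integrable_def using i[of "\<Union>i. B i"] B by simp
      have "(\<Sum>i. LINT x:B i|lborel. h' x) = (LINT x:(\<Union>i. B i)|lborel. h' x)"
        by (rule lebesgue_integral_countable_add[symmetric])
          (use B dis si in \<open>auto simp: disjoint_family_on_def\<close>)
      then show "(\<integral>x. indicator (\<Union>i. B i) x * h' x \<partial>lborel) = 0"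
        using z by (simp add: set_lebesgue_integral_def)
    qed (use * in auto)
  qed
  have [measurable]: "{x. h' x > 0} \<in> sets borel" "{x. h' x < 0} \<in> sets borel"
    using h' by (auto simp: borel_measurable_iff_greater borel_measurable_iff_less)
  have "AE x in lborel. indicator {x. h' x > 0} x * h' x = 0"
    using **[of "{x. h' x > 0}"] integrable_real_mult_indicator[of "{x. h' x > 0}" lborel h'] int
    by (subst integral_nonneg_eq_0_iff_AE[symmetric]) (auto simp: indicator_def mult.commute)
  moreover have "AE x in lborel. indicator {x. h' x < 0} x * - h' x = 0"
    using **[of "{x. h' x < 0}"] integrable_real_mult_indicator[of "{x. h' x < 0}" lborel h'] int
    by (subst integral_nonneg_eq_0_iff_AE[symmetric]) (auto simp: indicator_def mult.commute)
  ultimately have "AE x in lborel. h x = 0"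
    using ae by eventually_elim (auto simp: indicator_def split: if_splits)
  then have "AE x in lebesgue. h x = 0" by (rule AE_completion)
  then show ?thesis
    by (subst AE_restrict_space_iff) (auto simp: h_def indicator_def elim: eventually_mono)
qed

lemma
  fixes f :: "real^'n \<Rightarrow> 'b::euclidean_space"
  assumes "f \<in> L2 \<Omega>"
  shows L2_measurable: "f \<in> borel_measurable (lebesgue_on \<Omega>)"
    and L2_integrable_square: "integrable (lebesgue_on \<Omega>) (\<lambda>x. (norm (f x))\<^sup>2)"
  using assms by (auto simp: L2_def)

lemma L2_integrable_inner:
  fixes f g :: "real^'n \<Rightarrow> 'b::euclidean_space"
  assumes "f \<in> L2 \<Omega>" "g \<in> L2 \<Omega>"
  shows "integrable (lebesgue_on \<Omega>) (\<lambda>x. f x \<bullet> g x)"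
proof (rule Bochner_Integration.integrable_bound)
  show "integrable (lebesgue_on \<Omega>) (\<lambda>x. (norm (f x))\<^sup>2 + (norm (g x))\<^sup>2)"
    by (intro Bochner_Integration.integrable_add L2_integrable_square assms)
  show "AE x in lebesgue_on \<Omega>. norm (f x \<bullet> g x) \<le> norm ((norm (f x))\<^sup>2 + (norm (g x))\<^sup>2)"
  proof (rule AE_I2)
    fix x
    have "norm (f x \<bullet> g x) \<le> norm (f x) * norm (g x)" by (simp add: Cauchy_Schwarz_ineq2)
    also have "\<dots> \<le> (norm (f x))\<^sup>2 + (norm (g x))\<^sup>2"
      using sum_squares_bound[of "norm (f x)" "norm (g x)"]
        mult_nonneg_nonneg[OF norm_ge_zero[of "f x"] norm_ge_zero[of "g x"]] by linarith
    finally show "norm (f x \<bullet> g x) \<le> norm ((norm (f x))\<^sup>2 + (norm (g x))\<^sup>2)" by simp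
  qed
qed (use assms[THEN L2_measurable] in simp)

lemma L2_add:
  fixes f g :: "real^'n \<Rightarrow> 'b::euclidean_space"
  assumes "f \<in> L2 \<Omega>" "g \<in> L2 \<Omega>"
  shows "(\<lambda>x. f x + g x) \<in> L2 \<Omega>"
proof -
  have "(\<lambda>x. (norm (f x + g x))\<^sup>2) = (\<lambda>x. (norm (f x))\<^sup>2 + (norm (g x))\<^sup>2 + 2 * (f x \<bullet> g x))"
    by (auto simp: power2_norm_eq_inner inner_add inner_commute)
  then show ?thesis
    using assms L2_integrable_inner[OF assms] by (auto simp: L2_def)
qed

lemma L2_scaleR: "f \<in> L2 \<Omega> \<Longrightarrow> (\<lambda>x. c *\<^sub>R f x) \<in> L2 \<Omega>"
  by (auto simp: L2_def power_mult_distrib)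

lemma L2_diff: "f \<in> L2 \<Omega> \<Longrightarrow> g \<in> L2 \<Omega> \<Longrightarrow> (\<lambda>x. f x - g x) \<in> L2 \<Omega>"
  using L2_add[of f "\<lambda>x. (- 1) *\<^sub>R g x"] L2_scaleR[of g "- 1"] by simp

lemma L2_zero: "(\<lambda>x. 0) \<in> L2 \<Omega>"
  by (auto simp: L2_def)

lemma L2_sum: "(\<And>i. i \<in> A \<Longrightarrow> f i \<in> L2 \<Omega>) \<Longrightarrow> (\<lambda>x. \<Sum>i\<in>A. f i x) \<in> L2 \<Omega>"
  by (induction A rule: infinite_finite_induct) (auto simp: L2_zero intro: L2_add)

lemma L2_bounded:
  fixes f :: "real^'n \<Rightarrow> 'b::euclidean_space"
  assumes "f \<in> borel_measurable (lebesgue_on \<Omega>)" "\<And>x. norm (f x) \<le> B"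
  shows "f \<in> L2 \<Omega>"
proof -
  interpret finite_measure "lebesgue_on \<Omega>" by (rule finite_measure_Omega)
  have "integrable (lebesgue_on \<Omega>) (\<lambda>x. (norm (f x))\<^sup>2)"
    by (rule integrable_const_bound[where B="B\<^sup>2"]) (use assms in \<open>auto intro!: power_mono\<close>)
  then show ?thesis using assms by (auto simp: L2_def)
qed

lemma L2_scaleR_bounded:
  fixes f :: "real^'n \<Rightarrow> 'b::euclidean_space" and \<phi> :: "real^'n \<Rightarrow> real"
  assumes "f \<in> L2 \<Omega>" "\<phi> \<in> borel_measurable borel" "\<And>x. \<bar>\<phi> x\<bar> \<le> B"
  shows "(\<lambda>x. \<phi> x *\<^sub>R f x) \<in> L2 \<Omega>"
proof -
  have m: "\<phi> \<in> borel_measurable (lebesgue_on \<Omega>)" by (rule measurable_lebesgue_on[OF assms(2)])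
  have "integrable (lebesgue_on \<Omega>) (\<lambda>x. (norm (\<phi> x *\<^sub>R f x))\<^sup>2)"
  proof (rule Bochner_Integration.integrable_bound)
    show "integrable (lebesgue_on \<Omega>) (\<lambda>x. B\<^sup>2 * (norm (f x))\<^sup>2)"
      by (intro integrable_mult_right L2_integrable_square assms)
    show "AE x in lebesgue_on \<Omega>. norm ((norm (\<phi> x *\<^sub>R f x))\<^sup>2) \<le> norm (B\<^sup>2 * (norm (f x))\<^sup>2)"
    proof (rule AE_I2)
      fix x
      have "(\<phi> x)\<^sup>2 \<le> B\<^sup>2" using power_mono[OF assms(3) abs_ge_zero, of x 2] by simp
      then show "norm ((norm (\<phi> x *\<^sub>R f x))\<^sup>2) \<le> norm (B\<^sup>2 * (norm (f x))\<^sup>2)"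
        by (simp add: power_mult_distrib mult_right_mono)
    qed
  next
    have "(\<lambda>x. \<phi> x *\<^sub>R f x) \<in> borel_measurable (lebesgue_on \<Omega>)"
      by (intro borel_measurable_scaleR m L2_measurable assms)
    then show "(\<lambda>x. (norm (\<phi> x *\<^sub>R f x))\<^sup>2) \<in> borel_measurable (lebesgue_on \<Omega>)"
      by measurable
  qed
  then show ?thesis using m L2_measurable[OF assms(1)] by (auto simp: L2_def)
qed

lemma L2_integrable:
  fixes f :: "real^'n \<Rightarrow> 'b::euclidean_space"
  assumes "f \<in> L2 \<Omega>"
  shows "integrable (lebesgue_on \<Omega>) f"
proof (rule Bochner_Integration.integrable_bound)
  interpret finite_measure "lebesgue_on \<Omega>" by (rule finite_measure_Omega)
  show "integrable (lebesgue_on \<Omega>) (\<lambda>x. 1 + (norm (f x))\<^sup>2)"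
    by (intro Bochner_Integration.integrable_add L2_integrable_square assms integrable_const)
  have "norm y \<le> 1 + (norm y)\<^sup>2" for y :: 'b
    using sum_squares_bound[of 1 "norm y"] norm_ge_zero[of y] unfolding power_one by linarith
  then show "AE x in lebesgue_on \<Omega>. norm (f x) \<le> norm (1 + (norm (f x))\<^sup>2)"
    by (intro AE_I2) simp
qed (use assms[THEN L2_measurable] in simp)

lemma test_functions_L2:
  fixes \<phi> :: "real^'n \<Rightarrow> 'b::euclidean_space"
  assumes "\<phi> \<in> test_functions \<Omega>"
  shows "\<phi> \<in> L2 \<Omega>"
  using bounded_continuous_compact_support[OF test_functions_continuous[OF assms] test_functions_compact[OF assms]
    zero_outside_support[of _ \<phi>]] L2_bounded measurable_lebesgue_on test_functions_measurable[OF assms] by metis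

lemma test_functions_scaleR_integrable:
  fixes f :: "real^'n \<Rightarrow> 'b::euclidean_space" and \<phi> :: "real^'n \<Rightarrow> real"
  assumes "\<phi> \<in> test_functions \<Omega>" "f \<in> L2 \<Omega>"
  shows "integrable (lebesgue_on \<Omega>) (\<lambda>x. \<phi> x *\<^sub>R f x)"
proof -
  obtain B where "\<And>x. norm (\<phi> x) \<le> B"
    using bounded_continuous_compact_support[OF test_functions_continuous[OF assms(1)] test_functions_compact[OF assms(1)]
    zero_outside_support[of _ \<phi>]] by metis
  then show ?thesis
    by (intro L2_integrable L2_scaleR_bounded[OF assms(2) test_functions_measurable[OF assms(1)]])
      (simp add: real_norm_def)
qed

lemma fundamental_lemma:
  fixes g :: "real^'n \<Rightarrow> 'b::euclidean_space"
  assumes g: "g \<in> L2 \<Omega>"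
    and orth: "\<And>\<phi>. \<phi> \<in> test_functions \<Omega> \<Longrightarrow> (\<integral>x. \<phi> x *\<^sub>R g x \<partial>lebesgue_on \<Omega>) = 0"
  shows "AE x in lebesgue_on \<Omega>. g x = 0"
proof -
  have "AE x in lebesgue_on \<Omega>. g x \<bullet> b = 0" if "b \<in> Basis" for b
  proof (rule fundamental_lemma_real)
    show "integrable (lebesgue_on \<Omega>) (\<lambda>x. g x \<bullet> b)" using L2_integrable[OF g] by simp
    fix \<phi> :: "real^'n \<Rightarrow> real" assume \<phi>: "\<phi> \<in> test_functions \<Omega>"
    have "(\<integral>x. \<phi> x * (g x \<bullet> b) \<partial>lebesgue_on \<Omega>) = (\<integral>x. (\<phi> x *\<^sub>R g x) \<bullet> b \<partial>lebesgue_on \<Omega>)" by simp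
    also have "\<dots> = (\<integral>x. \<phi> x *\<^sub>R g x \<partial>lebesgue_on \<Omega>) \<bullet> b"
      by (rule integral_inner_left) (use test_functions_scaleR_integrable[OF \<phi> g] in simp)
    finally show "(\<integral>x. \<phi> x * (g x \<bullet> b) \<partial>lebesgue_on \<Omega>) = 0" using orth[OF \<phi>] by simp
  qed
  then have "AE x in lebesgue_on \<Omega>. \<forall>b\<in>Basis. g x \<bullet> b = 0"
    by (subst AE_ball_countable) (auto intro: countable_finite)
  then show ?thesis by eventually_elim (auto intro: euclidean_eqI)
qed

section \<open>Weak derivatives and closures of test functions\<close>

lemma has_weak_partial_unique:
  fixes f g1 g2 :: "real^'n \<Rightarrow> 'b::euclidean_space"
  assumes "g1 \<in> L2 \<Omega>" "g2 \<in> L2 \<Omega>" "has_weak_partial \<Omega> i f g1" "has_weak_partial \<Omega> i f g2"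
  shows "AE x in lebesgue_on \<Omega>. g1 x = g2 x"
proof -
  have "AE x in lebesgue_on \<Omega>. g1 x - g2 x = 0"
  proof (rule fundamental_lemma[OF L2_diff[OF assms(1,2)]])
    fix \<phi> :: "real^'n \<Rightarrow> real" assume \<phi>: "\<phi> \<in> test_functions \<Omega>"
    then have "(\<integral>x. \<phi> x *\<^sub>R g1 x \<partial>lebesgue_on \<Omega>) = (\<integral>x. \<phi> x *\<^sub>R g2 x \<partial>lebesgue_on \<Omega>)"
      using bspec[OF assms(3)[unfolded has_weak_partial_def] \<phi>] bspec[OF assms(4)[unfolded has_weak_partial_def] \<phi>]
      by simp
    then show "(\<integral>x. \<phi> x *\<^sub>R (g1 x - g2 x) \<partial>lebesgue_on \<Omega>) = 0"
      unfolding scaleR_diff_right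
      by (subst Bochner_Integration.integral_diff) (simp_all add: test_functions_scaleR_integrable[OF \<phi>] assms(1,2))
  qed
  then show ?thesis by simp
qed

text \<open>Uniqueness of weak derivatives turns the arbitrary choice behind \<open>weak_partial\<close> into a statement
  about any convenient representative.\<close>

lemma weak_partial_props:
  fixes f g :: "real^'n \<Rightarrow> 'b::euclidean_space"
  assumes "g \<in> L2 \<Omega>" "has_weak_partial \<Omega> i f g"
  shows "weak_partial \<Omega> i f \<in> L2 \<Omega>" "has_weak_partial \<Omega> i f (weak_partial \<Omega> i f)"
    "AE x in lebesgue_on \<Omega>. weak_partial \<Omega> i f x = g x"
proof -
  have "weak_partial \<Omega> i f \<in> L2 \<Omega> \<and> has_weak_partial \<Omega> i f (weak_partial \<Omega> i f)"
    unfolding weak_partial_def by (rule someI[of _ g]) (use assms in auto)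
  then show "weak_partial \<Omega> i f \<in> L2 \<Omega>" "has_weak_partial \<Omega> i f (weak_partial \<Omega> i f)" by auto
  then show "AE x in lebesgue_on \<Omega>. weak_partial \<Omega> i f x = g x"
    using has_weak_partial_unique assms by blast
qed

lemma H1_weak_partial:
  fixes f :: "real^'n \<Rightarrow> 'b::euclidean_space"
  assumes "f \<in> H1 \<Omega>"
  shows "f \<in> L2 \<Omega>" "weak_partial \<Omega> i f \<in> L2 \<Omega>" "has_weak_partial \<Omega> i f (weak_partial \<Omega> i f)"
  using assms weak_partial_props(1,2) unfolding H1_def by blast+

lemma test_functions_has_weak_partial:
  fixes w :: "real^'n \<Rightarrow> 'b::euclidean_space"
  assumes "w \<in> test_functions \<Omega>"
  shows "has_weak_partial \<Omega> i w (partial_deriv i w)"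
  unfolding has_weak_partial_def
proof
  fix \<phi> :: "real^'n \<Rightarrow> real" assume \<phi>: "\<phi> \<in> test_functions \<Omega>"
  note [measurable] = test_functions_measurable[OF \<phi>] test_functions_measurable[OF assms]
    test_functions_measurable[OF test_functions_partial_deriv[OF \<phi>]]
    test_functions_measurable[OF test_functions_partial_deriv[OF assms]]
  have "(\<integral>x. partial_deriv i \<phi> x *\<^sub>R w x \<partial>lborel) = - (\<integral>x. \<phi> x *\<^sub>R partial_deriv i w x \<partial>lborel)"
    by (intro integral_by_parts disjI1 test_functions_cont_diff[OF \<phi>] test_functions_cont_diff[OF assms]
        test_functions_compact[OF \<phi>])
  moreover have "(\<integral>x. partial_deriv i \<phi> x *\<^sub>R w x \<partial>lebesgue_on \<Omega>) = (\<integral>x. partial_deriv i \<phi> x *\<^sub>R w x \<partial>lborel)"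
    by (rule integral_lebesgue_on_eq_lborel) (simp_all add: test_functions_outside[OF assms])
  moreover have "(\<integral>x. \<phi> x *\<^sub>R partial_deriv i w x \<partial>lebesgue_on \<Omega>) = (\<integral>x. \<phi> x *\<^sub>R partial_deriv i w x \<partial>lborel)"
    by (rule integral_lebesgue_on_eq_lborel) (simp_all add: test_functions_outside[OF \<phi>])
  ultimately show "(\<integral>x. partial_deriv i \<phi> x *\<^sub>R w x \<partial>lebesgue_on \<Omega>) = - (\<integral>x. \<phi> x *\<^sub>R partial_deriv i w x \<partial>lebesgue_on \<Omega>)"
    by simp
qed

lemma has_weak_partial_diff:
  fixes f g :: "real^'n \<Rightarrow> 'b::euclidean_space"
  assumes "f \<in> L2 \<Omega>" "g \<in> L2 \<Omega>" "f' \<in> L2 \<Omega>" "g' \<in> L2 \<Omega>"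
    "has_weak_partial \<Omega> i f f'" "has_weak_partial \<Omega> i g g'"
  shows "has_weak_partial \<Omega> i (\<lambda>x. f x - g x) (\<lambda>x. f' x - g' x)"
  unfolding has_weak_partial_def
proof
  fix \<phi> :: "real^'n \<Rightarrow> real" assume \<phi>: "\<phi> \<in> test_functions \<Omega>"
  note int = test_functions_scaleR_integrable[OF \<phi>] test_functions_scaleR_integrable[OF test_functions_partial_deriv[OF \<phi>]]
  show "(\<integral>x. partial_deriv i \<phi> x *\<^sub>R (f x - g x) \<partial>lebesgue_on \<Omega>)
      = - (\<integral>x. \<phi> x *\<^sub>R (f' x - g' x) \<partial>lebesgue_on \<Omega>)"
    using bspec[OF assms(5)[unfolded has_weak_partial_def] \<phi>] bspec[OF assms(6)[unfolded has_weak_partial_def] \<phi>]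
    by (simp add: scaleR_diff_right int assms(1-4))
qed

lemma L2_norm_sq: "(L2_norm \<Omega> f)\<^sup>2 = L2_inner \<Omega> f f"
  unfolding L2_norm_def L2_inner_def by (simp add: Bochner_Integration.integral_nonneg)

lemma L2_norm_nonneg: "0 \<le> L2_norm \<Omega> f"
  unfolding L2_norm_def L2_inner_def by (simp add: Bochner_Integration.integral_nonneg)

lemma L2_inner_self_nonneg: "0 \<le> L2_inner \<Omega> f f"
  unfolding L2_inner_def by (simp add: Bochner_Integration.integral_nonneg)

lemma L2_inner_commute: "L2_inner \<Omega> f g = L2_inner \<Omega> g f"
  unfolding L2_inner_def by (simp add: inner_commute)

lemma L2_inner_scaleR_left: "L2_inner \<Omega> (\<lambda>x. c *\<^sub>R f x) h = c * L2_inner \<Omega> f h"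
  unfolding L2_inner_def by simp

lemma L2_inner_scaleR_right: "L2_inner \<Omega> h (\<lambda>x. c *\<^sub>R f x) = c * L2_inner \<Omega> h f"
  unfolding L2_inner_def by simp

lemma L2_inner_sum_left:
  "(\<And>i. i \<in> A \<Longrightarrow> f i \<in> L2 \<Omega>) \<Longrightarrow> h \<in> L2 \<Omega> \<Longrightarrow>
    L2_inner \<Omega> (\<lambda>x. \<Sum>i\<in>A. f i x) h = (\<Sum>i\<in>A. L2_inner \<Omega> (f i) h)"
  unfolding L2_inner_def inner_sum_left
  by (rule Bochner_Integration.integral_sum) (auto intro: L2_integrable_inner)

lemma L2_norm_sq_add:
  assumes "f \<in> L2 \<Omega>" "g \<in> L2 \<Omega>"
  shows "(L2_norm \<Omega> (\<lambda>x. f x + g x))\<^sup>2 = (L2_norm \<Omega> f)\<^sup>2 + 2 * L2_inner \<Omega> f g + (L2_norm \<Omega> g)\<^sup>2"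
proof -
  have "L2_inner \<Omega> (\<lambda>x. f x + g x) (\<lambda>x. f x + g x)
      = (\<integral>x. f x \<bullet> f x + 2 * (f x \<bullet> g x) + g x \<bullet> g x \<partial>lebesgue_on \<Omega>)"
    unfolding L2_inner_def
    by (rule Bochner_Integration.integral_cong) (simp_all add: inner_add_left inner_add_right inner_commute)
  also have "\<dots> = L2_inner \<Omega> f f + 2 * L2_inner \<Omega> f g + L2_inner \<Omega> g g"
    unfolding L2_inner_def by (simp add: L2_integrable_inner assms)
  finally show ?thesis by (simp only: L2_norm_sq)
qed

lemma L2_Cauchy_Schwarz:
  assumes "f \<in> L2 \<Omega>" "g \<in> L2 \<Omega>"
  shows "\<bar>L2_inner \<Omega> f g\<bar> \<le> L2_norm \<Omega> f * L2_norm \<Omega> g"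
proof -
  have "0 \<le> L2_inner \<Omega> f f + 2 * t * L2_inner \<Omega> f g + t\<^sup>2 * L2_inner \<Omega> g g" for t
    using L2_norm_sq_add[OF assms(1) L2_scaleR[OF assms(2), of t]]
      zero_le_power2[of "L2_norm \<Omega> (\<lambda>x. f x + t *\<^sub>R g x)"]
    unfolding L2_norm_sq L2_inner_scaleR_left L2_inner_scaleR_right by (simp add: power2_eq_square mult.assoc)
  then have *: "0 \<le> L2_inner \<Omega> g g * t\<^sup>2 + (2 * L2_inner \<Omega> f g) * t + L2_inner \<Omega> f f" for t
    by (simp add: algebra_simps)
  have "(L2_inner \<Omega> f g)\<^sup>2 \<le> L2_inner \<Omega> f f * L2_inner \<Omega> g g"
  proof (cases "L2_inner \<Omega> g g = 0")
    case False
    then show ?thesis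
      using *[of "- L2_inner \<Omega> f g / L2_inner \<Omega> g g"] L2_inner_self_nonneg[of g]
      by (simp add: field_simps power2_eq_square)
  next
    case True
    have "L2_inner \<Omega> f g = 0"
    proof (rule ccontr)
      \<comment> \<open>The quadratic degenerates to an affine function of \<open>t\<close>, which takes the value \<open>-1\<close> at this \<open>t\<close>.\<close>
      assume "L2_inner \<Omega> f g \<noteq> 0"
      then show False using *[of "- (L2_inner \<Omega> f f + 1) / (2 * L2_inner \<Omega> f g)"] True by simp
    qed
    then show ?thesis using True by simp
  qed
  then have "(L2_inner \<Omega> f g)\<^sup>2 \<le> (L2_norm \<Omega> f * L2_norm \<Omega> g)\<^sup>2"
    by (simp add: power_mult_distrib L2_norm_sq)
  then show ?thesis using L2_norm_nonneg by (metis abs_le_square_iff abs_of_nonneg mult_nonneg_nonneg)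
qed

lemma L2_norm_triangle:
  assumes "f \<in> L2 \<Omega>" "g \<in> L2 \<Omega>"
  shows "L2_norm \<Omega> (\<lambda>x. f x + g x) \<le> L2_norm \<Omega> f + L2_norm \<Omega> g"
proof (rule power2_le_imp_le)
  show "(L2_norm \<Omega> (\<lambda>x. f x + g x))\<^sup>2 \<le> (L2_norm \<Omega> f + L2_norm \<Omega> g)\<^sup>2"
    using L2_norm_sq_add[OF assms] L2_Cauchy_Schwarz[OF assms] by (simp add: power2_sum)
qed (simp add: L2_norm_nonneg)

lemma L2_norm_minus: "L2_norm \<Omega> (\<lambda>x. f x - g x) = L2_norm \<Omega> (\<lambda>x. g x - f x)"
  unfolding L2_norm_def L2_inner_def
  by (intro arg_cong[where f=sqrt] Bochner_Integration.integral_cong) (auto simp: algebra_simps inner_commute)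

lemma L2_norm_tendsto:
  assumes "\<And>m. w m \<in> L2 \<Omega>" "u \<in> L2 \<Omega>" "(\<lambda>m. L2_norm \<Omega> (\<lambda>x. u x - w m x)) \<longlonglongrightarrow> 0"
  shows "(\<lambda>m. L2_norm \<Omega> (w m)) \<longlonglongrightarrow> L2_norm \<Omega> u"
proof (rule LIM_zero_cancel, rule tendsto_rabs_zero_cancel, rule tendsto_sandwich[OF _ _ tendsto_const assms(3)])
  show "\<forall>\<^sub>F m in sequentially. 0 \<le> \<bar>L2_norm \<Omega> (w m) - L2_norm \<Omega> u\<bar>" by simp
  show "\<forall>\<^sub>F m in sequentially. \<bar>L2_norm \<Omega> (w m) - L2_norm \<Omega> u\<bar> \<le> L2_norm \<Omega> (\<lambda>x. u x - w m x)"
  proof (rule always_eventually, rule)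
    fix m
    have "L2_norm \<Omega> u \<le> L2_norm \<Omega> (\<lambda>x. u x - w m x) + L2_norm \<Omega> (w m)"
      using L2_norm_triangle[OF L2_diff[OF assms(2) assms(1)[of m]] assms(1)[of m]] by simp
    moreover have "L2_norm \<Omega> (w m) \<le> L2_norm \<Omega> (\<lambda>x. u x - w m x) + L2_norm \<Omega> u"
      using L2_norm_triangle[OF L2_diff[OF assms(1)[of m] assms(2)] assms(2)] L2_norm_minus[of u "w m"] by simp
    ultimately show "\<bar>L2_norm \<Omega> (w m) - L2_norm \<Omega> u\<bar> \<le> L2_norm \<Omega> (\<lambda>x. u x - w m x)" by linarith
  qed
qed

lemma L2_norm_cong_AE:
  fixes f g :: "real^'n \<Rightarrow> 'b::euclidean_space"
  assumes "f \<in> L2 \<Omega>" "g \<in> L2 \<Omega>" "AE x in lebesgue_on \<Omega>. f x = g x"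
  shows "L2_norm \<Omega> f = L2_norm \<Omega> g"
proof -
  have "(\<integral>x. f x \<bullet> f x \<partial>lebesgue_on \<Omega>) = (\<integral>x. g x \<bullet> g x \<partial>lebesgue_on \<Omega>)"
    by (rule integral_cong_AE; (intro borel_measurable_inner L2_measurable assms | use assms(3) in \<open>eventually_elim, simp\<close>))
  then show ?thesis by (simp add: L2_norm_def L2_inner_def)
qed

lemma dirichlet_form_self: "dirichlet_form \<Omega> u u = (\<Sum>i\<in>UNIV. (L2_norm \<Omega> (weak_partial \<Omega> i u))\<^sup>2)"
  by (simp add: dirichlet_form_def L2_norm_sq)

lemma dirichlet_form_test:
  assumes "w \<in> test_functions \<Omega>"
  shows "dirichlet_form \<Omega> w w = (\<Sum>i\<in>UNIV. (L2_norm \<Omega> (partial_deriv i w))\<^sup>2)"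
proof -
  have "L2_norm \<Omega> (weak_partial \<Omega> i w) = L2_norm \<Omega> (partial_deriv i w)" for i
    using weak_partial_props[OF test_functions_L2[OF test_functions_partial_deriv[OF assms]]
        test_functions_has_weak_partial[OF assms]] test_functions_L2[OF test_functions_partial_deriv[OF assms]]
    by (intro L2_norm_cong_AE)
  then show ?thesis by (simp add: dirichlet_form_self)
qed

text \<open>The interface to the closures of spaces of test functions. The only delicate point is that the norm in
  which the approximation takes place involves the chosen weak derivative of the difference \<open>u - w\<close>, which
  coincides almost everywhere with the difference of the derivatives.\<close>

lemma H1_closure_approximation:
  fixes u :: "real^'n \<Rightarrow> 'b::euclidean_space"
  assumes S: "S \<subseteq> test_functions \<Omega>" and u: "u \<in> H1_closure \<Omega> S"
  obtains w where "\<And>m. w m \<in> S" "u \<in> L2 \<Omega>"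
    "(\<lambda>m. L2_norm \<Omega> (\<lambda>x. u x - w m x)) \<longlonglongrightarrow> 0"
    "(\<lambda>m. (L2_norm \<Omega> (w m))\<^sup>2) \<longlonglongrightarrow> (L2_norm \<Omega> u)\<^sup>2"
    "(\<lambda>m. \<Sum>i\<in>UNIV. (L2_norm \<Omega> (partial_deriv i (w m)))\<^sup>2) \<longlonglongrightarrow> dirichlet_form \<Omega> u u"
proof -
  have uH: "u \<in> H1 \<Omega>" using u by (simp add: H1_closure_def)
  note uw = H1_weak_partial[OF uH]
  have "\<exists>w\<in>S. H1_norm \<Omega> (\<lambda>x. u x - w x) < 1 / real (Suc m)" for m
    using u unfolding H1_closure_def by simp
  then obtain w where w: "\<And>m. w m \<in> S" "\<And>m. H1_norm \<Omega> (\<lambda>x. u x - w m x) < 1 / real (Suc m)" by metis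
  have wt: "w m \<in> test_functions \<Omega>" for m using w S by blast
  have L: "w m \<in> L2 \<Omega>" "partial_deriv i (w m) \<in> L2 \<Omega>" for m i
    using test_functions_L2 test_functions_partial_deriv wt by blast+
  have part: "L2_norm \<Omega> (weak_partial \<Omega> i (\<lambda>x. u x - w m x)) = L2_norm \<Omega> (\<lambda>x. weak_partial \<Omega> i u x - partial_deriv i (w m) x)"
    for i m
  proof -
    note d = L2_diff[OF uw(2) L(2), of i i m]
    note p = has_weak_partial_diff[OF uw(1) L(1) uw(2) L(2) uw(3) test_functions_has_weak_partial[OF wt], of i m]
    show ?thesis by (rule L2_norm_cong_AE[OF weak_partial_props(1)[OF d p] d weak_partial_props(3)[OF d p]])
  qed
  have le: "L2_norm \<Omega> (\<lambda>x. u x - w m x) \<le> 1 / real (Suc m)"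
    "L2_norm \<Omega> (\<lambda>x. weak_partial \<Omega> i u x - partial_deriv i (w m) x) \<le> 1 / real (Suc m)" for m i
  proof -
    let ?d = "\<lambda>x. u x - w m x"
    have D: "dirichlet_form \<Omega> ?d ?d \<ge> (L2_norm \<Omega> (weak_partial \<Omega> i ?d))\<^sup>2" for i
      unfolding dirichlet_form_self by (rule member_le_sum) auto
    have "L2_norm \<Omega> ?d \<le> H1_norm \<Omega> ?d" "L2_norm \<Omega> (weak_partial \<Omega> i ?d) \<le> H1_norm \<Omega> ?d"
      unfolding H1_norm_def using D[of i] zero_le_power2[of "L2_norm \<Omega> (weak_partial \<Omega> i ?d)"]
        zero_le_power2[of "L2_norm \<Omega> ?d"] by (intro real_le_rsqrt; linarith)+
    then show "L2_norm \<Omega> ?d \<le> 1 / real (Suc m)"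
      "L2_norm \<Omega> (\<lambda>x. weak_partial \<Omega> i u x - partial_deriv i (w m) x) \<le> 1 / real (Suc m)"
      using w(2)[of m] part[of i m] by linarith+
  qed
  have lim: "(\<lambda>m. 1 / real (Suc m)) \<longlonglongrightarrow> 0" by (rule LIMSEQ_inverse_real_of_nat[unfolded inverse_eq_divide])
  have 1: "(\<lambda>m. L2_norm \<Omega> (\<lambda>x. u x - w m x)) \<longlonglongrightarrow> 0"
    by (rule tendsto_sandwich[OF _ _ tendsto_const lim]; intro always_eventually allI L2_norm_nonneg le)
  have 2: "(\<lambda>m. L2_norm \<Omega> (\<lambda>x. weak_partial \<Omega> i u x - partial_deriv i (w m) x)) \<longlonglongrightarrow> 0" for i
    by (rule tendsto_sandwich[OF _ _ tendsto_const lim]; intro always_eventually allI L2_norm_nonneg le)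
  show ?thesis
    by (rule that[of w]) (auto simp: w dirichlet_form_self intro!: uw 1 tendsto_sum tendsto_power L2_norm_tendsto L 2)
qed

end

section \<open>Power spectra and the Plancherel identity\<close>

text \<open>The squared modulus \<open>\<bar>\<integral> exp (-\<i> \<xi> x) f x\<bar>\<^sup>2\<close> of the Fourier transform, written with real
  integrals so that \<open>f\<close> may take values in any Euclidean space.\<close>

definition power_spectrum :: "(real^'n) measure \<Rightarrow> (real^'n \<Rightarrow> 'b::euclidean_space) \<Rightarrow> real^'n \<Rightarrow> real" where
  "power_spectrum M f \<xi> = (norm (\<integral>x. cos (\<xi> \<bullet> x) *\<^sub>R f x \<partial>M))\<^sup>2 + (norm (\<integral>x. sin (\<xi> \<bullet> x) *\<^sub>R f x \<partial>M))\<^sup>2"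

lemma power_spectrum_nonneg: "0 \<le> power_spectrum M f \<xi>"
  by (simp add: power_spectrum_def)

lemma lborel_integral_scale:
  fixes f :: "real^'n \<Rightarrow> 'b::euclidean_space"
  assumes [measurable]: "f \<in> borel_measurable borel" and s: "s > 0"
  shows "(\<integral>x. f x \<partial>lborel) = s ^ CARD('n) *\<^sub>R (\<integral>x. f (s *\<^sub>R x) \<partial>lborel)"
proof -
  have "(\<integral>x. f x \<partial>lborel) = (\<integral>x. f x \<partial>density (distr lborel borel (\<lambda>x. 0 + s *\<^sub>R x)) (\<lambda>_. ennreal (\<bar>s\<bar> ^ DIM(real^'n))))"
    by (subst lborel_affine[of s 0]) (use s in auto)
  also have "\<dots> = (\<integral>x. (\<bar>s\<bar> ^ DIM(real^'n)) *\<^sub>R f x \<partial>distr lborel borel (\<lambda>x. 0 + s *\<^sub>R x))"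
    by (rule integral_density) auto
  also have "\<dots> = (\<integral>x. (\<bar>s\<bar> ^ DIM(real^'n)) *\<^sub>R f (0 + s *\<^sub>R x) \<partial>lborel)"
    by (rule integral_distr) auto
  finally show ?thesis using s by simp
qed

lemma
  fixes f :: "'a::euclidean_space \<Rightarrow> real \<Rightarrow> complex"
  assumes int: "\<And>b. b \<in> Basis \<Longrightarrow> integrable lborel (f b)"
  shows lborel_integral_prod_Basis: "(\<integral>x. (\<Prod>b\<in>Basis. f b (x \<bullet> b)) \<partial>lborel) = (\<Prod>b\<in>Basis. \<integral>t. f b t \<partial>lborel)"
    and lborel_integrable_prod_Basis: "integrable lborel (\<lambda>x. \<Prod>b\<in>Basis. f b (x \<bullet> b))"
proof -
  interpret product_sigma_finite "\<lambda>_ :: 'a. lborel :: real measure" by standard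
  have m: "f b \<in> borel_measurable borel" if "b \<in> Basis" for b using int[OF that] by auto
  have [measurable]: "(\<lambda>x::'a. \<Prod>b\<in>Basis. f b (x \<bullet> b)) \<in> borel_measurable borel"
    by (intro borel_measurable_prod measurable_compose[OF _ m]) auto
  have coord: "(\<Sum>b\<in>Basis. y b *\<^sub>R b) \<bullet> b' = y b'" if "b' \<in> Basis" for y and b' :: 'a
    using that by (simp add: inner_sum_left inner_Basis if_distrib[where f = "\<lambda>x. _ * x"] cong: if_cong)
  have e: "(\<Prod>b\<in>Basis. f b ((\<Sum>b\<in>Basis. y b *\<^sub>R b) \<bullet> b)) = (\<Prod>b\<in>Basis. f b (y b))" for y
    by (intro prod.cong refl arg_cong2[where f=f] coord)
  have "(\<integral>x. (\<Prod>b\<in>Basis. f b (x \<bullet> b)) \<partial>lborel)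
      = (\<integral>y. (\<Prod>b\<in>Basis. f b ((\<Sum>b\<in>Basis. y b *\<^sub>R b) \<bullet> b)) \<partial>(\<Pi>\<^sub>M b\<in>Basis. lborel))"
    unfolding lborel_eq[where 'a='a] by (subst integral_distr) auto
  also have "\<dots> = (\<Prod>b\<in>Basis. \<integral>t. f b t \<partial>lborel)"
    unfolding e by (rule product_integral_prod) (use int in auto)
  finally show "(\<integral>x. (\<Prod>b\<in>Basis. f b (x \<bullet> b)) \<partial>lborel) = (\<Prod>b\<in>Basis. \<integral>t. f b t \<partial>lborel)" .
  have "integrable (\<Pi>\<^sub>M b\<in>Basis. lborel) (\<lambda>y. \<Prod>b\<in>Basis. f b ((\<Sum>b\<in>Basis. y b *\<^sub>R b) \<bullet> b))"
    unfolding e by (rule product_integrable_prod) (use int in auto)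
  then show "integrable lborel (\<lambda>x. \<Prod>b\<in>Basis. f b (x \<bullet> b))"
    unfolding lborel_eq[where 'a='a] by (subst integrable_distr_eq) auto
qed

text \<open>The characteristic function of the standard normal distribution, freed from its normalising factor.\<close>

lemma
  shows integral_gaussian_cis: "(\<integral>x. complex_of_real (exp (- (x\<^sup>2) / 2)) * cis (x * t) \<partial>lborel)
      = complex_of_real (sqrt (2 * pi) * exp (- (t\<^sup>2) / 2))"
    and integrable_gaussian_cis: "integrable lborel (\<lambda>x. complex_of_real (exp (- (x\<^sup>2) / 2)) * cis (x * t))"
proof -
  have d: "complex_of_real (exp (- (x\<^sup>2) / 2)) * cis (x * t)
      = sqrt (2 * pi) *\<^sub>R (std_normal_density x *\<^sub>R iexp (t * x))" for x
    by (simp add: std_normal_density_def cis_conv_exp scaleR_conv_of_real mult.commute)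
  have "char std_normal_distribution t = (\<integral>x. std_normal_density x *\<^sub>R iexp (t * x) \<partial>lborel)"
    unfolding char_def by (rule integral_density) (auto simp: normal_density_nonneg)
  then have c: "(\<integral>x. std_normal_density x *\<^sub>R iexp (t * x) \<partial>lborel) = complex_of_real (exp (- (t\<^sup>2) / 2))"
    by (simp add: char_std_normal_distribution)
  have i: "integrable lborel (\<lambda>x. std_normal_density x *\<^sub>R iexp (t * x))"
  proof (rule Bochner_Integration.integrable_bound)
    show "integrable lborel (\<lambda>x. std_normal_density x)" by (rule integrable_normal_density) simp
    show "AE x in lborel. norm (std_normal_density x *\<^sub>R iexp (t * x)) \<le> norm (std_normal_density x)"
      by (intro AE_I2) (simp add: norm_mult)
  qed measurable
  show "(\<integral>x. complex_of_real (exp (- (x\<^sup>2) / 2)) * cis (x * t) \<partial>lborel)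
      = complex_of_real (sqrt (2 * pi) * exp (- (t\<^sup>2) / 2))"
    unfolding d by (subst integral_scaleR_right) (use c in \<open>simp add: scaleR_conv_of_real\<close>)
  show "integrable lborel (\<lambda>x. complex_of_real (exp (- (x\<^sup>2) / 2)) * cis (x * t))"
    unfolding d by (intro integrable_scaleR_right i)
qed

lemma
  fixes z :: "real^'n"
  shows integral_gaussian_cos: "(\<integral>\<xi>. exp (- ((norm \<xi>)\<^sup>2) / 2) * cos (\<xi> \<bullet> z) \<partial>lborel)
      = sqrt (2 * pi) ^ CARD('n) * exp (- ((norm z)\<^sup>2) / 2)"
    and integrable_gaussian_cos: "integrable lborel (\<lambda>\<xi>. exp (- ((norm \<xi>)\<^sup>2) / 2) * cos (\<xi> \<bullet> z))"
proof -
  let ?g = "\<lambda>b x. complex_of_real (exp (- (x\<^sup>2) / 2)) * cis (x * (z \<bullet> b))"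
  have nsq: "(norm y)\<^sup>2 = (\<Sum>b\<in>Basis. (y \<bullet> b)\<^sup>2)" for y :: "real^'n"
    unfolding power2_norm_eq_inner by (subst euclidean_inner) (simp add: power2_eq_square)
  have ex: "exp (- ((norm y)\<^sup>2) / 2) = (\<Prod>b\<in>Basis. exp (- ((y \<bullet> b)\<^sup>2) / 2))" for y :: "real^'n"
    unfolding nsq by (simp add: sum_negf sum_divide_distrib flip: exp_sum)
  have "(\<Prod>b\<in>Basis. cis ((\<xi> \<bullet> b) * (z \<bullet> b))) = cis (\<xi> \<bullet> z)" for \<xi>
    unfolding euclidean_inner[of \<xi> z] cis_conv_exp by (simp add: sum_distrib_left flip: exp_sum)
  then have p: "(\<Prod>b\<in>Basis. ?g b (\<xi> \<bullet> b)) = complex_of_real (exp (- ((norm \<xi>)\<^sup>2) / 2)) * cis (\<xi> \<bullet> z)" for \<xi>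
    unfolding ex by (simp add: prod.distrib)
  have i: "integrable lborel (\<lambda>\<xi>. complex_of_real (exp (- ((norm \<xi>)\<^sup>2) / 2)) * cis (\<xi> \<bullet> z))"
    using lborel_integrable_prod_Basis[of ?g] integrable_gaussian_cis unfolding p by blast
  have re: "exp (- ((norm \<xi>)\<^sup>2) / 2) * cos (\<xi> \<bullet> z) = Re (complex_of_real (exp (- ((norm \<xi>)\<^sup>2) / 2)) * cis (\<xi> \<bullet> z))" for \<xi>
    by simp
  have "(\<integral>\<xi>. complex_of_real (exp (- ((norm \<xi>)\<^sup>2) / 2)) * cis (\<xi> \<bullet> z) \<partial>lborel)
      = (\<Prod>b\<in>(Basis :: (real^'n) set). complex_of_real (sqrt (2 * pi) * exp (- ((z \<bullet> b)\<^sup>2) / 2)))"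
    using lborel_integral_prod_Basis[of ?g] integrable_gaussian_cis
    unfolding p integral_gaussian_cis by blast
  also have "\<dots> = complex_of_real (sqrt (2 * pi) ^ CARD('n) * exp (- ((norm z)\<^sup>2) / 2))"
    unfolding ex by (simp add: prod.distrib)
  finally have c: "(\<integral>\<xi>. complex_of_real (exp (- ((norm \<xi>)\<^sup>2) / 2)) * cis (\<xi> \<bullet> z) \<partial>lborel)
      = complex_of_real (sqrt (2 * pi) ^ CARD('n) * exp (- ((norm z)\<^sup>2) / 2))" .
  show "(\<integral>\<xi>. exp (- ((norm \<xi>)\<^sup>2) / 2) * cos (\<xi> \<bullet> z) \<partial>lborel)
      = sqrt (2 * pi) ^ CARD('n) * exp (- ((norm z)\<^sup>2) / 2)"
    unfolding re integral_Re[OF i] c by simp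
  show "integrable lborel (\<lambda>\<xi>. exp (- ((norm \<xi>)\<^sup>2) / 2) * cos (\<xi> \<bullet> z))"
    unfolding re by (rule integrable_Re[OF i])
qed

lemma integrable_gaussian: "integrable lborel (\<lambda>\<xi> :: real^'n. exp (- ((norm \<xi>)\<^sup>2) / 2))"
  using integrable_gaussian_cos[of "0 :: real^'n"] by simp

lemma integral_gaussian_scaled:
  fixes z :: "real^'n"
  assumes s: "s > 0"
  shows "(\<integral>\<xi>. exp (- ((norm (s *\<^sub>R \<xi>))\<^sup>2) / 2) * cos (\<xi> \<bullet> z) \<partial>lborel)
      = inverse s ^ CARD('n) * (sqrt (2 * pi) ^ CARD('n) * exp (- ((norm (inverse s *\<^sub>R z))\<^sup>2) / 2))"
proof -
  have "(\<integral>\<xi>. exp (- ((norm (s *\<^sub>R \<xi>))\<^sup>2) / 2) * cos (\<xi> \<bullet> z) \<partial>lborel)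
      = inverse s ^ CARD('n) *\<^sub>R
        (\<integral>\<xi>. exp (- ((norm (s *\<^sub>R (inverse s *\<^sub>R \<xi>)))\<^sup>2) / 2) * cos ((inverse s *\<^sub>R \<xi>) \<bullet> z) \<partial>lborel)"
    by (rule lborel_integral_scale) (use s in auto)
  also have "(\<integral>\<xi>. exp (- ((norm (s *\<^sub>R (inverse s *\<^sub>R \<xi>)))\<^sup>2) / 2) * cos ((inverse s *\<^sub>R \<xi>) \<bullet> z) \<partial>lborel)
      = (\<integral>\<xi>. exp (- ((norm \<xi>)\<^sup>2) / 2) * cos (\<xi> \<bullet> (inverse s *\<^sub>R z)) \<partial>lborel)"
    using s by simp
  finally show ?thesis by (simp only: integral_gaussian_cos real_scaleR_def)
qed

lemma integrable_gaussian_scaled: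
  assumes s: "s > 0"
  shows "integrable lborel (\<lambda>\<xi> :: real^'n. exp (- ((norm (s *\<^sub>R \<xi>))\<^sup>2) / 2))"
proof (rule ccontr)
  \<comment> \<open>The integral of a non-integrable function is 0 by convention, whereas this one is positive.\<close>
  assume "\<not> integrable lborel (\<lambda>\<xi> :: real^'n. exp (- ((norm (s *\<^sub>R \<xi>))\<^sup>2) / 2))"
  then have "(\<integral>\<xi>. exp (- ((norm (s *\<^sub>R \<xi>))\<^sup>2) / 2) * cos (\<xi> \<bullet> (0 :: real^'n)) \<partial>lborel) = 0"
    by (simp add: not_integrable_integral_eq)
  then show False unfolding integral_gaussian_scaled[OF s] using s by simp
qed

locale continuous_compact_support =
  fixes f :: "real^'n \<Rightarrow> 'b::euclidean_space" and K :: "(real^'n) set"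
  assumes cont: "continuous_on UNIV f" and compact_K: "compact K" and outside: "\<And>x. x \<notin> K \<Longrightarrow> f x = 0"
begin

lemma f_measurable [measurable]: "f \<in> borel_measurable borel"
  using cont by (rule borel_measurable_continuous_onI)

lemma f_integrable: "integrable lborel f"
  by (rule integrable_continuous_compact_support[OF cont compact_K outside])

definition autocorrelation :: "real^'n \<Rightarrow> real" where
  "autocorrelation z = (\<integral>x. f x \<bullet> f (x + z) \<partial>lborel)"

lemma integrable_modulated:
  fixes h :: "real^'n \<Rightarrow> real"
  assumes "continuous_on UNIV h"
  shows "integrable lborel (\<lambda>x. h x *\<^sub>R f x)"
  by (rule integrable_continuous_compact_support[OF _ compact_K])
    (use assms cont outside in \<open>auto intro!: continuous_on_scaleR\<close>)

lemma integrable_correlation_pair: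
  "integrable (lborel \<Otimes>\<^sub>M lborel) (\<lambda>(x, z). cos (\<xi> \<bullet> z) * (f x \<bullet> f (x + z)))"
proof -
  let ?D = "K \<times> (\<lambda>(x, y). y - x) ` (K \<times> K)"
  let ?F = "\<lambda>p. cos (\<xi> \<bullet> snd p) * (f (fst p) \<bullet> f (fst p + snd p))"
  have "compact ?D"
    by (intro compact_Times compact_K compact_continuous_image)
      (auto intro!: continuous_intros simp: case_prod_beta)
  moreover have "continuous_on UNIV ?F"
    by (intro continuous_intros continuous_on_compose2[OF cont]) auto
  then have "continuous_on ?D ?F" by (rule continuous_on_subset) simp
  ultimately have "integrable lborel (\<lambda>p. indicator ?D p *\<^sub>R ?F p)" by (rule borel_integrable_compact)
  moreover have ind: "indicator ?D p *\<^sub>R ?F p = ?F p" for p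
  proof (cases "p \<in> ?D")
    case False
    have "fst p \<notin> K \<or> fst p + snd p \<notin> K"
    proof (rule ccontr)
      assume "\<not> ?thesis"
      then have "snd p \<in> (\<lambda>(x, y). y - x) ` (K \<times> K)" "fst p \<in> K"
        by (auto intro!: image_eqI[of _ _ "(fst p, fst p + snd p)"])
      then have "p \<in> ?D" by (simp only: mem_Times_iff)
      then show False using False by simp
    qed
    then show ?thesis using outside by auto
  qed simp
  ultimately have "integrable lborel ?F" by (simp only: ind)
  then show ?thesis by (simp add: lborel_prod split_beta')
qed

lemma inner_integrals:
  fixes h k :: "real^'n \<Rightarrow> real"
  assumes "continuous_on UNIV h" "continuous_on UNIV k"
  shows "(\<integral>x. h x *\<^sub>R f x \<partial>lborel) \<bullet> (\<integral>x. k x *\<^sub>R f x \<partial>lborel)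
      = (\<integral>x. (\<integral>y. (h x * k y) * (f x \<bullet> f y) \<partial>lborel) \<partial>lborel)"
proof -
  note i = integrable_modulated[OF assms(1)] integrable_modulated[OF assms(2)]
  have "(\<integral>x. h x *\<^sub>R f x \<partial>lborel) \<bullet> (\<integral>x. k x *\<^sub>R f x \<partial>lborel)
      = (\<integral>x. (h x *\<^sub>R f x) \<bullet> (\<integral>y. k y *\<^sub>R f y \<partial>lborel) \<partial>lborel)"
    by (rule integral_inner_left[symmetric]) (use i in simp)
  also have "\<dots> = (\<integral>x. (\<integral>y. (h x *\<^sub>R f x) \<bullet> (k y *\<^sub>R f y) \<partial>lborel) \<partial>lborel)"
    by (subst integral_inner_right) (use i in simp_all)
  finally show ?thesis by (simp add: mult_ac)
qed

text \<open>The Wiener--Khinchin identity: the power spectrum is the Fourier transform of the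
  autocorrelation. The addition theorem for the cosine combines the two squares into a double integral
  over \<open>cos (\<xi> \<bullet> (y - x))\<close>, and \<open>y = x + z\<close>.\<close>

lemma power_spectrum_autocorrelation:
  "power_spectrum lborel f \<xi> = (\<integral>z. cos (\<xi> \<bullet> z) * autocorrelation z \<partial>lborel)"
proof -
  have c: "continuous_on UNIV (\<lambda>x. cos (\<xi> \<bullet> x))" "continuous_on UNIV (\<lambda>x. sin (\<xi> \<bullet> x))"
    by (intro continuous_intros)+
  have inner_int: "integrable lborel (\<lambda>y. (h x * k y) * (f x \<bullet> f y))"
    if "continuous_on UNIV k" for h k :: "real^'n \<Rightarrow> real" and x
    using integrable_inner_right[of "h x *\<^sub>R f x", OF integrable_modulated[OF that]]
    by (simp add: mult_ac)
  have outer_int: "integrable lborel (\<lambda>x. \<integral>y. (h x * k y) * (f x \<bullet> f y) \<partial>lborel)"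
    if hk: "continuous_on UNIV h" "continuous_on UNIV k" for h k :: "real^'n \<Rightarrow> real"
  proof -
    have "(\<integral>y. (h x * k y) * (f x \<bullet> f y) \<partial>lborel) = (h x *\<^sub>R f x) \<bullet> (\<integral>y. k y *\<^sub>R f y \<partial>lborel)" for x
      by (subst integral_inner_right[symmetric]) (use integrable_modulated[OF hk(2)] in \<open>simp_all add: mult_ac\<close>)
    then show ?thesis using integrable_inner_left[of "\<integral>y. k y *\<^sub>R f y \<partial>lborel", OF integrable_modulated[OF hk(1)]]
      by simp
  qed
  have "power_spectrum lborel f \<xi> = (\<integral>x. (\<integral>y. (cos (\<xi> \<bullet> x) * cos (\<xi> \<bullet> y)) * (f x \<bullet> f y) \<partial>lborel)
      + (\<integral>y. (sin (\<xi> \<bullet> x) * sin (\<xi> \<bullet> y)) * (f x \<bullet> f y) \<partial>lborel) \<partial>lborel)"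
    unfolding power_spectrum_def power2_norm_eq_inner inner_integrals[OF c(1) c(1)] inner_integrals[OF c(2) c(2)]
    by (rule Bochner_Integration.integral_add[symmetric]) (intro outer_int c)+
  also have "\<dots> = (\<integral>x. (\<integral>y. cos (\<xi> \<bullet> (y - x)) * (f x \<bullet> f y) \<partial>lborel) \<partial>lborel)"
  proof (rule Bochner_Integration.integral_cong[OF refl])
    fix x
    have "(\<integral>y. (cos (\<xi> \<bullet> x) * cos (\<xi> \<bullet> y)) * (f x \<bullet> f y) \<partial>lborel)
        + (\<integral>y. (sin (\<xi> \<bullet> x) * sin (\<xi> \<bullet> y)) * (f x \<bullet> f y) \<partial>lborel)
      = (\<integral>y. (cos (\<xi> \<bullet> x) * cos (\<xi> \<bullet> y)) * (f x \<bullet> f y)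
          + (sin (\<xi> \<bullet> x) * sin (\<xi> \<bullet> y)) * (f x \<bullet> f y) \<partial>lborel)"
      by (rule Bochner_Integration.integral_add[symmetric]) (intro inner_int c)+
    also have "\<dots> = (\<integral>y. cos (\<xi> \<bullet> (y - x)) * (f x \<bullet> f y) \<partial>lborel)"
      by (rule Bochner_Integration.integral_cong) (simp_all add: inner_diff_right cos_diff algebra_simps)
    finally show "(\<integral>y. (cos (\<xi> \<bullet> x) * cos (\<xi> \<bullet> y)) * (f x \<bullet> f y) \<partial>lborel)
        + (\<integral>y. (sin (\<xi> \<bullet> x) * sin (\<xi> \<bullet> y)) * (f x \<bullet> f y) \<partial>lborel)
      = (\<integral>y. cos (\<xi> \<bullet> (y - x)) * (f x \<bullet> f y) \<partial>lborel)" .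
  qed
  also have "\<dots> = (\<integral>x. (\<integral>z. cos (\<xi> \<bullet> z) * (f x \<bullet> f (x + z)) \<partial>lborel) \<partial>lborel)"
  proof (rule Bochner_Integration.integral_cong[OF refl])
    fix x
    show "(\<integral>y. cos (\<xi> \<bullet> (y - x)) * (f x \<bullet> f y) \<partial>lborel) = (\<integral>z. cos (\<xi> \<bullet> z) * (f x \<bullet> f (x + z)) \<partial>lborel)"
      by (subst lborel_integral_translate[symmetric, of _ x]) (auto simp: add.commute)
  qed
  also have "\<dots> = (\<integral>z. (\<integral>x. cos (\<xi> \<bullet> z) * (f x \<bullet> f (x + z)) \<partial>lborel) \<partial>lborel)"
    by (rule lborel_pair.Fubini_integral[symmetric]) (rule integrable_correlation_pair)
  finally show ?thesis by (simp add: autocorrelation_def)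
qed

lemma autocorrelation_integrable: "integrable lborel autocorrelation"
  using lborel_pair.integrable_snd[OF integrable_correlation_pair[of 0]]
  by (simp add: autocorrelation_def[abs_def])

lemma autocorrelation_bound: obtains C where "\<And>z. \<bar>autocorrelation z\<bar> \<le> C"
proof -
  obtain B where B: "B \<ge> 0" "\<And>x. norm (f x) \<le> B"
    using bounded_continuous_compact_support[OF cont compact_K outside] by blast
  have le: "norm (f x \<bullet> f (x + z)) \<le> norm (f x) * B" for x z
    using Cauchy_Schwarz_ineq2[of "f x" "f (x + z)"] mult_left_mono[OF B(2)[of "x + z"] norm_ge_zero[of "f x"]]
    by simp
  have int: "integrable lborel (\<lambda>x. norm (f x) * B)" using f_integrable by simp
  have "\<bar>autocorrelation z\<bar> \<le> (\<integral>x. norm (f x) * B \<partial>lborel)" for z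
  proof -
    have "norm (autocorrelation z) \<le> (\<integral>x. norm (f x \<bullet> f (x + z)) \<partial>lborel)"
      unfolding autocorrelation_def by (rule integral_norm_bound)
    also have "\<dots> \<le> (\<integral>x. norm (f x) * B \<partial>lborel)"
      by (rule Bochner_Integration.integral_mono'[OF int le]) (simp add: B(1))
    finally show ?thesis by simp
  qed
  then show ?thesis using that by blast
qed

lemma autocorrelation_tendsto:
  assumes "s \<longlonglongrightarrow> 0"
  shows "(\<lambda>m. autocorrelation (s m)) \<longlonglongrightarrow> (\<integral>x. (norm (f x))\<^sup>2 \<partial>lborel)"
proof -
  obtain B where B: "B \<ge> 0" "\<And>x. norm (f x) \<le> B"
    using bounded_continuous_compact_support[OF cont compact_K outside] by blast
  show ?thesis
    unfolding autocorrelation_def power2_norm_eq_inner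
  proof (rule integral_dominated_convergence[where w = "\<lambda>x. norm (f x) * B"])
    show "integrable lborel (\<lambda>x. norm (f x) * B)" using f_integrable by simp
    show "AE x in lborel. norm (f x \<bullet> f (x + s m)) \<le> norm (f x) * B" for m
    proof (rule AE_I2)
      fix x
      show "norm (f x \<bullet> f (x + s m)) \<le> norm (f x) * B"
        using Cauchy_Schwarz_ineq2[of "f x" "f (x + s m)"] mult_left_mono[OF B(2)[of "x + s m"] norm_ge_zero[of "f x"]]
        by simp
    qed
    show "AE x in lborel. (\<lambda>m. f x \<bullet> f (x + s m)) \<longlonglongrightarrow> f x \<bullet> f x"
    proof (rule AE_I2)
      fix x
      have "(\<lambda>m. x + s m) \<longlonglongrightarrow> x + 0" by (intro tendsto_intros assms)
      then have "(\<lambda>m. f (x + s m)) \<longlonglongrightarrow> f x"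
        using continuous_on_tendsto_compose[OF cont, of "\<lambda>m. x + s m" x] by simp
      then show "(\<lambda>m. f x \<bullet> f (x + s m)) \<longlonglongrightarrow> f x \<bullet> f x" by (intro tendsto_intros)
    qed
  qed measurable
qed

lemma power_spectrum_measurable: "power_spectrum lborel f \<in> borel_measurable borel"
proof -
  have "(\<lambda>\<xi>. \<integral>x. h (\<xi> \<bullet> x) *\<^sub>R f x \<partial>lborel) \<in> borel_measurable borel"
    if [measurable]: "h \<in> borel_measurable borel" for h :: "real \<Rightarrow> real"
    by (rule lborel.borel_measurable_lebesgue_integral) measurable
  from this[of cos] this[of sin] show ?thesis
    unfolding power_spectrum_def[abs_def] by measurable
qed

text \<open>A Gaussian weight makes the integral over frequencies absolutely convergent, so that it can be
  interchanged with the integral over \<open>z\<close>; the transform of the weight is an approximate identity,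
  which the substitution \<open>z = s y\<close> turns into a fixed Gaussian.\<close>

lemma gaussian_regularised_spectrum:
  assumes s: "s > 0"
  shows "(\<integral>\<xi>. exp (- ((norm (s *\<^sub>R \<xi>))\<^sup>2) / 2) * power_spectrum lborel f \<xi> \<partial>lborel)
    = (\<integral>y. sqrt (2 * pi) ^ CARD('n) * exp (- ((norm y)\<^sup>2) / 2) * autocorrelation (s *\<^sub>R y) \<partial>lborel)" (is ?eq)
    and "integrable lborel (\<lambda>\<xi>. exp (- ((norm (s *\<^sub>R \<xi>))\<^sup>2) / 2) * power_spectrum lborel f \<xi>)" (is ?int)
proof -
  let ?g = "\<lambda>\<xi> :: real^'n. exp (- ((norm (s *\<^sub>R \<xi>))\<^sup>2) / 2)"
  have am[measurable]: "autocorrelation \<in> borel_measurable borel"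
    using borel_measurable_integrable[OF autocorrelation_integrable] by simp
  have int: "integrable (lborel \<Otimes>\<^sub>M lborel) (\<lambda>(\<xi>, z). ?g \<xi> * (cos (\<xi> \<bullet> z) * autocorrelation z))"
  proof (rule Bochner_Integration.integrable_bound)
    show "integrable (lborel \<Otimes>\<^sub>M lborel) (\<lambda>(\<xi>, z). ?g \<xi> * autocorrelation z)"
    proof (rule lborel_pair.Fubini_integrable)
      show "(\<lambda>(\<xi>, z). ?g \<xi> * autocorrelation z) \<in> borel_measurable (lborel \<Otimes>\<^sub>M lborel)" by measurable
      have "integrable lborel (\<lambda>\<xi>. ?g \<xi> * (\<integral>z. \<bar>autocorrelation z\<bar> \<partial>lborel))"
        by (intro integrable_mult_left integrable_gaussian_scaled s)
      then show "integrable lborel (\<lambda>\<xi>. \<integral>z. norm (case (\<xi>, z) of (\<xi>, z) \<Rightarrow> ?g \<xi> * autocorrelation z) \<partial>lborel)"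
        by (simp add: abs_mult)
      show "AE \<xi> in lborel. integrable lborel (\<lambda>z. case (\<xi>, z) of (\<xi>, z) \<Rightarrow> ?g \<xi> * autocorrelation z)"
        using autocorrelation_integrable by (intro AE_I2) simp
    qed
    show "AE p in lborel \<Otimes>\<^sub>M lborel. norm (case p of (\<xi>, z) \<Rightarrow> ?g \<xi> * (cos (\<xi> \<bullet> z) * autocorrelation z))
        \<le> norm (case p of (\<xi>, z) \<Rightarrow> ?g \<xi> * autocorrelation z)"
      by (intro AE_I2) (auto simp: abs_mult mult_left_le_one_le)
  qed measurable
  have gP: "?g \<xi> * power_spectrum lborel f \<xi> = (\<integral>z. ?g \<xi> * (cos (\<xi> \<bullet> z) * autocorrelation z) \<partial>lborel)" for \<xi>
    by (simp add: power_spectrum_autocorrelation)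
  show ?int unfolding gP using lborel_pair.integrable_fst[OF int] by simp
  have "(\<integral>\<xi>. ?g \<xi> * power_spectrum lborel f \<xi> \<partial>lborel)
      = (\<integral>z. (\<integral>\<xi>. ?g \<xi> * (cos (\<xi> \<bullet> z) * autocorrelation z) \<partial>lborel) \<partial>lborel)"
    unfolding gP by (rule lborel_pair.Fubini_integral[symmetric]) (rule int)
  also have "\<dots> = (\<integral>z. (\<integral>\<xi>. ?g \<xi> * cos (\<xi> \<bullet> z) \<partial>lborel) * autocorrelation z \<partial>lborel)"
    by (simp flip: mult.assoc)
  also have "\<dots> = (\<integral>z. inverse s ^ CARD('n) * (sqrt (2 * pi) ^ CARD('n) * exp (- ((norm (inverse s *\<^sub>R z))\<^sup>2) / 2))
      * autocorrelation z \<partial>lborel)"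
    unfolding integral_gaussian_scaled[OF s] ..
  also have "\<dots> = s ^ CARD('n) *\<^sub>R (\<integral>y. inverse s ^ CARD('n)
      * (sqrt (2 * pi) ^ CARD('n) * exp (- ((norm (inverse s *\<^sub>R (s *\<^sub>R y)))\<^sup>2) / 2))
      * autocorrelation (s *\<^sub>R y) \<partial>lborel)"
    by (rule lborel_integral_scale[OF _ s]) measurable
  also have "\<dots> = (\<integral>y. sqrt (2 * pi) ^ CARD('n) * exp (- ((norm y)\<^sup>2) / 2) * autocorrelation (s *\<^sub>R y) \<partial>lborel)"
    unfolding real_scaleR_def integral_mult_right_zero[symmetric]
    using s by (intro Bochner_Integration.integral_cong) (auto simp: field_simps power_inverse)
  finally show ?eq .
qed

text \<open>As the weight increases to 1, monotone convergence applies on the left of the regularised identity,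
  while on the right the autocorrelation is evaluated at the origin in the limit.\<close>

theorem plancherel:
  shows "integrable lborel (power_spectrum lborel f)"
    and "(\<integral>\<xi>. power_spectrum lborel f \<xi> \<partial>lborel) = (2 * pi) ^ CARD('n) * (\<integral>x. (norm (f x))\<^sup>2 \<partial>lborel)"
proof -
  define s where "s m = 1 / real (Suc m)" for m
  have s: "s m > 0" for m by (simp add: s_def)
  have s0: "s \<longlonglongrightarrow> 0" unfolding s_def by (rule LIMSEQ_inverse_real_of_nat[unfolded inverse_eq_divide])
  let ?P = "power_spectrum lborel f"
  let ?g = "\<lambda>m \<xi>. exp (- ((norm (s m *\<^sub>R \<xi>))\<^sup>2) / 2)"
  obtain C where C: "\<And>z. \<bar>autocorrelation z\<bar> \<le> C" using autocorrelation_bound by blast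
  have am[measurable]: "autocorrelation \<in> borel_measurable borel"
    using borel_measurable_integrable[OF autocorrelation_integrable] by simp
  let ?c = "sqrt (2 * pi) ^ CARD('n)"
  have "(\<lambda>m. \<integral>y. ?c * exp (- ((norm y)\<^sup>2) / 2) * autocorrelation (s m *\<^sub>R y) \<partial>lborel)
      \<longlonglongrightarrow> (\<integral>y. ?c * exp (- ((norm y)\<^sup>2) / 2) * (\<integral>x. (norm (f x))\<^sup>2 \<partial>lborel) \<partial>(lborel :: (real^'n) measure))"
  proof (rule integral_dominated_convergence[where w = "\<lambda>y. ?c * exp (- ((norm y)\<^sup>2) / 2) * C"])
    show "integrable lborel (\<lambda>y :: real^'n. ?c * exp (- ((norm y)\<^sup>2) / 2) * C)"
      by (intro integrable_mult_left integrable_mult_right integrable_gaussian)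
    show "AE y in lborel. norm (?c * exp (- ((norm y)\<^sup>2) / 2) * autocorrelation (s m *\<^sub>R y))
        \<le> ?c * exp (- ((norm y)\<^sup>2) / 2) * C" for m
      using C by (intro AE_I2) (auto simp: abs_mult intro!: mult_left_mono)
    show "AE y in lborel. (\<lambda>m. ?c * exp (- ((norm y)\<^sup>2) / 2) * autocorrelation (s m *\<^sub>R y))
        \<longlonglongrightarrow> ?c * exp (- ((norm y)\<^sup>2) / 2) * (\<integral>x. (norm (f x))\<^sup>2 \<partial>lborel)"
    proof (rule AE_I2)
      fix y :: "real^'n"
      have "(\<lambda>m. s m *\<^sub>R y) \<longlonglongrightarrow> 0 *\<^sub>R y" by (intro tendsto_intros s0)
      then show "(\<lambda>m. ?c * exp (- ((norm y)\<^sup>2) / 2) * autocorrelation (s m *\<^sub>R y))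
        \<longlonglongrightarrow> ?c * exp (- ((norm y)\<^sup>2) / 2) * (\<integral>x. (norm (f x))\<^sup>2 \<partial>lborel)"
        by (intro tendsto_mult_left autocorrelation_tendsto) simp
    qed
  qed measurable
  also have "(\<integral>y. ?c * exp (- ((norm y)\<^sup>2) / 2) * (\<integral>x. (norm (f x))\<^sup>2 \<partial>lborel) \<partial>(lborel :: (real^'n) measure))
      = (2 * pi) ^ CARD('n) * (\<integral>x. (norm (f x))\<^sup>2 \<partial>lborel)"
  proof -
    have g: "(\<integral>y. exp (- ((norm y)\<^sup>2) / 2) \<partial>(lborel :: (real^'n) measure)) = ?c"
      using integral_gaussian_cos[of "0 :: real^'n"] by simp
    have "?c * ?c = (2 * pi) ^ CARD('n)" unfolding power_mult_distrib[symmetric] by simp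
    then show ?thesis by (simp only: integral_mult_left_zero integral_mult_right_zero g)
  qed
  finally have lim: "(\<lambda>m. \<integral>\<xi>. ?g m \<xi> * ?P \<xi> \<partial>lborel) \<longlonglongrightarrow> (2 * pi) ^ CARD('n) * (\<integral>x. (norm (f x))\<^sup>2 \<partial>lborel)"
    by (simp only: gaussian_regularised_spectrum(1)[OF s])
  have g1: "(\<lambda>m. ?g m \<xi>) \<longlonglongrightarrow> 1" for \<xi> :: "real^'n"
  proof -
    have "(\<lambda>m. ?g m \<xi>) \<longlonglongrightarrow> exp (- ((norm (0 *\<^sub>R \<xi>))\<^sup>2) / 2)" by (intro tendsto_intros s0) simp
    then show ?thesis by simp
  qed
  have mono: "mono (\<lambda>m. ?g m \<xi> * ?P \<xi>)" for \<xi> :: "real^'n"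
  proof (rule monoI, rule mult_right_mono[OF _ power_spectrum_nonneg])
    fix m l :: nat assume "m \<le> l"
    then have "s l \<le> s m" by (simp add: s_def frac_le)
    then have "norm (s l *\<^sub>R \<xi>) \<le> norm (s m *\<^sub>R \<xi>)" using s[of l] s[of m] by (simp add: mult_right_mono)
    then show "?g m \<xi> \<le> ?g l \<xi>" by (simp add: power_mono)
  qed
  have lim': "AE \<xi> in lborel. (\<lambda>m. ?g m \<xi> * ?P \<xi>) \<longlonglongrightarrow> ?P \<xi>"
    using tendsto_mult_right[OF g1] by (intro AE_I2) simp
  have meas: "?P \<in> borel_measurable lborel" using power_spectrum_measurable by simp
  have pos: "AE \<xi> in lborel. 0 \<le> ?g m \<xi> * ?P \<xi>" for m
    by (intro AE_I2 mult_nonneg_nonneg power_spectrum_nonneg) simp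
  note mc = integral_monotone_convergence_nonneg[OF gaussian_regularised_spectrum(2)[OF s]
      AE_I2[OF mono] pos lim' lim meas]
  show "integrable lborel ?P" by (rule mc(1))
  show "(\<integral>\<xi>. ?P \<xi> \<partial>lborel) = (2 * pi) ^ CARD('n) * (\<integral>x. (norm (f x))\<^sup>2 \<partial>lborel)" by (rule mc(2))
qed

end

section \<open>The Berezin--Li--Yau bound\<close>

text \<open>Layer-cake computation: \<open>\<Lambda> - \<bar>\<xi>\<bar>\<^sup>2\<close> is the length of the interval of heights \<open>t\<close> with
  \<open>\<bar>\<xi>\<bar>\<^sup>2 \<le> t \<le> \<Lambda>\<close>, and for fixed \<open>t\<close> the frequencies form a ball of radius \<open>sqrt t\<close>.\<close>

lemma nn_integral_bathtub_weight:
  assumes L: "\<Lambda> > 0"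
  shows "(\<integral>\<^sup>+\<xi>. ennreal (max 0 (\<Lambda> - (norm \<xi>)\<^sup>2)) \<partial>(lborel :: (real^'n) measure))
    = ennreal (unit_ball_vol (real CARD('n)) * (\<Lambda> powr (real CARD('n) / 2 + 1) / (real CARD('n) / 2 + 1)))"
proof -
  let ?n = "real CARD('n)"
  have "(\<integral>\<^sup>+\<xi>. ennreal (max 0 (\<Lambda> - (norm \<xi>)\<^sup>2)) \<partial>(lborel :: (real^'n) measure))
      = (\<integral>\<^sup>+\<xi>. (\<integral>\<^sup>+t. indicator {(norm \<xi>)\<^sup>2..\<Lambda>} t \<partial>lborel) \<partial>(lborel :: (real^'n) measure))"
    by (intro nn_integral_cong) (auto simp: max_def)
  also have "\<dots> = (\<integral>\<^sup>+\<xi>. (\<integral>\<^sup>+t. (if (norm \<xi>)\<^sup>2 \<le> t \<and> t \<le> \<Lambda> then 1 else 0) \<partial>lborel) \<partial>(lborel :: (real^'n) measure))"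
    by (intro nn_integral_cong) (auto simp: indicator_def)
  also have "\<dots> = (\<integral>\<^sup>+t. (\<integral>\<^sup>+\<xi>. (if (norm \<xi>)\<^sup>2 \<le> t \<and> t \<le> \<Lambda> then 1 else 0) \<partial>(lborel :: (real^'n) measure)) \<partial>lborel)"
    by (rule lborel_pair.Fubini'[symmetric]) measurable
  also have "\<dots> = (\<integral>\<^sup>+t. ennreal (unit_ball_vol ?n * (indicator {0..\<Lambda>} t * t powr (?n / 2))) \<partial>lborel)"
  proof (intro nn_integral_cong)
    fix t :: real
    show "(\<integral>\<^sup>+\<xi>. (if (norm \<xi>)\<^sup>2 \<le> t \<and> t \<le> \<Lambda> then 1 else 0) \<partial>(lborel :: (real^'n) measure))
        = ennreal (unit_ball_vol ?n * (indicator {0..\<Lambda>} t * t powr (?n / 2)))"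
    proof (cases "0 \<le> t \<and> t \<le> \<Lambda>")
      case False
      then have no: "\<not> ((norm \<xi>)\<^sup>2 \<le> t \<and> t \<le> \<Lambda>)" for \<xi> :: "real^'n" using zero_le_power2[of "norm \<xi>"] by linarith
      then have "(\<integral>\<^sup>+\<xi>. (if (norm \<xi>)\<^sup>2 \<le> t \<and> t \<le> \<Lambda> then 1 else 0) \<partial>(lborel :: (real^'n) measure)) = 0"
        by (simp only: if_not_P[OF no]) simp
      also have "0 = ennreal (unit_ball_vol ?n * (indicator {0..\<Lambda>} t * t powr (?n / 2)))"
        using False by (simp add: indicator_def)
      finally show ?thesis .
    next
      case True
      have "(norm \<xi>)\<^sup>2 \<le> t \<longleftrightarrow> norm \<xi> \<le> sqrt t" for \<xi> :: "real^'n"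
        using real_le_rsqrt real_sqrt_le_iff[of "(norm \<xi>)\<^sup>2" t] by simp
      then have "(\<integral>\<^sup>+\<xi>. (if (norm \<xi>)\<^sup>2 \<le> t \<and> t \<le> \<Lambda> then 1 else 0) \<partial>(lborel :: (real^'n) measure))
          = (\<integral>\<^sup>+\<xi>. indicator (cball 0 (sqrt t)) \<xi> \<partial>(lborel :: (real^'n) measure))"
        using True by (intro nn_integral_cong) (auto simp: indicator_def)
      also have "\<dots> = ennreal (unit_ball_vol ?n * sqrt t ^ CARD('n))"
        using True by (simp add: emeasure_cball)
      also have "sqrt t ^ CARD('n) = t powr (?n / 2)"
      proof (cases "t = 0")
        case False
        then have "t > 0" using True by simp
        then show ?thesis by (simp add: powr_half_sqrt[symmetric] powr_powr powr_realpow[symmetric])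
      qed simp
      finally show ?thesis using True by simp
    qed
  qed
  also have "\<dots> = ennreal (unit_ball_vol ?n) * (\<integral>\<^sup>+t. ennreal (indicator {0..\<Lambda>} t * t powr (?n / 2)) \<partial>lborel)"
    by (subst nn_integral_cmult[symmetric]) (auto simp: ennreal_mult)
  also have "(\<integral>\<^sup>+t. ennreal (indicator {0..\<Lambda>} t * t powr (?n / 2)) \<partial>lborel)
      = ennreal (\<Lambda> powr (?n / 2 + 1) / (?n / 2 + 1))"
  proof (rule nn_integral_has_integral_lborel)
    have "((\<lambda>t. t powr (?n / 2)) has_integral (\<Lambda> powr (?n / 2 + 1) / (?n / 2 + 1))) {0..\<Lambda>}"
      by (rule has_integral_powr_from_0) (use L in \<open>auto intro: less_le_trans[of _ 0]\<close>)
    then have "((\<lambda>t. if t \<in> {0..\<Lambda>} then t powr (?n / 2) else 0) has_integral (\<Lambda> powr (?n / 2 + 1) / (?n / 2 + 1))) UNIV"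
      by (simp only: has_integral_restrict_UNIV)
    then show "((\<lambda>t. indicator {0..\<Lambda>} t * t powr (?n / 2)) has_integral (\<Lambda> powr (?n / 2 + 1) / (?n / 2 + 1))) UNIV"
      by (rule has_integral_eq[rotated]) (auto simp: indicator_def)
  qed auto
  also have "ennreal (unit_ball_vol ?n) * ennreal (\<Lambda> powr (?n / 2 + 1) / (?n / 2 + 1))
      = ennreal (unit_ball_vol ?n * (\<Lambda> powr (?n / 2 + 1) / (?n / 2 + 1)))"
    by (rule ennreal_mult[symmetric]) auto
  finally show ?thesis .
qed

lemma
  assumes L: "\<Lambda> > 0"
  shows integral_bathtub_weight: "(\<integral>\<xi>. max 0 (\<Lambda> - (norm \<xi>)\<^sup>2) \<partial>(lborel :: (real^'n) measure))
    = unit_ball_vol (real CARD('n)) * (\<Lambda> powr (real CARD('n) / 2 + 1) / (real CARD('n) / 2 + 1))"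
  and integrable_bathtub_weight: "integrable lborel (\<lambda>\<xi> :: real^'n. max 0 (\<Lambda> - (norm \<xi>)\<^sup>2))"
proof -
  show "(\<integral>\<xi>. max 0 (\<Lambda> - (norm \<xi>)\<^sup>2) \<partial>(lborel :: (real^'n) measure))
    = unit_ball_vol (real CARD('n)) * (\<Lambda> powr (real CARD('n) / 2 + 1) / (real CARD('n) / 2 + 1))"
    by (subst integral_eq_nn_integral) (auto simp: nn_integral_bathtub_weight[OF L] intro!: mult_nonneg_nonneg)
  show "integrable lborel (\<lambda>\<xi> :: real^'n. max 0 (\<Lambda> - (norm \<xi>)\<^sup>2))"
    by (rule integrableI_nonneg) (auto simp: nn_integral_bathtub_weight[OF L])
qed

text \<open>The Legendre transform that converts the bound with a free spectral parameter into the final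
  power law. The value of \<open>\<Lambda>\<close> chosen in the proof makes the derivative in \<open>\<Lambda>\<close> of the difference of the two
  sides vanish; it is the height at which the bathtub is exactly filled.\<close>

lemma li_yau_optimisation:
  fixes k s M \<omega> n c :: real
  assumes pos: "k > 0" "M > 0" "\<omega> > 0" "n > 0" "c > 0"
    and bound: "\<And>\<Lambda>. \<Lambda> > 0 \<Longrightarrow> \<Lambda> * k - s \<le> (M / c) * (\<omega> * (\<Lambda> powr (n / 2 + 1) / (n / 2 + 1)))"
  shows "s \<ge> k * (n / (2 + n) * (c * k / (\<omega> * M)) powr (2 / n))"
proof -
  define \<Lambda> where "\<Lambda> = (c * k / (\<omega> * M)) powr (2 / n)"
  have q: "c * k / (\<omega> * M) > 0" using pos by simp
  have "\<Lambda> > 0" using q unfolding \<Lambda>_def powr_gt_zero by linarith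
  have "2 / n * (n / 2) = 1" using pos(4) by simp
  then have "\<Lambda> powr (n / 2) = (c * k / (\<omega> * M)) powr 1"
    unfolding \<Lambda>_def by (simp only: powr_powr)
  also have "\<dots> = c * k / (\<omega> * M)" by (rule powr_one[OF less_imp_le[OF q]])
  finally have "\<Lambda> powr (n / 2) = c * k / (\<omega> * M)" .
  then have e: "\<Lambda> powr (n / 2 + 1) = (c * k / (\<omega> * M)) * \<Lambda>"
    using \<open>\<Lambda> > 0\<close> by (simp add: powr_add)
  have "(M / c) * (\<omega> * (\<Lambda> powr (n / 2 + 1) / (n / 2 + 1))) = k * \<Lambda> * (2 / (2 + n))"
  proof -
    have nz: "M \<noteq> 0" "c \<noteq> 0" "\<omega> \<noteq> 0" "2 + n \<noteq> 0" using pos by auto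
    have "(M / c) * (\<omega> * ((c * k / (\<omega> * M)) * \<Lambda> / q')) = k * \<Lambda> / q'" for q'
      using nz(1-3) by simp
    moreover have "k * \<Lambda> / (n / 2 + 1) = k * \<Lambda> * (2 / (2 + n))"
      using nz(4) by (simp add: divide_simps)
    ultimately show ?thesis unfolding e by simp
  qed
  then have "\<Lambda> * k - s \<le> k * \<Lambda> * (2 / (2 + n))" using bound[OF \<open>\<Lambda> > 0\<close>] by simp
  moreover have "\<Lambda> * k - k * \<Lambda> * (2 / (2 + n)) = k * (n / (2 + n) * \<Lambda>)"
    using pos by (simp add: field_simps)
  ultimately show ?thesis unfolding \<Lambda>_def[symmetric] by linarith
qed

context open_finite_measure
begin

lemma L2_norm_sq_test:
  fixes w :: "real^'n \<Rightarrow> 'b::euclidean_space"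
  assumes "w \<in> test_functions \<Omega>"
  shows "(L2_norm \<Omega> w)\<^sup>2 = (\<integral>x. (norm (w x))\<^sup>2 \<partial>lborel)"
proof -
  note [measurable] = test_functions_measurable[OF assms]
  have "(\<integral>x. w x \<bullet> w x \<partial>lebesgue_on \<Omega>) = (\<integral>x. w x \<bullet> w x \<partial>lborel)"
    by (rule integral_lebesgue_on_eq_lborel) (simp_all add: test_functions_outside[OF assms])
  then show ?thesis by (simp add: L2_norm_sq L2_inner_def power2_norm_eq_inner)
qed

lemma power_spectrum_test:
  fixes w :: "real^'n \<Rightarrow> 'b::euclidean_space"
  assumes "w \<in> test_functions \<Omega>"
  shows "power_spectrum (lebesgue_on \<Omega>) w \<xi> = power_spectrum lborel w \<xi>"
proof -
  note [measurable] = test_functions_measurable[OF assms]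
  have "(\<integral>x. h x *\<^sub>R w x \<partial>lebesgue_on \<Omega>) = (\<integral>x. h x *\<^sub>R w x \<partial>lborel)"
    if [measurable]: "h \<in> borel_measurable borel" for h :: "real^'n \<Rightarrow> real"
    by (rule integral_lebesgue_on_eq_lborel) (simp_all add: test_functions_outside[OF assms])
  then show ?thesis by (simp add: power_spectrum_def)
qed

lemma plancherel_test:
  fixes w :: "real^'n \<Rightarrow> 'b::euclidean_space"
  assumes "w \<in> test_functions \<Omega>"
  shows "integrable lborel (power_spectrum lborel w)"
    and "(\<integral>\<xi>. power_spectrum lborel w \<xi> \<partial>lborel) = (2 * pi) ^ CARD('n) * (L2_norm \<Omega> w)\<^sup>2"
proof -
  interpret continuous_compact_support w "closure {x. w x \<noteq> 0}"
    by (rule continuous_compact_support.intro[OF test_functions_continuous[OF assms]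
          test_functions_compact[OF assms] zero_outside_support[of _ w]])
  show "integrable lborel (power_spectrum lborel w)" by (rule plancherel)
  show "(\<integral>\<xi>. power_spectrum lborel w \<xi> \<partial>lborel) = (2 * pi) ^ CARD('n) * (L2_norm \<Omega> w)\<^sup>2"
    unfolding plancherel L2_norm_sq_test[OF assms] ..
qed

end

lemma cont_diff_1_sin_cos:
  fixes \<xi> :: "real^'n"
  shows "cont_diff 1 (\<lambda>x. cos (\<xi> \<bullet> x))" "cont_diff 1 (\<lambda>x. sin (\<xi> \<bullet> x))"
    and partial_deriv_cos: "partial_deriv i (\<lambda>x. cos (\<xi> \<bullet> x)) x = - (\<xi> $ i * sin (\<xi> \<bullet> x))"
    and partial_deriv_sin: "partial_deriv i (\<lambda>x. sin (\<xi> \<bullet> x)) x = \<xi> $ i * cos (\<xi> \<bullet> x)"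
proof -
  have c: "((\<lambda>x. cos (\<xi> \<bullet> x)) has_derivative (\<lambda>h. - ((\<xi> \<bullet> h) * sin (\<xi> \<bullet> x)))) (at x)"
    and s: "((\<lambda>x. sin (\<xi> \<bullet> x)) has_derivative (\<lambda>h. (\<xi> \<bullet> h) * cos (\<xi> \<bullet> x))) (at x)" for x
    by (auto intro!: derivative_eq_intros)
  show pc: "partial_deriv i (\<lambda>x. cos (\<xi> \<bullet> x)) x = - (\<xi> $ i * sin (\<xi> \<bullet> x))" for i x
    using partial_deriv_eq[OF c, of i x] by (simp add: inner_axis)
  show ps: "partial_deriv i (\<lambda>x. sin (\<xi> \<bullet> x)) x = \<xi> $ i * cos (\<xi> \<bullet> x)" for i x
    using partial_deriv_eq[OF s, of i x] by (simp add: inner_axis)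
  show "cont_diff 1 (\<lambda>x. cos (\<xi> \<bullet> x))" "cont_diff 1 (\<lambda>x. sin (\<xi> \<bullet> x))"
    using c s by (auto simp: pc[abs_def] ps[abs_def] differentiable_def intro!: continuous_intros)
qed

lemma power_spectrum_partial_deriv:
  fixes w :: "real^'n \<Rightarrow> 'b::euclidean_space"
  assumes w: "cont_diff 1 w" "compact (closure {x. w x \<noteq> 0})"
  shows "power_spectrum lborel (partial_deriv i w) \<xi> = (\<xi> $ i)\<^sup>2 * power_spectrum lborel w \<xi>"
proof -
  have "(\<integral>x. cos (\<xi> \<bullet> x) *\<^sub>R partial_deriv i w x \<partial>lborel) = (\<xi> $ i) *\<^sub>R (\<integral>x. sin (\<xi> \<bullet> x) *\<^sub>R w x \<partial>lborel)"
    using integral_by_parts[OF cont_diff_1_sin_cos(1)[of \<xi>] w(1) disjI2[OF w(2)], where i = i]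
    by (simp add: partial_deriv_cos scaleR_scaleR[symmetric] del: scaleR_scaleR)
  moreover have "(\<integral>x. sin (\<xi> \<bullet> x) *\<^sub>R partial_deriv i w x \<partial>lborel) = - (\<xi> $ i) *\<^sub>R (\<integral>x. cos (\<xi> \<bullet> x) *\<^sub>R w x \<partial>lborel)"
    using integral_by_parts[OF cont_diff_1_sin_cos(2)[of \<xi>] w(1) disjI2[OF w(2)], where i = i]
    by (simp add: partial_deriv_sin scaleR_scaleR[symmetric] del: scaleR_scaleR)
  ultimately show ?thesis
    by (simp add: power_spectrum_def power_mult_distrib algebra_simps)
qed

context open_finite_measure
begin

text \<open>By Plancherel applied to \<open>w\<close> and to its derivatives, the left-hand side is the integral of
  \<open>(\<Lambda> - \<bar>\<xi>\<bar>\<^sup>2)\<close> against the power spectrum; dropping the negative part of the weight can only increase it.\<close>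

lemma berezin_test:
  fixes w :: "real^'n \<Rightarrow> 'b::euclidean_space"
  assumes w: "w \<in> test_functions \<Omega>"
  shows "(2 * pi) ^ CARD('n) * (\<Lambda> * (L2_norm \<Omega> w)\<^sup>2 - (\<Sum>i\<in>UNIV. (L2_norm \<Omega> (partial_deriv i w))\<^sup>2))
    \<le> (\<integral>\<xi>. max 0 (\<Lambda> - (norm \<xi>)\<^sup>2) * power_spectrum (lebesgue_on \<Omega>) w \<xi> \<partial>lborel)"
proof -
  let ?P = "power_spectrum lborel w"
  have pd: "power_spectrum lborel (partial_deriv i w) = (\<lambda>\<xi>. (\<xi> $ i)\<^sup>2 * ?P \<xi>)" for i
    by (rule ext, rule power_spectrum_partial_deriv[OF test_functions_cont_diff[OF w] test_functions_compact[OF w]])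
  note p0 = plancherel_test[OF w]
  note p1 = plancherel_test[OF test_functions_partial_deriv[OF w], unfolded pd]
  have nsq: "(norm \<xi>)\<^sup>2 = (\<Sum>i\<in>UNIV. (\<xi> $ i)\<^sup>2)" for \<xi> :: "real^'n"
    by (simp add: norm_vec_def L2_set_def sum_nonneg)
  have eq: "(\<Lambda> - (norm \<xi>)\<^sup>2) * ?P \<xi> = \<Lambda> * ?P \<xi> - (\<Sum>i\<in>UNIV. (\<xi> $ i)\<^sup>2 * ?P \<xi>)" for \<xi>
    by (simp add: nsq left_diff_distrib sum_distrib_right)
  have int: "integrable lborel (\<lambda>\<xi>. (\<Lambda> - (norm \<xi>)\<^sup>2) * ?P \<xi>)"
    unfolding eq by (intro Bochner_Integration.integrable_diff integrable_mult_right p0 Bochner_Integration.integrable_sum p1)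
  have "(2 * pi) ^ CARD('n) * (\<Lambda> * (L2_norm \<Omega> w)\<^sup>2 - (\<Sum>i\<in>UNIV. (L2_norm \<Omega> (partial_deriv i w))\<^sup>2))
      = \<Lambda> * (\<integral>\<xi>. ?P \<xi> \<partial>lborel) - (\<Sum>i\<in>UNIV. \<integral>\<xi>. (\<xi> $ i)\<^sup>2 * ?P \<xi> \<partial>lborel)"
    by (simp add: p0 p1 right_diff_distrib sum_distrib_left mult.left_commute)
  also have "\<dots> = (\<integral>\<xi>. (\<Lambda> - (norm \<xi>)\<^sup>2) * ?P \<xi> \<partial>lborel)"
    unfolding eq using p0(1) p1(1) by simp
  also have "\<dots> \<le> (\<integral>\<xi>. max 0 (\<Lambda> - (norm \<xi>)\<^sup>2) * ?P \<xi> \<partial>lborel)"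
  proof (rule integral_mono[OF int])
    have "integrable lborel (\<lambda>\<xi>. max 0 ((\<Lambda> - (norm \<xi>)\<^sup>2) * ?P \<xi>))" using int by simp
    moreover have "max 0 ((\<Lambda> - (norm \<xi>)\<^sup>2) * ?P \<xi>) = max 0 (\<Lambda> - (norm \<xi>)\<^sup>2) * ?P \<xi>" for \<xi>
      using power_spectrum_nonneg[of lborel w \<xi>] by (simp add: max_def mult_le_0_iff) (auto simp: zero_le_mult_iff)
    ultimately show "integrable lborel (\<lambda>\<xi>. max 0 (\<Lambda> - (norm \<xi>)\<^sup>2) * ?P \<xi>)" by simp
    show "(\<Lambda> - (norm \<xi>)\<^sup>2) * ?P \<xi> \<le> max 0 (\<Lambda> - (norm \<xi>)\<^sup>2) * ?P \<xi>" for \<xi>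
      by (intro mult_right_mono power_spectrum_nonneg) simp
  qed
  finally show ?thesis by (simp add: power_spectrum_test[OF w])
qed

text \<open>Finite measure makes the Fourier transform continuous, pointwise in the frequency, with respect to
  the \<open>L\<^sub>2\<close> norm.\<close>

lemma norm_integral_modulated_le:
  fixes f :: "real^'n \<Rightarrow> 'b::euclidean_space" and h :: "real^'n \<Rightarrow> real"
  assumes f: "f \<in> L2 \<Omega>" and h: "h \<in> borel_measurable borel" "\<And>x. \<bar>h x\<bar> \<le> 1"
  shows "norm (\<integral>x. h x *\<^sub>R f x \<partial>lebesgue_on \<Omega>) \<le> sqrt (measure lebesgue \<Omega>) * L2_norm \<Omega> f"
proof -
  interpret finite_measure "lebesgue_on \<Omega>" by (rule finite_measure_Omega)
  let ?n = "\<lambda>x. norm (f x)"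
  have n: "?n \<in> L2 \<Omega>" using f by (auto simp: L2_def)
  have one: "(\<lambda>x. 1 :: real) \<in> L2 \<Omega>" by (rule L2_bounded[of _ 1]) auto
  have "norm (\<integral>x. h x *\<^sub>R f x \<partial>lebesgue_on \<Omega>) \<le> (\<integral>x. norm (h x *\<^sub>R f x) \<partial>lebesgue_on \<Omega>)"
    by (rule integral_norm_bound)
  also have "\<dots> \<le> (\<integral>x. ?n x \<partial>lebesgue_on \<Omega>)"
    by (rule Bochner_Integration.integral_mono'[OF L2_integrable[OF n]])
      (use h(2) in \<open>auto intro: mult_left_le_one_le\<close>)
  also have "\<dots> = L2_inner \<Omega> (\<lambda>x. 1) ?n" by (simp add: L2_inner_def)
  also have "\<dots> \<le> L2_norm \<Omega> (\<lambda>x. 1 :: real) * L2_norm \<Omega> ?n" using L2_Cauchy_Schwarz[OF one n] by linarith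
  also have "L2_norm \<Omega> (\<lambda>x. 1 :: real) = sqrt (measure lebesgue \<Omega>)"
    by (simp add: L2_norm_def L2_inner_def measure_restrict_space)
  also have "L2_norm \<Omega> ?n = L2_norm \<Omega> f"
    by (simp add: L2_norm_def L2_inner_def power2_norm_eq_inner flip: power2_eq_square)
  finally show ?thesis .
qed

lemma power_spectrum_le:
  fixes f :: "real^'n \<Rightarrow> 'b::euclidean_space"
  assumes f: "f \<in> L2 \<Omega>"
  shows "power_spectrum (lebesgue_on \<Omega>) f \<xi> \<le> 2 * (measure lebesgue \<Omega> * (L2_norm \<Omega> f)\<^sup>2)"
proof -
  have "(norm (\<integral>x. h x *\<^sub>R f x \<partial>lebesgue_on \<Omega>))\<^sup>2 \<le> measure lebesgue \<Omega> * (L2_norm \<Omega> f)\<^sup>2"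
    if "h \<in> borel_measurable borel" "\<And>x. \<bar>h x\<bar> \<le> 1" for h :: "real^'n \<Rightarrow> real"
    using power_mono[OF norm_integral_modulated_le[OF f that] norm_ge_zero, of 2]
    by (simp add: power_mult_distrib)
  from this[of "\<lambda>x. cos (\<xi> \<bullet> x)"] this[of "\<lambda>x. sin (\<xi> \<bullet> x)"] show ?thesis
    by (simp add: power_spectrum_def)
qed

lemma integral_modulated_tendsto:
  fixes u :: "real^'n \<Rightarrow> 'b::euclidean_space" and h :: "real^'n \<Rightarrow> real"
  assumes w: "\<And>m. w m \<in> L2 \<Omega>" and u: "u \<in> L2 \<Omega>" and lim: "(\<lambda>m. L2_norm \<Omega> (\<lambda>x. u x - w m x)) \<longlonglongrightarrow> 0"
    and h: "h \<in> borel_measurable borel" "\<And>x. \<bar>h x\<bar> \<le> 1"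
  shows "(\<lambda>m. \<integral>x. h x *\<^sub>R w m x \<partial>lebesgue_on \<Omega>) \<longlonglongrightarrow> (\<integral>x. h x *\<^sub>R u x \<partial>lebesgue_on \<Omega>)"
proof -
  have d: "(\<integral>x. h x *\<^sub>R (u x - w m x) \<partial>lebesgue_on \<Omega>)
      = (\<integral>x. h x *\<^sub>R u x \<partial>lebesgue_on \<Omega>) - (\<integral>x. h x *\<^sub>R w m x \<partial>lebesgue_on \<Omega>)" for m
    unfolding scaleR_diff_right
    by (rule Bochner_Integration.integral_diff) (intro L2_integrable L2_scaleR_bounded[OF _ h] u w)+
  have "(\<lambda>m. norm (\<integral>x. h x *\<^sub>R (u x - w m x) \<partial>lebesgue_on \<Omega>)) \<longlonglongrightarrow> 0"
  proof (rule tendsto_sandwich[OF _ _ tendsto_const])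
    show "(\<lambda>m. sqrt (measure lebesgue \<Omega>) * L2_norm \<Omega> (\<lambda>x. u x - w m x)) \<longlonglongrightarrow> 0"
      by (rule tendsto_mult_right_zero[OF lim])
    show "\<forall>\<^sub>F m in sequentially. norm (\<integral>x. h x *\<^sub>R (u x - w m x) \<partial>lebesgue_on \<Omega>)
        \<le> sqrt (measure lebesgue \<Omega>) * L2_norm \<Omega> (\<lambda>x. u x - w m x)"
      by (intro always_eventually allI norm_integral_modulated_le L2_diff u w h)
  qed simp
  then have "(\<lambda>m. (\<integral>x. h x *\<^sub>R u x \<partial>lebesgue_on \<Omega>) - (\<integral>x. h x *\<^sub>R w m x \<partial>lebesgue_on \<Omega>)) \<longlonglongrightarrow> 0"
    unfolding d by (rule tendsto_norm_zero_cancel)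
  from tendsto_diff[OF tendsto_const[of "\<integral>x. h x *\<^sub>R u x \<partial>lebesgue_on \<Omega>"] this] show ?thesis by simp
qed

lemma power_spectrum_tendsto:
  fixes u :: "real^'n \<Rightarrow> 'b::euclidean_space"
  assumes "\<And>m. w m \<in> L2 \<Omega>" "u \<in> L2 \<Omega>" "(\<lambda>m. L2_norm \<Omega> (\<lambda>x. u x - w m x)) \<longlonglongrightarrow> 0"
  shows "(\<lambda>m. power_spectrum (lebesgue_on \<Omega>) (w m) \<xi>) \<longlonglongrightarrow> power_spectrum (lebesgue_on \<Omega>) u \<xi>"
  unfolding power_spectrum_def
  by (intro tendsto_intros integral_modulated_tendsto assms) auto

text \<open>The truncated weight has compact support, so the bound for test functions passes to the limit by
  dominated convergence: the power spectra converge pointwise and are uniformly bounded.\<close>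

lemma berezin_H1_closure:
  fixes u :: "real^'n \<Rightarrow> 'b::euclidean_space"
  assumes S: "S \<subseteq> test_functions \<Omega>" and u: "u \<in> H1_closure \<Omega> S" and L: "\<Lambda> > 0"
  shows "(2 * pi) ^ CARD('n) * (\<Lambda> * (L2_norm \<Omega> u)\<^sup>2 - dirichlet_form \<Omega> u u)
    \<le> (\<integral>\<xi>. max 0 (\<Lambda> - (norm \<xi>)\<^sup>2) * power_spectrum (lebesgue_on \<Omega>) u \<xi> \<partial>lborel)"
    and "integrable lborel (\<lambda>\<xi>. max 0 (\<Lambda> - (norm \<xi>)\<^sup>2) * power_spectrum (lebesgue_on \<Omega>) u \<xi>)"
proof -
  obtain w where w: "\<And>m. w m \<in> S" and uL: "u \<in> L2 \<Omega>"
    and l0: "(\<lambda>m. L2_norm \<Omega> (\<lambda>x. u x - w m x)) \<longlonglongrightarrow> 0"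
    and l1: "(\<lambda>m. (L2_norm \<Omega> (w m))\<^sup>2) \<longlonglongrightarrow> (L2_norm \<Omega> u)\<^sup>2"
    and l2: "(\<lambda>m. \<Sum>i\<in>UNIV. (L2_norm \<Omega> (partial_deriv i (w m)))\<^sup>2) \<longlonglongrightarrow> dirichlet_form \<Omega> u u"
    using H1_closure_approximation[OF S u] by blast
  have wt: "w m \<in> test_functions \<Omega>" for m using w S by blast
  note wL = test_functions_L2[OF wt]
  let ?h = "\<lambda>\<xi> :: real^'n. max 0 (\<Lambda> - (norm \<xi>)\<^sup>2)" and ?P = "\<lambda>f. power_spectrum (lebesgue_on \<Omega>) f"
  obtain C where C: "\<And>m. \<bar>(L2_norm \<Omega> (w m))\<^sup>2\<bar> \<le> C"
    using convergent_imp_Bseq[OF convergentI[OF l1]] by (auto simp: Bseq_def)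
  have Pm: "?P (w m) \<in> borel_measurable borel" for m
    using plancherel_test(1)[OF wt[of m]] by (simp add: power_spectrum_test[OF wt, abs_def])
  have lim: "(\<lambda>m. ?P (w m) \<xi>) \<longlonglongrightarrow> ?P u \<xi>" for \<xi>
    by (rule power_spectrum_tendsto[OF wL uL l0])
  have um: "?P u \<in> borel_measurable borel"
    by (rule borel_measurable_LIMSEQ_real, rule lim, rule Pm)
  have D: "integrable lborel (\<lambda>\<xi>. ?h \<xi> * (2 * (measure lebesgue \<Omega> * C)))"
    by (intro integrable_mult_left integrable_bathtub_weight L)
  have dom: "AE \<xi> in lborel. norm (?h \<xi> * ?P (w m) \<xi>) \<le> ?h \<xi> * (2 * (measure lebesgue \<Omega> * C))" for m
  proof (rule AE_I2)
    fix \<xi> :: "real^'n"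
    have "?P (w m) \<xi> \<le> 2 * (measure lebesgue \<Omega> * (L2_norm \<Omega> (w m))\<^sup>2)" by (rule power_spectrum_le[OF wL])
    also have "\<dots> \<le> 2 * (measure lebesgue \<Omega> * C)"
      using C[of m] by (intro mult_left_mono) auto
    finally show "norm (?h \<xi> * ?P (w m) \<xi>) \<le> ?h \<xi> * (2 * (measure lebesgue \<Omega> * C))"
      using power_spectrum_nonneg[of "lebesgue_on \<Omega>" "w m" \<xi>] by (simp add: abs_mult mult_left_mono)
  qed
  have lim': "AE \<xi> in lborel. (\<lambda>m. ?h \<xi> * ?P (w m) \<xi>) \<longlonglongrightarrow> ?h \<xi> * ?P u \<xi>"
    by (intro AE_I2 tendsto_mult_left lim)
  have meas: "(\<lambda>\<xi>. ?h \<xi> * ?P u \<xi>) \<in> borel_measurable lborel" "(\<lambda>\<xi>. ?h \<xi> * ?P (w m) \<xi>) \<in> borel_measurable lborel" for m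
    using um Pm by auto
  show "integrable lborel (\<lambda>\<xi>. ?h \<xi> * ?P u \<xi>)"
    by (rule integrable_dominated_convergence[OF meas D lim' dom])
  have rhs: "(\<lambda>m. \<integral>\<xi>. ?h \<xi> * ?P (w m) \<xi> \<partial>lborel) \<longlonglongrightarrow> (\<integral>\<xi>. ?h \<xi> * ?P u \<xi> \<partial>lborel)"
    by (rule integral_dominated_convergence[OF meas D lim' dom])
  have lhs: "(\<lambda>m. (2 * pi) ^ CARD('n) * (\<Lambda> * (L2_norm \<Omega> (w m))\<^sup>2 - (\<Sum>i\<in>UNIV. (L2_norm \<Omega> (partial_deriv i (w m)))\<^sup>2)))
      \<longlonglongrightarrow> (2 * pi) ^ CARD('n) * (\<Lambda> * (L2_norm \<Omega> u)\<^sup>2 - dirichlet_form \<Omega> u u)"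
    by (intro tendsto_intros l1 l2)
  show "(2 * pi) ^ CARD('n) * (\<Lambda> * (L2_norm \<Omega> u)\<^sup>2 - dirichlet_form \<Omega> u u)
      \<le> (\<integral>\<xi>. ?h \<xi> * ?P u \<xi> \<partial>lborel)"
    by (rule LIMSEQ_le[OF lhs rhs]) (use berezin_test[OF wt] in blast)
qed

text \<open>The general Berezin--Li--Yau mechanism: the only input specific to a problem is the uniform bound \<open>M\<close> on
  the total power spectrum. The bound at \<open>\<xi> = 0\<close> is left out because for solenoidal fields the
  direction of \<open>\<xi>\<close> matters.\<close>

theorem berezin_li_yau:
  fixes f :: "'j \<Rightarrow> real^'n \<Rightarrow> 'b::euclidean_space"
  assumes S: "S \<subseteq> test_functions \<Omega>"
    and f: "\<And>j. j \<in> J \<Longrightarrow> f j \<in> H1_closure \<Omega> S"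
    and N: "N = (\<Sum>j\<in>J. (L2_norm \<Omega> (f j))\<^sup>2)" "N > 0"
    and M: "M > 0" "\<And>\<xi>. \<xi> \<noteq> 0 \<Longrightarrow> (\<Sum>j\<in>J. power_spectrum (lebesgue_on \<Omega>) (f j) \<xi>) \<le> M"
  shows "(\<Sum>j\<in>J. dirichlet_form \<Omega> (f j) (f j)) \<ge> N * (real CARD('n) / (2 + real CARD('n))
      * ((2 * pi) ^ CARD('n) * N / (unit_ball_vol (real CARD('n)) * M)) powr (2 / real CARD('n)))"
proof (rule li_yau_optimisation)
  show "0 < unit_ball_vol (real CARD('n))" by (rule unit_ball_vol_pos) simp
  fix \<Lambda> :: real assume L: "\<Lambda> > 0"
  let ?h = "\<lambda>\<xi> :: real^'n. max 0 (\<Lambda> - (norm \<xi>)\<^sup>2)" and ?P = "\<lambda>f. power_spectrum (lebesgue_on \<Omega>) f"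
  note b = berezin_H1_closure[OF S f L]
  have "(2 * pi) ^ CARD('n) * (\<Lambda> * N - (\<Sum>j\<in>J. dirichlet_form \<Omega> (f j) (f j)))
      = (\<Sum>j\<in>J. (2 * pi) ^ CARD('n) * (\<Lambda> * (L2_norm \<Omega> (f j))\<^sup>2 - dirichlet_form \<Omega> (f j) (f j)))"
  proof -
    have "(\<Sum>j\<in>J. \<Lambda> * (L2_norm \<Omega> (f j))\<^sup>2 - dirichlet_form \<Omega> (f j) (f j))
        = \<Lambda> * N - (\<Sum>j\<in>J. dirichlet_form \<Omega> (f j) (f j))"
      by (simp add: N(1) sum_subtractf sum_distrib_left)
    then show ?thesis by (simp only: sum_distrib_left[symmetric])
  qed
  also have "\<dots> \<le> (\<Sum>j\<in>J. \<integral>\<xi>. ?h \<xi> * ?P (f j) \<xi> \<partial>lborel)" by (intro sum_mono b)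
  also have "\<dots> = (\<integral>\<xi>. (\<Sum>j\<in>J. ?h \<xi> * ?P (f j) \<xi>) \<partial>lborel)"
    by (rule Bochner_Integration.integral_sum[symmetric]) (rule b)
  also have "\<dots> \<le> (\<integral>\<xi>. ?h \<xi> * M \<partial>lborel)"
  proof (rule integral_mono_AE)
    show "integrable lborel (\<lambda>\<xi>. \<Sum>j\<in>J. ?h \<xi> * ?P (f j) \<xi>)" by (intro Bochner_Integration.integrable_sum b)
    show "integrable lborel (\<lambda>\<xi>. ?h \<xi> * M)" by (intro integrable_mult_left integrable_bathtub_weight L)
    \<comment> \<open>The excluded frequency is a null set.\<close>
    have "AE \<xi> in lborel. \<xi> \<noteq> (0 :: real^'n)" by (rule AE_lborel_singleton)
    then show "AE \<xi> in lborel. (\<Sum>j\<in>J. ?h \<xi> * ?P (f j) \<xi>) \<le> ?h \<xi> * M"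
      by eventually_elim (use M(2) in \<open>auto simp flip: sum_distrib_left intro!: mult_left_mono\<close>)
  qed
  also have "\<dots> = (unit_ball_vol (real CARD('n)) * (\<Lambda> powr (real CARD('n) / 2 + 1) / (real CARD('n) / 2 + 1))) * M"
    by (simp add: integral_bathtub_weight[OF L])
  finally have fin: "(2 * pi) ^ CARD('n) * (\<Lambda> * N - (\<Sum>j\<in>J. dirichlet_form \<Omega> (f j) (f j)))
      \<le> (unit_ball_vol (real CARD('n)) * (\<Lambda> powr (real CARD('n) / 2 + 1) / (real CARD('n) / 2 + 1))) * M" .
  have div: "X \<le> (m / c) * W" if "c * X \<le> W * m" "c > 0" for X W m c :: real
    using that by (simp add: field_simps)
  show "\<Lambda> * N - (\<Sum>j\<in>J. dirichlet_form \<Omega> (f j) (f j))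
      \<le> (M / (2 * pi) ^ CARD('n)) * (unit_ball_vol (real CARD('n)) * (\<Lambda> powr (real CARD('n) / 2 + 1) / (real CARD('n) / 2 + 1)))"
    by (rule div[OF fin]) simp
qed (use M N in auto)

end

section \<open>Solenoidal fields\<close>

lemma arctan_cont_diff:
  fixes j :: "'n::finite"
  shows "cont_diff 1 (\<lambda>x::real^'n. arctan (x $ j))"
    and partial_deriv_arctan: "partial_deriv i (\<lambda>x::real^'n. arctan (x $ j)) x = (if i = j then 1 / (1 + (x $ j)\<^sup>2) else 0)"
proof -
  have d: "((\<lambda>x::real^'n. arctan (x $ j)) has_derivative (\<lambda>h. h $ j * inverse (1 + (x $ j)\<^sup>2))) (at x)" for x
    by (rule DERIV_compose_FDERIV[OF DERIV_arctan]) (rule bounded_linear_imp_has_derivative[OF bounded_linear_vec_nth])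
  show p: "partial_deriv i (\<lambda>x::real^'n. arctan (x $ j)) x = (if i = j then 1 / (1 + (x $ j)\<^sup>2) else 0)" for i x
    using partial_deriv_eq[OF d, of i x] by (auto simp: axis_def inverse_eq_divide)
  have nz: "1 + t\<^sup>2 \<noteq> 0" for t :: real using zero_le_power2[of t] by linarith
  have "continuous_on UNIV (\<lambda>x::real^'n. if i = j then 1 / (1 + (x $ j)\<^sup>2) else 0)" for i
    by (cases "i = j") (auto intro!: continuous_intros simp: nz)
  moreover have "partial_deriv i (\<lambda>x::real^'n. arctan (x $ j)) = (\<lambda>x. if i = j then 1 / (1 + (x $ j)\<^sup>2) else 0)" for i
    using p by (rule ext)
  ultimately show "cont_diff 1 (\<lambda>x::real^'n. arctan (x $ j))"
    using d by (auto simp: differentiable_def)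
qed

text \<open>The rows \<open>A i\<close> stand for the derivatives \<open>\<partial>\<^sub>i w\<close> of a divergence-free field, and the conclusion
  concerns the \<open>j\<close>-th component of \<open>(w \<cdot> \<nabla>) w\<close>. The quantity \<open>D\<close> measures how far the derivatives are
  from being parallel to \<open>w\<close>: if \<open>\<partial>\<^sub>i w = p\<^sub>i w\<close> for all \<open>i\<close>, then the divergence is
  \<open>\<Sum> p\<^sub>i w\<^sub>i\<close>, so it vanishes, and \<open>(w \<cdot> \<nabla>) w = (\<Sum> p\<^sub>i w\<^sub>i) w\<close> vanishes with it.
  In general both are controlled by the components \<open>r\<^sub>i\<close> of the derivatives orthogonal to \<open>w\<close>.\<close>

lemma transport_bound:
  fixes w :: "real^'n" and A :: "'n \<Rightarrow> real^'n" and j :: 'n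
  assumes div: "(\<Sum>i\<in>UNIV. A i $ i) = 0" and q: "(norm w)\<^sup>2 \<le> q" "q > 0"
  defines "D \<equiv> (\<Sum>i\<in>UNIV. (norm (A i))\<^sup>2 - (w \<bullet> A i)\<^sup>2 / q)"
  shows "D \<ge> 0" and "\<bar>\<Sum>i\<in>UNIV. w $ i * A i $ j\<bar> \<le> 2 * real CARD('n) * (norm w * sqrt D)"
proof -
  have d0: "0 \<le> (norm (A i))\<^sup>2 - (w \<bullet> A i)\<^sup>2 / q" for i
  proof -
    have "(w \<bullet> A i)\<^sup>2 \<le> (norm w * norm (A i))\<^sup>2"
      using Cauchy_Schwarz_ineq2[of w "A i"] by (simp add: abs_le_square_iff[symmetric])
    also have "\<dots> \<le> q * (norm (A i))\<^sup>2" using q by (simp add: power_mult_distrib mult_right_mono)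
    finally show ?thesis using q by (simp add: field_simps)
  qed
  show D0: "D \<ge> 0" unfolding D_def by (intro sum_nonneg d0)
  show "\<bar>\<Sum>i\<in>UNIV. w $ i * A i $ j\<bar> \<le> 2 * real CARD('n) * (norm w * sqrt D)"
  proof (cases "w = 0")
    case True
    then show ?thesis by simp
  next
    case False
    then have n0: "(norm w)\<^sup>2 > 0" by simp
    \<comment> \<open>Split each row into its part along \<open>w\<close> and the remainder \<open>r i\<close> orthogonal to \<open>w\<close>.\<close>
    define p where "p i = (w \<bullet> A i) / (norm w)\<^sup>2" for i
    define r where "r i = A i - p i *\<^sub>R w" for i
    have r: "norm (r i) \<le> sqrt D" for i
    proof (rule real_le_rsqrt)
      have "(norm (r i))\<^sup>2 = (norm (A i))\<^sup>2 - 2 * p i * (w \<bullet> A i) + (p i)\<^sup>2 * (norm w)\<^sup>2"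
        unfolding r_def power2_norm_eq_inner
        by (simp add: inner_diff_left inner_diff_right inner_commute power2_eq_square algebra_simps)
      also have "(p i)\<^sup>2 * (norm w)\<^sup>2 = p i * (w \<bullet> A i)" using n0 by (simp add: p_def power2_eq_square)
      also have "(norm (A i))\<^sup>2 - 2 * p i * (w \<bullet> A i) + p i * (w \<bullet> A i) = (norm (A i))\<^sup>2 - (w \<bullet> A i)\<^sup>2 / (norm w)\<^sup>2"
        by (simp add: p_def power2_eq_square)
      also have "\<dots> \<le> (norm (A i))\<^sup>2 - (w \<bullet> A i)\<^sup>2 / q"
        by (intro diff_left_mono divide_left_mono mult_pos_pos q n0 zero_le_power2)
      also have "\<dots> \<le> D" unfolding D_def by (rule member_le_sum) (use d0 in auto)
      finally show "(norm (r i))\<^sup>2 \<le> D" .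
    qed
    have A: "A i = p i *\<^sub>R w + r i" for i by (simp add: r_def)
    have pw: "(\<Sum>i\<in>UNIV. p i * w $ i) = - (\<Sum>i\<in>UNIV. r i $ i)"
      using div unfolding A by (simp add: sum.distrib)
    have "(\<Sum>i\<in>UNIV. w $ i * A i $ j) = (\<Sum>i\<in>UNIV. p i * w $ i) * w $ j + (\<Sum>i\<in>UNIV. w $ i * r i $ j)"
      unfolding A by (simp add: distrib_left sum.distrib sum_distrib_left mult_ac)
    also have "\<dots> = (\<Sum>i\<in>UNIV. w $ i * r i $ j) - w $ j * (\<Sum>i\<in>UNIV. r i $ i)" unfolding pw by simp
    finally have "\<bar>\<Sum>i\<in>UNIV. w $ i * A i $ j\<bar> \<le> \<bar>\<Sum>i\<in>UNIV. w $ i * r i $ j\<bar> + \<bar>w $ j * (\<Sum>i\<in>UNIV. r i $ i)\<bar>"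
      by simp
    also have "\<bar>\<Sum>i\<in>UNIV. w $ i * r i $ j\<bar> \<le> (\<Sum>i\<in>(UNIV::'n set). norm w * sqrt D)"
    proof (rule order_trans[OF sum_abs], rule sum_mono)
      fix i
      show "\<bar>w $ i * r i $ j\<bar> \<le> norm w * sqrt D"
        unfolding abs_mult
        by (intro mult_mono component_le_norm_cart order_trans[OF component_le_norm_cart r]) auto
    qed
    also have "\<bar>w $ j * (\<Sum>i\<in>UNIV. r i $ i)\<bar> \<le> norm w * (\<Sum>i\<in>(UNIV::'n set). sqrt D)"
      unfolding abs_mult
    proof (intro mult_mono component_le_norm_cart)
      show "\<bar>\<Sum>i\<in>UNIV. r i $ i\<bar> \<le> (\<Sum>i\<in>(UNIV::'n set). sqrt D)"
        by (rule order_trans[OF sum_abs], rule sum_mono) (intro order_trans[OF component_le_norm_cart r])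
    qed auto
    finally show ?thesis by (simp add: algebra_simps)
  qed
qed

context open_finite_measure
begin

lemma solenoidal_test: "w \<in> solenoidal_test_functions \<Omega> \<Longrightarrow> w \<in> test_functions \<Omega>"
  by (simp add: solenoidal_test_functions_def)

lemma solenoidal_divergence:
  assumes "w \<in> solenoidal_test_functions \<Omega>"
  shows "(\<Sum>i\<in>UNIV. partial_deriv i w x $ i) = 0"
proof (cases "x \<in> \<Omega>")
  case True
  then show ?thesis using assms by (simp add: solenoidal_test_functions_def divergence_def)
next
  case False
  then show ?thesis
    using test_functions_outside[OF test_functions_partial_deriv[OF solenoidal_test[OF assms]]] by simp
qed

text \<open>Solenoidal fields are orthogonal to gradients. It is used for plane waves, where it says that the
  Fourier transform is transversal, and for \<open>w\<^sub>j arctan x\<^sub>j\<close> in the proof of the strict inequality.\<close>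

lemma solenoidal_orthogonal_gradient:
  fixes f :: "real^'n \<Rightarrow> real"
  assumes w: "w \<in> solenoidal_test_functions \<Omega>" and f: "cont_diff 1 f"
  shows "(\<integral>x. (\<Sum>i\<in>UNIV. partial_deriv i f x * w x $ i) \<partial>lborel) = 0"
proof -
  note wt = solenoidal_test[OF w]
  have cf: "continuous_on UNIV f" "continuous_on UNIV (partial_deriv i f)" for i
    using cont_diff_continuous[OF f] f by auto
  have i1: "integrable lborel (\<lambda>x. partial_deriv i f x *\<^sub>R w x)"
    and i2: "integrable lborel (\<lambda>x. f x *\<^sub>R partial_deriv i w x)" for i
  proof -
    show "integrable lborel (\<lambda>x. partial_deriv i f x *\<^sub>R w x)"
      by (rule integrable_continuous_compact_support[OF _ test_functions_compact[OF wt]],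
          intro continuous_on_scaleR cf test_functions_continuous[OF wt])
        (use zero_outside_support[of _ w] in \<open>metis scaleR_zero_right\<close>)
    show "integrable lborel (\<lambda>x. f x *\<^sub>R partial_deriv i w x)"
      by (rule integrable_continuous_compact_support[OF _ test_functions_compact[OF wt]],
          intro continuous_on_scaleR cf test_functions_continuous[OF test_functions_partial_deriv[OF wt]])
        (use partial_deriv_outside_support[of _ w] in \<open>metis scaleR_zero_right\<close>)
  qed
  have c1: "integrable lborel (\<lambda>x. partial_deriv i f x * w x $ i)"
    and c1': "(\<integral>x. partial_deriv i f x * w x $ i \<partial>lborel) = (\<integral>x. partial_deriv i f x *\<^sub>R w x \<partial>lborel) \<bullet> axis i 1" for i
    using integrable_inner_left[OF i1[of i], of "axis i 1"] integral_inner_left[of "axis i 1", OF i1[of i]]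
    by (simp_all add: inner_axis)
  have c2: "integrable lborel (\<lambda>x. f x * partial_deriv i w x $ i)"
    and c2': "(\<integral>x. f x * partial_deriv i w x $ i \<partial>lborel) = (\<integral>x. f x *\<^sub>R partial_deriv i w x \<partial>lborel) \<bullet> axis i 1" for i
    using integrable_inner_left[OF i2[of i], of "axis i 1"] integral_inner_left[of "axis i 1", OF i2[of i]]
    by (simp_all add: inner_axis)
  have "(\<integral>x. (\<Sum>i\<in>UNIV. partial_deriv i f x * w x $ i) \<partial>lborel) = (\<Sum>i\<in>UNIV. \<integral>x. partial_deriv i f x * w x $ i \<partial>lborel)"
    by (rule Bochner_Integration.integral_sum) (rule c1)
  also have "\<dots> = (\<Sum>i\<in>UNIV. - (\<integral>x. f x * partial_deriv i w x $ i \<partial>lborel))"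
    unfolding c1' c2'
    by (intro sum.cong refl, subst integral_by_parts[OF f test_functions_cont_diff[OF wt] disjI2[OF test_functions_compact[OF wt]]])
      simp
  also have "\<dots> = - (\<integral>x. (\<Sum>i\<in>UNIV. f x * partial_deriv i w x $ i) \<partial>lborel)"
    by (subst Bochner_Integration.integral_sum) (use c2 in \<open>auto simp: sum_negf\<close>)
  also have "\<dots> = 0"
    using solenoidal_divergence[OF w] by (simp flip: sum_distrib_left)
  finally show ?thesis .
qed

lemma solenoidal_fourier_transversal:
  assumes w: "w \<in> solenoidal_test_functions \<Omega>"
  shows "\<xi> \<bullet> (\<integral>x. cos (\<xi> \<bullet> x) *\<^sub>R w x \<partial>lebesgue_on \<Omega>) = 0"
    and "\<xi> \<bullet> (\<integral>x. sin (\<xi> \<bullet> x) *\<^sub>R w x \<partial>lebesgue_on \<Omega>) = 0"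
proof -
  note wt = solenoidal_test[OF w]
  note [measurable] = test_functions_measurable[OF wt]
  have conv: "(\<integral>x. h x *\<^sub>R w x \<partial>lebesgue_on \<Omega>) = (\<integral>x. h x *\<^sub>R w x \<partial>lborel)"
    and pull: "\<xi> \<bullet> (\<integral>x. h x *\<^sub>R w x \<partial>lborel) = (\<integral>x. h x * (\<xi> \<bullet> w x) \<partial>lborel)"
    if h: "continuous_on UNIV h" for h :: "real^'n \<Rightarrow> real"
  proof -
    have [measurable]: "h \<in> borel_measurable borel" using h by (rule borel_measurable_continuous_onI)
    show "(\<integral>x. h x *\<^sub>R w x \<partial>lebesgue_on \<Omega>) = (\<integral>x. h x *\<^sub>R w x \<partial>lborel)"
      by (rule integral_lebesgue_on_eq_lborel) (simp_all add: test_functions_outside[OF wt])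
    have "integrable lborel (\<lambda>x. h x *\<^sub>R w x)"
      by (rule integrable_continuous_compact_support[OF _ test_functions_compact[OF wt]],
          intro continuous_on_scaleR h test_functions_continuous[OF wt])
        (use zero_outside_support[of _ w] in \<open>metis scaleR_zero_right\<close>)
    then show "\<xi> \<bullet> (\<integral>x. h x *\<^sub>R w x \<partial>lborel) = (\<integral>x. h x * (\<xi> \<bullet> w x) \<partial>lborel)"
      by (subst integral_inner_right[symmetric]) auto
  qed
  have "(\<Sum>i\<in>UNIV. \<xi> $ i * c * w x $ i) = c * (\<xi> \<bullet> w x)" for c x
    by (simp add: inner_vec_def sum_distrib_left mult_ac)
  note e = this
  have "(\<integral>x. cos (\<xi> \<bullet> x) * (\<xi> \<bullet> w x) \<partial>lborel) = 0"
    using solenoidal_orthogonal_gradient[OF w cont_diff_1_sin_cos(2)[of \<xi>]]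
    by (simp only: partial_deriv_sin e)
  then show "\<xi> \<bullet> (\<integral>x. cos (\<xi> \<bullet> x) *\<^sub>R w x \<partial>lebesgue_on \<Omega>) = 0"
    by (subst conv, (intro continuous_intros)[1], subst pull, (intro continuous_intros)[1])
  have "(\<integral>x. - (sin (\<xi> \<bullet> x) * (\<xi> \<bullet> w x)) \<partial>lborel) = 0"
    using solenoidal_orthogonal_gradient[OF w cont_diff_1_sin_cos(1)[of \<xi>]]
    by (simp only: partial_deriv_cos e mult_minus_left sum_negf)
  then show "\<xi> \<bullet> (\<integral>x. sin (\<xi> \<bullet> x) *\<^sub>R w x \<partial>lebesgue_on \<Omega>) = 0"
    by (subst conv, (intro continuous_intros)[1], subst pull, (intro continuous_intros)[1]) simp
qed

lemma V_space_fourier_transversal: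
  assumes v: "v \<in> V_space \<Omega>"
  shows "\<xi> \<bullet> (\<integral>x. cos (\<xi> \<bullet> x) *\<^sub>R v x \<partial>lebesgue_on \<Omega>) = 0"
    and "\<xi> \<bullet> (\<integral>x. sin (\<xi> \<bullet> x) *\<^sub>R v x \<partial>lebesgue_on \<Omega>) = 0"
proof -
  have "solenoidal_test_functions \<Omega> \<subseteq> test_functions \<Omega>" using solenoidal_test by blast
  from H1_closure_approximation[OF this v[unfolded V_space_def]]
  obtain w where w: "\<And>m. w m \<in> solenoidal_test_functions \<Omega>" and vL: "v \<in> L2 \<Omega>"
    and l0: "(\<lambda>m. L2_norm \<Omega> (\<lambda>x. v x - w m x)) \<longlonglongrightarrow> 0" by metis
  have lim: "(\<lambda>m. \<xi> \<bullet> (\<integral>x. h x *\<^sub>R w m x \<partial>lebesgue_on \<Omega>)) \<longlonglongrightarrow> \<xi> \<bullet> (\<integral>x. h x *\<^sub>R v x \<partial>lebesgue_on \<Omega>)"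
    if "h \<in> borel_measurable borel" "\<And>x. \<bar>h x\<bar> \<le> 1" for h :: "real^'n \<Rightarrow> real"
    by (intro tendsto_inner tendsto_const
      integral_modulated_tendsto[OF test_functions_L2[OF solenoidal_test[OF w]] vL l0 that])
  show "\<xi> \<bullet> (\<integral>x. cos (\<xi> \<bullet> x) *\<^sub>R v x \<partial>lebesgue_on \<Omega>) = 0"
    using lim[of "\<lambda>x. cos (\<xi> \<bullet> x)"] by (simp add: solenoidal_fourier_transversal[OF w] LIMSEQ_const_iff)
  show "\<xi> \<bullet> (\<integral>x. sin (\<xi> \<bullet> x) *\<^sub>R v x \<partial>lebesgue_on \<Omega>) = 0"
    using lim[of "\<lambda>x. sin (\<xi> \<bullet> x)"] by (simp add: solenoidal_fourier_transversal[OF w] LIMSEQ_const_iff)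
qed

lemma bessel:
  fixes f :: "real^'n \<Rightarrow> 'b::euclidean_space"
  assumes v: "\<And>j. j \<in> J \<Longrightarrow> v j \<in> L2 \<Omega>" and f: "f \<in> L2 \<Omega>" and J: "finite J"
    and orth: "\<And>j k. j \<in> J \<Longrightarrow> k \<in> J \<Longrightarrow> L2_inner \<Omega> (v j) (v k) = (if j = k then 1 else 0)"
  shows "(\<Sum>j\<in>J. (L2_inner \<Omega> (v j) f)\<^sup>2) \<le> (L2_norm \<Omega> f)\<^sup>2"
proof -
  \<comment> \<open>With this sign \<open>f + g\<close> is the component of \<open>f\<close> orthogonal to the family.\<close>
  define c where "c j = - L2_inner \<Omega> (v j) f" for j
  define g where "g x = (\<Sum>j\<in>J. c j *\<^sub>R v j x)" for x
  have gL: "g \<in> L2 \<Omega>" unfolding g_def[abs_def] by (intro L2_sum L2_scaleR v)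
  have gh: "L2_inner \<Omega> g h = (\<Sum>j\<in>J. c j * L2_inner \<Omega> (v j) h)" if "h \<in> L2 \<Omega>" for h
    unfolding g_def[abs_def] using that
    by (subst L2_inner_sum_left) (auto intro: L2_scaleR v simp: L2_inner_scaleR_left)
  have vg: "L2_inner \<Omega> (v k) g = c k" if "k \<in> J" for k
  proof -
    have "L2_inner \<Omega> (v k) g = L2_inner \<Omega> g (v k)" by (rule L2_inner_commute)
    also have "\<dots> = (\<Sum>j\<in>J. if j = k then c j else 0)"
      unfolding gh[OF v[OF that]] using orth that by (intro sum.cong) auto
    finally show ?thesis using that J by simp
  qed
  have gg: "L2_inner \<Omega> g g = (\<Sum>j\<in>J. (c j)\<^sup>2)"
    unfolding gh[OF gL] by (intro sum.cong) (auto simp: vg power2_eq_square)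
  have gf: "L2_inner \<Omega> f g = - (\<Sum>j\<in>J. (c j)\<^sup>2)"
    unfolding L2_inner_commute[of f g] gh[OF f] by (simp add: c_def power2_eq_square sum_negf)
  have "0 \<le> (L2_norm \<Omega> f)\<^sup>2 - (\<Sum>j\<in>J. (c j)\<^sup>2)"
    using L2_norm_sq_add[OF f gL] zero_le_power2[of "L2_norm \<Omega> (\<lambda>x. f x + g x)"]
    unfolding L2_norm_sq[of g] gg gf by linarith
  then show ?thesis by (simp add: c_def)
qed

lemma L2_norm_sq_modulation:
  fixes a :: "'b::euclidean_space"
  shows "(L2_norm \<Omega> (\<lambda>x. h x *\<^sub>R a))\<^sup>2 = (norm a)\<^sup>2 * (\<integral>x. (h x)\<^sup>2 \<partial>lebesgue_on \<Omega>)"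
proof -
  have "(h x *\<^sub>R a) \<bullet> (h x *\<^sub>R a) = (norm a)\<^sup>2 * (h x)\<^sup>2" for x
    unfolding power2_norm_eq_inner by (simp add: power2_eq_square)
  then show ?thesis unfolding L2_norm_sq L2_inner_def by (simp only: integral_mult_right_zero)
qed

lemma integral_cos_sin_sq:
  "(\<integral>x. (cos (\<xi> \<bullet> x))\<^sup>2 \<partial>lebesgue_on \<Omega>) + (\<integral>x. (sin (\<xi> \<bullet> x))\<^sup>2 \<partial>lebesgue_on \<Omega>) = measure lebesgue \<Omega>"
proof -
  interpret finite_measure "lebesgue_on \<Omega>" by (rule finite_measure_Omega)
  have i: "integrable (lebesgue_on \<Omega>) (\<lambda>x. (h x)\<^sup>2)"
    if "h \<in> borel_measurable borel" "\<And>x. \<bar>h x\<bar> \<le> 1" for h :: "real^'n \<Rightarrow> real"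
    using L2_integrable_square[OF L2_bounded[OF measurable_lebesgue_on[OF that(1)], of 1]] that(2) by simp
  have "(\<integral>x. (cos (\<xi> \<bullet> x))\<^sup>2 \<partial>lebesgue_on \<Omega>) + (\<integral>x. (sin (\<xi> \<bullet> x))\<^sup>2 \<partial>lebesgue_on \<Omega>)
      = (\<integral>x. (cos (\<xi> \<bullet> x))\<^sup>2 + (sin (\<xi> \<bullet> x))\<^sup>2 \<partial>lebesgue_on \<Omega>)"
    by (rule Bochner_Integration.integral_add[symmetric]; rule i) auto
  then show ?thesis by (simp add: measure_restrict_space)
qed

lemma inner_modulated_integral:
  fixes f :: "real^'n \<Rightarrow> 'b::euclidean_space"
  assumes "f \<in> L2 \<Omega>" "h \<in> borel_measurable borel" "\<And>x. \<bar>h x\<bar> \<le> 1"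
  shows "a \<bullet> (\<integral>x. h x *\<^sub>R f x \<partial>lebesgue_on \<Omega>) = L2_inner \<Omega> f (\<lambda>x. h x *\<^sub>R a)"
  unfolding L2_inner_def
  using integral_inner_right[of a "lebesgue_on \<Omega>", OF L2_integrable[OF L2_scaleR_bounded[OF assms]]]
  by (simp add: inner_commute)

text \<open>Incompressibility gains the factor \<open>n - 1\<close> in place of \<open>n\<close>: the transforms of the fields are orthogonal to
  \<open>\<xi>\<close>, so only the projections \<open>a i\<close> of the coordinate directions onto the complement of \<open>\<xi>\<close> are
  seen, and their squared lengths add up to the trace of that projection. Bessel's inequality is
  applied to the plane waves polarised along \<open>a i\<close>.\<close>

lemma solenoidal_spectrum_bound:
  assumes v: "\<And>j. j \<in> J \<Longrightarrow> v j \<in> V_space \<Omega>" and J: "finite J"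
    and orth: "\<And>j k. j \<in> J \<Longrightarrow> k \<in> J \<Longrightarrow> L2_inner \<Omega> (v j) (v k) = (if j = k then 1 else 0)"
    and \<xi>: "\<xi> \<noteq> 0"
  shows "(\<Sum>j\<in>J. power_spectrum (lebesgue_on \<Omega>) (v j) \<xi>) \<le> (real CARD('n) - 1) * measure lebesgue \<Omega>"
proof -
  have vL: "v j \<in> L2 \<Omega>" if "j \<in> J" for j
    using v[OF that] by (auto simp: V_space_def H1_closure_def H1_def)
  define a where "a i = axis i 1 - (\<xi> $ i / (norm \<xi>)\<^sup>2) *\<^sub>R \<xi>" for i
  have na: "(\<Sum>i\<in>UNIV. (norm (a i))\<^sup>2) = real CARD('n) - 1"
  proof -
    have "(norm (a i))\<^sup>2 = 1 - (\<xi> $ i)\<^sup>2 / (norm \<xi>)\<^sup>2" for i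
    proof -
      have "(norm (a i))\<^sup>2 = 1 - 2 * (\<xi> $ i / (norm \<xi>)\<^sup>2) * \<xi> $ i + (\<xi> $ i / (norm \<xi>)\<^sup>2)\<^sup>2 * (norm \<xi>)\<^sup>2"
        unfolding a_def power2_norm_eq_inner
        by (simp add: inner_diff_left inner_diff_right inner_axis inner_axis' power2_eq_square algebra_simps)
      then show ?thesis using \<xi> by (simp add: power2_eq_square)
    qed
    then have "(\<Sum>i\<in>UNIV. (norm (a i))\<^sup>2) = real CARD('n) - (\<Sum>i\<in>UNIV. (\<xi> $ i)\<^sup>2) / (norm \<xi>)\<^sup>2"
      by (simp add: sum_subtractf sum_divide_distrib)
    also have "(\<Sum>i\<in>UNIV. (\<xi> $ i)\<^sup>2) = (norm \<xi>)\<^sup>2" by (simp add: norm_vec_def L2_set_def sum_nonneg)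
    finally show ?thesis using \<xi> by simp
  qed
  have half: "(\<Sum>j\<in>J. (norm (\<integral>x. h x *\<^sub>R v j x \<partial>lebesgue_on \<Omega>))\<^sup>2)
      \<le> (real CARD('n) - 1) * (\<integral>x. (h x)\<^sup>2 \<partial>lebesgue_on \<Omega>)"
    if h: "h \<in> borel_measurable borel" "\<And>x. \<bar>h x\<bar> \<le> 1"
      and tr: "\<And>j. j \<in> J \<Longrightarrow> \<xi> \<bullet> (\<integral>x. h x *\<^sub>R v j x \<partial>lebesgue_on \<Omega>) = 0" for h
  proof -
    have ha: "(\<lambda>x. h x *\<^sub>R a i) \<in> L2 \<Omega>" for i
      by (rule L2_bounded[of _ "norm (a i)"])
        (use h in \<open>auto intro!: measurable_lebesgue_on mult_left_le_one_le\<close>)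
    have comp: "(\<integral>x. h x *\<^sub>R v j x \<partial>lebesgue_on \<Omega>) $ i = L2_inner \<Omega> (v j) (\<lambda>x. h x *\<^sub>R a i)" if "j \<in> J" for i j
    proof -
      have "(\<integral>x. h x *\<^sub>R v j x \<partial>lebesgue_on \<Omega>) $ i = a i \<bullet> (\<integral>x. h x *\<^sub>R v j x \<partial>lebesgue_on \<Omega>)"
        unfolding a_def using tr[OF that] by (simp add: inner_diff_left inner_axis')
      then show ?thesis using inner_modulated_integral[OF vL[OF that] h] by simp
    qed
    have "(\<Sum>j\<in>J. (norm (\<integral>x. h x *\<^sub>R v j x \<partial>lebesgue_on \<Omega>))\<^sup>2)
        = (\<Sum>j\<in>J. \<Sum>i\<in>UNIV. (L2_inner \<Omega> (v j) (\<lambda>x. h x *\<^sub>R a i))\<^sup>2)"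
    proof (intro sum.cong refl)
      fix j assume j: "j \<in> J"
      show "(norm (\<integral>x. h x *\<^sub>R v j x \<partial>lebesgue_on \<Omega>))\<^sup>2 = (\<Sum>i\<in>UNIV. (L2_inner \<Omega> (v j) (\<lambda>x. h x *\<^sub>R a i))\<^sup>2)"
        unfolding comp[OF j, symmetric] by (simp add: norm_vec_def L2_set_def sum_nonneg)
    qed
    also have "\<dots> = (\<Sum>i\<in>UNIV. \<Sum>j\<in>J. (L2_inner \<Omega> (v j) (\<lambda>x. h x *\<^sub>R a i))\<^sup>2)" by (rule sum.swap)
    also have "\<dots> \<le> (\<Sum>i\<in>UNIV. (L2_norm \<Omega> (\<lambda>x. h x *\<^sub>R a i))\<^sup>2)"
      by (intro sum_mono bessel vL ha J orth)
    also have "\<dots> = (real CARD('n) - 1) * (\<integral>x. (h x)\<^sup>2 \<partial>lebesgue_on \<Omega>)"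
      unfolding L2_norm_sq_modulation by (simp add: na flip: sum_distrib_right)
    finally show ?thesis .
  qed
  have "(\<Sum>j\<in>J. power_spectrum (lebesgue_on \<Omega>) (v j) \<xi>)
      \<le> (real CARD('n) - 1) * ((\<integral>x. (cos (\<xi> \<bullet> x))\<^sup>2 \<partial>lebesgue_on \<Omega>) + (\<integral>x. (sin (\<xi> \<bullet> x))\<^sup>2 \<partial>lebesgue_on \<Omega>))"
    unfolding power_spectrum_def sum.distrib distrib_left
    by (intro add_mono half V_space_fourier_transversal v) auto
  then show ?thesis by (simp only: integral_cos_sin_sq)
qed

lemma scalar_spectrum_bound:
  fixes \<phi> :: "real^'n \<Rightarrow> real"
  assumes \<phi>: "\<phi> \<in> L2 \<Omega>"
  shows "power_spectrum (lebesgue_on \<Omega>) \<phi> \<xi> \<le> measure lebesgue \<Omega> * (L2_norm \<Omega> \<phi>)\<^sup>2"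
proof -
  have "(norm (\<integral>x. h x *\<^sub>R \<phi> x \<partial>lebesgue_on \<Omega>))\<^sup>2 \<le> (L2_norm \<Omega> \<phi>)\<^sup>2 * (\<integral>x. (h x)\<^sup>2 \<partial>lebesgue_on \<Omega>)"
    if h: "h \<in> borel_measurable borel" "\<And>x. \<bar>h x\<bar> \<le> 1" for h :: "real^'n \<Rightarrow> real"
  proof -
    have hL: "(\<lambda>x. h x *\<^sub>R (1::real)) \<in> L2 \<Omega>"
      by (rule L2_bounded[of _ 1]) (use h in \<open>auto intro!: measurable_lebesgue_on\<close>)
    have "(\<integral>x. h x *\<^sub>R \<phi> x \<partial>lebesgue_on \<Omega>) = L2_inner \<Omega> \<phi> (\<lambda>x. h x *\<^sub>R 1)"
      using inner_modulated_integral[OF \<phi> h, of 1] by simp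
    then have "(norm (\<integral>x. h x *\<^sub>R \<phi> x \<partial>lebesgue_on \<Omega>))\<^sup>2 \<le> (L2_norm \<Omega> \<phi> * L2_norm \<Omega> (\<lambda>x. h x *\<^sub>R (1::real)))\<^sup>2"
      using L2_Cauchy_Schwarz[OF \<phi> hL] by (intro power_mono) auto
    then show ?thesis by (simp only: power_mult_distrib L2_norm_sq_modulation norm_one) simp
  qed
  from this[of "\<lambda>x. cos (\<xi> \<bullet> x)"] this[of "\<lambda>x. sin (\<xi> \<bullet> x)"]
  have "power_spectrum (lebesgue_on \<Omega>) \<phi> \<xi>
      \<le> (L2_norm \<Omega> \<phi>)\<^sup>2 * ((\<integral>x. (cos (\<xi> \<bullet> x))\<^sup>2 \<partial>lebesgue_on \<Omega>) + (\<integral>x. (sin (\<xi> \<bullet> x))\<^sup>2 \<partial>lebesgue_on \<Omega>))"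
    unfolding power_spectrum_def distrib_left by (intro add_mono) auto
  then show ?thesis unfolding integral_cos_sin_sq by (simp add: mult.commute)
qed

end

section \<open>The scalar eigenvalue lies strictly below the solenoidal one\<close>

context open_finite_measure
begin

lemma L2_norm_sq_integral: "(L2_norm \<Omega> f)\<^sup>2 = (\<integral>x. (norm (f x))\<^sup>2 \<partial>lebesgue_on \<Omega>)"
  unfolding L2_norm_sq L2_inner_def power2_norm_eq_inner ..

text \<open>A smooth substitute for the modulus of \<open>w\<close>; subtracting \<open>\<epsilon>\<close> keeps the support compact.\<close>

definition regularised_modulus :: "real \<Rightarrow> (real^'n \<Rightarrow> real^'n) \<Rightarrow> real^'n \<Rightarrow> real" where
  "regularised_modulus \<epsilon> w x = sqrt (w x \<bullet> w x + \<epsilon>\<^sup>2) - \<epsilon>"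

lemma regularised_modulus_test:
  assumes w: "w \<in> test_functions \<Omega>" and e: "\<epsilon> > 0"
  shows "regularised_modulus \<epsilon> w \<in> test_functions \<Omega>"
proof (rule test_functions_subordinate[OF w])
  have pos: "w x \<bullet> w x + \<epsilon>\<^sup>2 > 0" for x using e by (simp add: add_nonneg_pos)
  have "cont_diff k (\<lambda>x. (w x \<bullet> w x + \<epsilon>\<^sup>2) powr (1 / 2) - \<epsilon>)" for k
    by (intro cont_diff_diff cont_diff_powr cont_diff_add cont_diff_inner test_functions_cont_diff[OF w]
        cont_diff_const pos)
  moreover have "(\<lambda>x. (w x \<bullet> w x + \<epsilon>\<^sup>2) powr (1 / 2) - \<epsilon>) = regularised_modulus \<epsilon> w"
    using less_imp_le[OF pos] by (simp add: regularised_modulus_def[abs_def] powr_half_sqrt)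
  ultimately show "cont_diff k (regularised_modulus \<epsilon> w)" for k by simp
  show "w x = 0 \<Longrightarrow> regularised_modulus \<epsilon> w x = 0" for x
    using e by (simp add: regularised_modulus_def)
qed

lemma partial_deriv_regularised_modulus:
  assumes w: "w \<in> test_functions \<Omega>" and e: "\<epsilon> > 0"
  shows "partial_deriv i (regularised_modulus \<epsilon> w) x = (w x \<bullet> partial_deriv i w x) / sqrt (w x \<bullet> w x + \<epsilon>\<^sup>2)"
proof -
  have pos: "w x \<bullet> w x + \<epsilon>\<^sup>2 > 0" using e by (simp add: add_nonneg_pos)
  let ?d = "frechet_derivative w (at x)"
  have d: "(w has_derivative ?d) (at x)" by (rule has_derivative_cont_diff[OF test_functions_cont_diff[OF w]])
  have "((\<lambda>x. w x \<bullet> w x + \<epsilon>\<^sup>2) has_derivative (\<lambda>h. 2 * (w x \<bullet> ?d h))) (at x)"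
    using has_derivative_add[OF has_derivative_inner[OF d d] has_derivative_const[of "\<epsilon>\<^sup>2"]]
    by (simp add: inner_commute)
  from has_derivative_diff[OF DERIV_compose_FDERIV[OF DERIV_real_sqrt[OF pos] this] has_derivative_const[of \<epsilon>]]
  have "(regularised_modulus \<epsilon> w has_derivative (\<lambda>h. 2 * (w x \<bullet> ?d h) * (inverse (sqrt (w x \<bullet> w x + \<epsilon>\<^sup>2)) / 2) - 0)) (at x)"
    unfolding regularised_modulus_def[abs_def] .
  then have "partial_deriv i (regularised_modulus \<epsilon> w) x
      = 2 * (w x \<bullet> ?d (axis i 1)) * (inverse (sqrt (w x \<bullet> w x + \<epsilon>\<^sup>2)) / 2) - 0"
    by (rule partial_deriv_eq)
  also have "\<dots> = (w x \<bullet> ?d (axis i 1)) / sqrt (w x \<bullet> w x + \<epsilon>\<^sup>2)"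
  proof -
    have "2 * c * (inverse r / 2) - 0 = c / r" for c r :: real by (simp add: inverse_eq_divide)
    then show ?thesis .
  qed
  finally show ?thesis unfolding partial_deriv_def[of i w x] .
qed

text \<open>Because \<open>\<Omega>\<close> has finite measure, replacing the modulus by its regularisation costs only
  \<open>O(\<epsilon>)\<close> in the square of the norm.\<close>

lemma regularised_modulus_norm:
  assumes w: "w \<in> test_functions \<Omega>" and e: "\<epsilon> > 0"
  shows "(L2_norm \<Omega> w)\<^sup>2 - \<epsilon> * (measure lebesgue \<Omega> + (L2_norm \<Omega> w)\<^sup>2) \<le> (L2_norm \<Omega> (regularised_modulus \<epsilon> w))\<^sup>2"
proof -
  interpret finite_measure "lebesgue_on \<Omega>" by (rule finite_measure_Omega)
  let ?\<eta> = "regularised_modulus \<epsilon> w"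
  have iw: "integrable (lebesgue_on \<Omega>) (\<lambda>x. w x \<bullet> w x)"
    by (intro L2_integrable_inner test_functions_L2 w)
  have i\<eta>: "integrable (lebesgue_on \<Omega>) (\<lambda>x. ?\<eta> x \<bullet> ?\<eta> x)"
    by (intro L2_integrable_inner test_functions_L2 regularised_modulus_test w e)
  have "w x \<bullet> w x - \<epsilon> * (1 + w x \<bullet> w x) \<le> ?\<eta> x \<bullet> ?\<eta> x" for x
  proof -
    define s where "s = norm (w x)"
    have s: "s \<ge> 0" "w x \<bullet> w x = s\<^sup>2" by (simp_all add: s_def power2_norm_eq_inner)
    let ?q = "sqrt (s\<^sup>2 + \<epsilon>\<^sup>2)"
    have q2: "?q\<^sup>2 = s\<^sup>2 + \<epsilon>\<^sup>2" by simp
    have "?q \<le> s + \<epsilon>" by (rule real_le_lsqrt) (use s e in \<open>auto simp: power2_sum\<close>)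
    then have "\<epsilon> * ?q \<le> \<epsilon> * (s + \<epsilon>)" using e by (simp add: mult_left_mono)
    then have *: "\<epsilon> * ?q \<le> \<epsilon> * s + \<epsilon>\<^sup>2" by (simp add: distrib_left power2_eq_square)
    have "2 * s \<le> 1 + s\<^sup>2" using sum_squares_bound[of 1 s] by simp
    \<comment> \<open>Together with the previous bound: \<open>(?q - \<epsilon>)\<^sup>2 \<ge> s\<^sup>2 - 2 \<epsilon> s \<ge> s\<^sup>2 - \<epsilon> (1 + s\<^sup>2)\<close>.\<close>
    then have **: "\<epsilon> * (2 * s) \<le> \<epsilon> * (1 + s\<^sup>2)" using e by (intro mult_left_mono) auto
    have "?\<eta> x \<bullet> ?\<eta> x = (?q - \<epsilon>)\<^sup>2" by (simp add: regularised_modulus_def s power2_eq_square)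
    also have "\<dots> = s\<^sup>2 + 2 * \<epsilon>\<^sup>2 - 2 * (\<epsilon> * ?q)" unfolding power2_diff q2 by simp
    finally show ?thesis unfolding s(2) using * ** by linarith
  qed
  then have "(\<integral>x. w x \<bullet> w x - \<epsilon> * (1 + w x \<bullet> w x) \<partial>lebesgue_on \<Omega>) \<le> (\<integral>x. ?\<eta> x \<bullet> ?\<eta> x \<partial>lebesgue_on \<Omega>)"
    by (intro integral_mono i\<eta> Bochner_Integration.integrable_diff iw integrable_mult_right
        Bochner_Integration.integrable_add integrable_const)
  moreover have "(\<integral>x. w x \<bullet> w x - \<epsilon> * (1 + w x \<bullet> w x) \<partial>lebesgue_on \<Omega>)
      = (\<integral>x. w x \<bullet> w x \<partial>lebesgue_on \<Omega>) - \<epsilon> * (measure lebesgue \<Omega> + (\<integral>x. w x \<bullet> w x \<partial>lebesgue_on \<Omega>))"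
    using iw by (simp add: measure_restrict_space)
  ultimately show ?thesis by (simp add: L2_norm_sq L2_inner_def)
qed

text \<open>The field is tested against the gradient of \<open>w\<^sub>j arctan x\<^sub>j\<close>. The inverse tangent is a bounded
  replacement for the coordinate \<open>x\<^sub>j\<close> with strictly positive derivative; boundedness matters because
  \<open>\<Omega>\<close> may be unbounded.\<close>

lemma transport_identity:
  assumes w: "w \<in> solenoidal_test_functions \<Omega>"
  shows "(\<integral>x. (w x $ j)\<^sup>2 / (1 + (x $ j)\<^sup>2) \<partial>lebesgue_on \<Omega>)
    = - (\<integral>x. arctan (x $ j) * (\<Sum>i\<in>UNIV. w x $ i * partial_deriv i w x $ j) \<partial>lebesgue_on \<Omega>)"
proof -
  note wt = solenoidal_test[OF w]
  have c: "continuous_on UNIV w" "continuous_on UNIV (partial_deriv i w)" for i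
    using test_functions_continuous[OF wt] test_functions_continuous[OF test_functions_partial_deriv[OF wt]] by auto
  let ?a = "\<lambda>x. arctan (x $ j)" and ?S = "\<lambda>x. \<Sum>i\<in>UNIV. w x $ i * partial_deriv i w x $ j"
  let ?T = "\<lambda>x. (w x $ j)\<^sup>2 / (1 + (x $ j)\<^sup>2)"
  have wj: "cont_diff 1 (\<lambda>x. w x $ j)"
    by (rule cont_diff_bounded_linear[OF bounded_linear_vec_nth test_functions_cont_diff[OF wt]])
  have f: "cont_diff 1 (\<lambda>x. w x $ j * ?a x)" by (rule cont_diff_mult[OF wj arctan_cont_diff(1)])
  have pd: "partial_deriv i (\<lambda>x. w x $ j * ?a x) x
      = w x $ j * (if i = j then 1 / (1 + (x $ j)\<^sup>2) else 0) + partial_deriv i w x $ j * ?a x" for i x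
    using wj arctan_cont_diff(1)[of j] test_functions_cont_diff[OF wt, of 1]
    by (subst partial_deriv_bounded_bilinear[OF bounded_bilinear_mult])
      (auto simp: partial_deriv_arctan partial_deriv_bounded_linear[OF bounded_linear_vec_nth])
  have e: "(\<Sum>i\<in>UNIV. partial_deriv i (\<lambda>x. w x $ j * ?a x) x * w x $ i) = ?T x + ?a x * ?S x" for x
  proof -
    have "(\<Sum>i\<in>UNIV. partial_deriv i (\<lambda>x. w x $ j * ?a x) x * w x $ i)
        = (\<Sum>i\<in>UNIV. (if i = j then ?T x else 0) + ?a x * (w x $ i * partial_deriv i w x $ j))"
      unfolding pd by (intro sum.cong refl) (auto simp: power2_eq_square algebra_simps)
    also have "\<dots> = ?T x + ?a x * ?S x"
      by (simp add: sum.distrib flip: sum_distrib_left)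
    finally show ?thesis .
  qed
  have nz: "1 + t\<^sup>2 \<noteq> 0" for t :: real using zero_le_power2[of t] by linarith
  have cT: "continuous_on UNIV ?T" "continuous_on UNIV (\<lambda>x. ?a x * ?S x)"
    by (intro continuous_intros c; simp add: nz)+
  have z: "?T x = 0" "?a x * ?S x = 0" if "x \<notin> closure {x. w x \<noteq> 0}" for x
    using zero_outside_support[OF that] by simp_all
  have i: "integrable lborel ?T" "integrable lborel (\<lambda>x. ?a x * ?S x)"
    by (rule integrable_continuous_compact_support[OF cT(1) test_functions_compact[OF wt] z(1)], assumption)
      (rule integrable_continuous_compact_support[OF cT(2) test_functions_compact[OF wt] z(2)], assumption)
  have "(\<integral>x. ?T x + ?a x * ?S x \<partial>lborel) = 0"
    using solenoidal_orthogonal_gradient[OF w f] unfolding e .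
  then have "(\<integral>x. ?T x \<partial>lborel) = - (\<integral>x. ?a x * ?S x \<partial>lborel)"
    using i by simp
  moreover have "(\<integral>x. ?T x \<partial>lebesgue_on \<Omega>) = (\<integral>x. ?T x \<partial>lborel)"
    by (rule integral_lebesgue_on_eq_lborel[OF borel_measurable_continuous_onI[OF cT(1)]])
      (simp add: test_functions_outside[OF wt])
  moreover have "(\<integral>x. ?a x * ?S x \<partial>lebesgue_on \<Omega>) = (\<integral>x. ?a x * ?S x \<partial>lborel)"
    by (rule integral_lebesgue_on_eq_lborel[OF borel_measurable_continuous_onI[OF cT(2)]])
      (simp add: test_functions_outside[OF wt])
  ultimately show ?thesis by simp
qed

text \<open>The right-hand side of the transport identity is at most a multiple of
  \<open>\<integral> \<bar>w\<bar> sqrt D\<close>, where \<open>D\<close> is the excess of \<open>\<bar>\<nabla>w\<bar>\<^sup>2\<close> over the squared gradient of the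
  regularised modulus. The scalar Rayleigh bound for the latter controls \<open>\<integral> D\<close>.\<close>

lemma transport_estimate:
  assumes w: "w \<in> solenoidal_test_functions \<Omega>" and e: "\<epsilon> > 0" and \<mu>: "\<mu> \<ge> 0"
    and ray: "\<And>\<eta> :: real^'n \<Rightarrow> real. \<eta> \<in> test_functions \<Omega> \<Longrightarrow>
      \<mu> * (L2_norm \<Omega> \<eta>)\<^sup>2 \<le> (\<Sum>i\<in>UNIV. (L2_norm \<Omega> (partial_deriv i \<eta>))\<^sup>2)"
  shows "(\<integral>x. (w x $ j)\<^sup>2 / (1 + (x $ j)\<^sup>2) \<partial>lebesgue_on \<Omega>)\<^sup>2
    \<le> (pi * real CARD('n))\<^sup>2 * ((L2_norm \<Omega> w)\<^sup>2 *
        ((\<Sum>i\<in>UNIV. (L2_norm \<Omega> (partial_deriv i w))\<^sup>2) - \<mu> * (L2_norm \<Omega> w)\<^sup>2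
          + \<mu> * \<epsilon> * (measure lebesgue \<Omega> + (L2_norm \<Omega> w)\<^sup>2)))"
proof -
  note wt = solenoidal_test[OF w]
  let ?\<eta> = "regularised_modulus \<epsilon> w" and ?n = "real CARD('n)"
  let ?S = "\<lambda>x. \<Sum>i\<in>UNIV. w x $ i * partial_deriv i w x $ j"
  define D where "D x = (\<Sum>i\<in>UNIV. (norm (partial_deriv i w x))\<^sup>2
    - (w x \<bullet> partial_deriv i w x)\<^sup>2 / (w x \<bullet> w x + \<epsilon>\<^sup>2))" for x
  have pos: "w x \<bullet> w x + \<epsilon>\<^sup>2 > 0" for x using e by (simp add: add_nonneg_pos)
  have D_eq: "D x = (\<Sum>i\<in>UNIV. (norm (partial_deriv i w x))\<^sup>2 - (norm (partial_deriv i ?\<eta> x))\<^sup>2)" for x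
    unfolding D_def partial_deriv_regularised_modulus[OF wt e]
    using less_imp_le[OF pos[of x]] by (simp add: power_divide)
  have tb: "D x \<ge> 0" "\<bar>?S x\<bar> \<le> 2 * ?n * (norm (w x) * sqrt (D x))" for x
    unfolding D_def using pos[of x]
    by (intro transport_bound[OF solenoidal_divergence[OF w]]; simp add: power2_norm_eq_inner)+
  note Lw = test_functions_L2[OF wt]
  note Lp = test_functions_L2[OF test_functions_partial_deriv[OF wt]]
  note L\<eta> = test_functions_L2[OF test_functions_partial_deriv[OF regularised_modulus_test[OF wt e]]]
  have iD: "integrable (lebesgue_on \<Omega>) D"
    unfolding D_eq[abs_def]
    by (intro Bochner_Integration.integrable_sum Bochner_Integration.integrable_diff L2_integrable_square Lp L\<eta>)
  have intD: "(\<integral>x. D x \<partial>lebesgue_on \<Omega>)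
      = (\<Sum>i\<in>UNIV. (L2_norm \<Omega> (partial_deriv i w))\<^sup>2) - (\<Sum>i\<in>UNIV. (L2_norm \<Omega> (partial_deriv i ?\<eta>))\<^sup>2)"
    unfolding D_eq[abs_def] L2_norm_sq_integral using L2_integrable_square[OF Lp] L2_integrable_square[OF L\<eta>]
    by (simp add: sum_subtractf del: real_norm_def)
  have nL: "(\<lambda>x. norm (w x)) \<in> L2 \<Omega>" using Lw by (auto simp: L2_def)
  have sL: "(\<lambda>x. sqrt (D x)) \<in> L2 \<Omega>" using iD tb(1) by (auto simp: L2_def)
  have nn: "L2_norm \<Omega> (\<lambda>x. norm (w x)) = L2_norm \<Omega> w"
    by (simp add: L2_norm_def L2_inner_def power2_norm_eq_inner flip: power2_eq_square)
  have ns: "(L2_norm \<Omega> (\<lambda>x. sqrt (D x)))\<^sup>2 = (\<integral>x. D x \<partial>lebesgue_on \<Omega>)"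
    using tb(1) by (simp add: L2_norm_sq L2_inner_def)
  have "\<bar>\<integral>x. (w x $ j)\<^sup>2 / (1 + (x $ j)\<^sup>2) \<partial>lebesgue_on \<Omega>\<bar>
      = norm (\<integral>x. arctan (x $ j) * ?S x \<partial>lebesgue_on \<Omega>)"
    unfolding transport_identity[OF w] by simp
  also have "\<dots> \<le> (\<integral>x. norm (arctan (x $ j) * ?S x) \<partial>lebesgue_on \<Omega>)" by (rule integral_norm_bound)
  also have "\<dots> \<le> (\<integral>x. pi * ?n * (norm (w x) * sqrt (D x)) \<partial>lebesgue_on \<Omega>)"
  proof (rule Bochner_Integration.integral_mono')
    show "integrable (lebesgue_on \<Omega>) (\<lambda>x. pi * ?n * (norm (w x) * sqrt (D x)))"
      using L2_integrable_inner[OF nL sL] by (intro integrable_mult_right) simp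
    show "norm (arctan (x $ j) * ?S x) \<le> pi * ?n * (norm (w x) * sqrt (D x))" for x
    proof -
      have "\<bar>arctan (x $ j)\<bar> \<le> pi / 2" using arctan_lbound[of "x $ j"] arctan_ubound[of "x $ j"] by linarith
      then have "\<bar>arctan (x $ j)\<bar> * \<bar>?S x\<bar> \<le> (pi / 2) * (2 * ?n * (norm (w x) * sqrt (D x)))"
        by (intro mult_mono tb(2)) auto
      then show ?thesis by (simp add: abs_mult)
    qed
    show "0 \<le> pi * ?n * (norm (w x) * sqrt (D x))" for x using tb(1)[of x] by simp
  qed
  also have "\<dots> = pi * ?n * L2_inner \<Omega> (\<lambda>x. norm (w x)) (\<lambda>x. sqrt (D x))" by (simp add: L2_inner_def)
  also have "\<dots> \<le> pi * ?n * (L2_norm \<Omega> w * L2_norm \<Omega> (\<lambda>x. sqrt (D x)))"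
    using L2_Cauchy_Schwarz[OF nL sL] unfolding nn by (intro mult_left_mono) auto
  finally have abs_le: "\<bar>\<integral>x. (w x $ j)\<^sup>2 / (1 + (x $ j)\<^sup>2) \<partial>lebesgue_on \<Omega>\<bar>
      \<le> pi * ?n * (L2_norm \<Omega> w * L2_norm \<Omega> (\<lambda>x. sqrt (D x)))" .
  have "(\<integral>x. (w x $ j)\<^sup>2 / (1 + (x $ j)\<^sup>2) \<partial>lebesgue_on \<Omega>)\<^sup>2
      \<le> (pi * ?n * (L2_norm \<Omega> w * L2_norm \<Omega> (\<lambda>x. sqrt (D x))))\<^sup>2"
    using power_mono[OF abs_le abs_ge_zero, of 2] by (simp only: power2_abs)
  also have "\<dots> = (pi * ?n)\<^sup>2 * ((L2_norm \<Omega> w)\<^sup>2 * (\<integral>x. D x \<partial>lebesgue_on \<Omega>))"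
    by (simp only: power_mult_distrib ns)
  also have "\<dots> \<le> (pi * ?n)\<^sup>2 * ((L2_norm \<Omega> w)\<^sup>2 *
        ((\<Sum>i\<in>UNIV. (L2_norm \<Omega> (partial_deriv i w))\<^sup>2) - \<mu> * (L2_norm \<Omega> w)\<^sup>2
          + \<mu> * \<epsilon> * (measure lebesgue \<Omega> + (L2_norm \<Omega> w)\<^sup>2)))"
  proof (intro mult_left_mono zero_le_power2)
    have "\<mu> * ((L2_norm \<Omega> w)\<^sup>2 - \<epsilon> * (measure lebesgue \<Omega> + (L2_norm \<Omega> w)\<^sup>2)) \<le> \<mu> * (L2_norm \<Omega> ?\<eta>)\<^sup>2"
      by (intro mult_left_mono regularised_modulus_norm wt e \<mu>)
    also have "\<dots> \<le> (\<Sum>i\<in>UNIV. (L2_norm \<Omega> (partial_deriv i ?\<eta>))\<^sup>2)"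
      by (rule ray[OF regularised_modulus_test[OF wt e]])
    finally show "(\<integral>x. D x \<partial>lebesgue_on \<Omega>) \<le> (\<Sum>i\<in>UNIV. (L2_norm \<Omega> (partial_deriv i w))\<^sup>2) - \<mu> * (L2_norm \<Omega> w)\<^sup>2
          + \<mu> * \<epsilon> * (measure lebesgue \<Omega> + (L2_norm \<Omega> w)\<^sup>2)"
      unfolding intD by (simp add: algebra_simps)
  qed
  finally show ?thesis .
qed

lemma weighted_component_L2:
  fixes f :: "real^'n \<Rightarrow> real^'n"
  assumes "f \<in> L2 \<Omega>"
  shows "(\<lambda>x. (1 / sqrt (1 + (x $ j)\<^sup>2)) *\<^sub>R (f x $ j)) \<in> L2 \<Omega>"
    and "L2_norm \<Omega> (\<lambda>x. (1 / sqrt (1 + (x $ j)\<^sup>2)) *\<^sub>R (f x $ j)) \<le> L2_norm \<Omega> f"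
    and "(L2_norm \<Omega> (\<lambda>x. (1 / sqrt (1 + (x $ j)\<^sup>2)) *\<^sub>R (f x $ j)))\<^sup>2 = (\<integral>x. (f x $ j)\<^sup>2 / (1 + (x $ j)\<^sup>2) \<partial>lebesgue_on \<Omega>)"
proof -
  let ?k = "\<lambda>x::real^'n. 1 / sqrt (1 + (x $ j)\<^sup>2)"
  have k: "\<bar>?k x\<bar> \<le> 1" for x
  proof -
    have "\<bar>1 / s\<bar> \<le> 1" if "1 \<le> s" for s :: real using that by (simp add: divide_le_eq_1)
    from this[of "sqrt (1 + (x $ j)\<^sup>2)"] show ?thesis by simp
  qed
  have m: "(\<lambda>x. f x $ j) \<in> borel_measurable (lebesgue_on \<Omega>)"
    by (rule measurable_compose[OF L2_measurable[OF assms] borel_measurable_nth])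
  have fj: "(\<lambda>x. f x $ j) \<in> L2 \<Omega>"
  proof -
    have "integrable (lebesgue_on \<Omega>) (\<lambda>x. (norm (f x $ j))\<^sup>2)"
    proof (rule Bochner_Integration.integrable_bound[OF L2_integrable_square[OF assms]])
      show "AE x in lebesgue_on \<Omega>. norm ((norm (f x $ j))\<^sup>2) \<le> norm ((norm (f x))\<^sup>2)"
        using component_le_norm_cart by (intro AE_I2) (simp add: abs_le_square_iff[symmetric])
    qed (use m in measurable)
    then show ?thesis using m by (auto simp: L2_def)
  qed
  have "?k \<in> borel_measurable borel" by measurable
  then show kf: "(\<lambda>x. ?k x *\<^sub>R (f x $ j)) \<in> L2 \<Omega>"
    by (rule L2_scaleR_bounded[OF fj _ k])
  have sq: "(?k x *\<^sub>R (f x $ j)) \<bullet> (?k x *\<^sub>R (f x $ j)) = (f x $ j)\<^sup>2 / (1 + (x $ j)\<^sup>2)" for x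
  proof -
    have "sqrt (1 + (x $ j)\<^sup>2) * sqrt (1 + (x $ j)\<^sup>2) = 1 + (x $ j)\<^sup>2" by simp
    then show ?thesis by (simp add: power2_eq_square)
  qed
  show "(L2_norm \<Omega> (\<lambda>x. ?k x *\<^sub>R (f x $ j)))\<^sup>2 = (\<integral>x. (f x $ j)\<^sup>2 / (1 + (x $ j)\<^sup>2) \<partial>lebesgue_on \<Omega>)"
    unfolding L2_norm_sq L2_inner_def sq ..
  show "L2_norm \<Omega> (\<lambda>x. ?k x *\<^sub>R (f x $ j)) \<le> L2_norm \<Omega> f"
    unfolding L2_norm_def
  proof (rule real_sqrt_le_mono)
    show "L2_inner \<Omega> (\<lambda>x. ?k x *\<^sub>R (f x $ j)) (\<lambda>x. ?k x *\<^sub>R (f x $ j)) \<le> L2_inner \<Omega> f f"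
      unfolding L2_inner_def
    proof (rule integral_mono[OF L2_integrable_inner[OF kf kf] L2_integrable_inner[OF assms assms]])
      fix x
      have "\<bar>?k x *\<^sub>R (f x $ j)\<bar> \<le> norm (f x)"
        using mult_mono[OF k[of x] component_le_norm_cart[of "f x" j]] by (simp add: abs_mult)
      from power_mono[OF this abs_ge_zero, of 2]
      have "(norm (?k x *\<^sub>R (f x $ j)))\<^sup>2 \<le> (norm (f x))\<^sup>2" by (simp only: real_norm_def)
      then show "(?k x *\<^sub>R (f x $ j)) \<bullet> (?k x *\<^sub>R (f x $ j)) \<le> f x \<bullet> f x"
        by (simp only: power2_norm_eq_inner)
    qed
  qed
qed

text \<open>If the solenoidal Rayleigh quotient of \<open>u\<close> were at most \<open>\<mu>\<close>, then in the limit along approximating test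
  fields, and with \<open>\<epsilon>\<close> tending to 0, the transport estimate would force
  \<open>\<integral> u\<^sub>j\<^sup>2 / (1 + x\<^sub>j\<^sup>2) = 0\<close> for every \<open>j\<close>, hence \<open>u = 0\<close> almost everywhere.\<close>

theorem solenoidal_rayleigh_strict:
  assumes u: "u \<in> V_space \<Omega>" "L2_norm \<Omega> u \<noteq> 0" and \<mu>: "\<mu> \<ge> 0"
    and ray: "\<And>\<eta> :: real^'n \<Rightarrow> real. \<eta> \<in> test_functions \<Omega> \<Longrightarrow>
      \<mu> * (L2_norm \<Omega> \<eta>)\<^sup>2 \<le> (\<Sum>i\<in>UNIV. (L2_norm \<Omega> (partial_deriv i \<eta>))\<^sup>2)"
  shows "\<mu> * (L2_norm \<Omega> u)\<^sup>2 < dirichlet_form \<Omega> u u"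
proof (rule ccontr)
  assume "\<not> \<mu> * (L2_norm \<Omega> u)\<^sup>2 < dirichlet_form \<Omega> u u"
  then have le: "dirichlet_form \<Omega> u u - \<mu> * (L2_norm \<Omega> u)\<^sup>2 \<le> 0" by simp
  have S: "solenoidal_test_functions \<Omega> \<subseteq> test_functions \<Omega>" using solenoidal_test by blast
  obtain w where w: "\<And>m. w m \<in> solenoidal_test_functions \<Omega>" and uL: "u \<in> L2 \<Omega>"
    and l0: "(\<lambda>m. L2_norm \<Omega> (\<lambda>x. u x - w m x)) \<longlonglongrightarrow> 0"
    and l1: "(\<lambda>m. (L2_norm \<Omega> (w m))\<^sup>2) \<longlonglongrightarrow> (L2_norm \<Omega> u)\<^sup>2"
    and l2: "(\<lambda>m. \<Sum>i\<in>UNIV. (L2_norm \<Omega> (partial_deriv i (w m)))\<^sup>2) \<longlonglongrightarrow> dirichlet_form \<Omega> u u"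
    using H1_closure_approximation[OF S u(1)[unfolded V_space_def]] by blast
  note wL = test_functions_L2[OF solenoidal_test[OF w]]
  let ?U = "(L2_norm \<Omega> u)\<^sup>2" and ?M = "measure lebesgue \<Omega>"
  let ?T = "\<lambda>f j. \<lambda>x::real^'n. (1 / sqrt (1 + (x $ j)\<^sup>2)) *\<^sub>R ((f x :: real^'n) $ j)"
  have T0: "AE x in lebesgue_on \<Omega>. u x $ j = 0" for j
  proof -
    let ?t = "\<integral>x. (u x $ j)\<^sup>2 / (1 + (x $ j)\<^sup>2) \<partial>lebesgue_on \<Omega>"
    have lim: "(\<lambda>m. L2_norm \<Omega> (?T (w m) j)) \<longlonglongrightarrow> L2_norm \<Omega> (?T u j)"
    proof (rule L2_norm_tendsto)
      show "(\<lambda>m. L2_norm \<Omega> (\<lambda>x. ?T u j x - ?T (w m) j x)) \<longlonglongrightarrow> 0"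
      proof (rule tendsto_sandwich[OF _ _ tendsto_const l0])
        have "(\<lambda>x. ?T u j x - ?T (w m) j x) = ?T (\<lambda>x. u x - w m x) j" for m
          by (simp add: right_diff_distrib diff_divide_distrib)
        then show "\<forall>\<^sub>F m in sequentially. L2_norm \<Omega> (\<lambda>x. ?T u j x - ?T (w m) j x) \<le> L2_norm \<Omega> (\<lambda>x. u x - w m x)"
          using weighted_component_L2(2)[OF L2_diff[OF uL wL], of j] by (intro always_eventually) simp
      qed (simp add: L2_norm_nonneg)
    qed (intro weighted_component_L2 uL wL)+
    then have lim2: "(\<lambda>m. (\<integral>x. (w m x $ j)\<^sup>2 / (1 + (x $ j)\<^sup>2) \<partial>lebesgue_on \<Omega>)\<^sup>2) \<longlonglongrightarrow> ?t\<^sup>2"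
      unfolding weighted_component_L2(3)[OF uL, symmetric] weighted_component_L2(3)[OF wL, symmetric]
      by (intro tendsto_power)
    have bound: "?t\<^sup>2 \<le> \<epsilon> * ((pi * real CARD('n))\<^sup>2 * (?U * (\<mu> * (?M + ?U))))" if e: "\<epsilon> > 0" for \<epsilon>
    proof -
      have rhs: "(\<lambda>m. (pi * real CARD('n))\<^sup>2 * ((L2_norm \<Omega> (w m))\<^sup>2 *
          ((\<Sum>i\<in>UNIV. (L2_norm \<Omega> (partial_deriv i (w m)))\<^sup>2) - \<mu> * (L2_norm \<Omega> (w m))\<^sup>2
            + \<mu> * \<epsilon> * (?M + (L2_norm \<Omega> (w m))\<^sup>2))))
        \<longlonglongrightarrow> (pi * real CARD('n))\<^sup>2 * (?U * (dirichlet_form \<Omega> u u - \<mu> * ?U + \<mu> * \<epsilon> * (?M + ?U)))"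
        by (intro tendsto_mult tendsto_add tendsto_diff tendsto_const l1 l2)
      have "?t\<^sup>2 \<le> (pi * real CARD('n))\<^sup>2 * (?U * (dirichlet_form \<Omega> u u - \<mu> * ?U + \<mu> * \<epsilon> * (?M + ?U)))"
        by (rule LIMSEQ_le[OF lim2 rhs]) (use transport_estimate[OF w e \<mu> ray] in blast)
      also have "\<dots> \<le> (pi * real CARD('n))\<^sup>2 * (?U * (0 + \<mu> * \<epsilon> * (?M + ?U)))"
        by (intro mult_left_mono add_right_mono le) auto
      finally show ?thesis by (simp add: mult_ac)
    qed
    have "?t\<^sup>2 \<le> 0"
    proof (rule field_le_epsilon)
      fix \<epsilon> :: real assume e: "\<epsilon> > 0"
      define B where "B = (pi * real CARD('n))\<^sup>2 * (?U * (\<mu> * (?M + ?U)))"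
      have B: "B \<ge> 0" unfolding B_def by (intro mult_nonneg_nonneg add_nonneg_nonneg \<mu>) auto
      \<comment> \<open>Dividing by \<open>B + 1\<close> instead of \<open>B\<close> covers the case \<open>B = 0\<close>.\<close>
      have "?t\<^sup>2 \<le> (\<epsilon> / (B + 1)) * B" using bound[of "\<epsilon> / (B + 1)"] e B by (simp add: B_def)
      also have "\<dots> \<le> \<epsilon>" using e B by (simp add: field_simps)
      finally show "?t\<^sup>2 \<le> 0 + \<epsilon>" by simp
    qed
    then have "?t = 0" by simp
    moreover have "integrable (lebesgue_on \<Omega>) (\<lambda>x. (u x $ j)\<^sup>2 / (1 + (x $ j)\<^sup>2))"
      using L2_integrable_square[OF weighted_component_L2(1)[OF uL, of j]]
      by (simp add: power_mult_distrib power_divide)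
    ultimately have "AE x in lebesgue_on \<Omega>. (u x $ j)\<^sup>2 / (1 + (x $ j)\<^sup>2) = 0"
      by (subst integral_nonneg_eq_0_iff_AE[symmetric]) auto
    then show ?thesis
    proof eventually_elim
      case (elim x)
      have "1 + (x $ j)\<^sup>2 \<noteq> 0" using zero_le_power2[of "x $ j"] by linarith
      then show ?case using elim by simp
    qed
  qed
  have "AE x in lebesgue_on \<Omega>. \<forall>j\<in>UNIV. u x $ j = 0"
    using T0 by (subst AE_ball_countable) auto
  then have "AE x in lebesgue_on \<Omega>. u x = 0" by eventually_elim (simp add: vec_eq_iff)
  then have "L2_norm \<Omega> u = L2_norm \<Omega> (\<lambda>x. 0 :: real^'n)" by (intro L2_norm_cong_AE uL L2_zero)
  then show False using u(2) by (simp add: L2_norm_def L2_inner_def)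
qed

lemma test_functions_H1_closure:
  fixes \<eta> :: "real^'n \<Rightarrow> 'b::euclidean_space"
  assumes "\<eta> \<in> test_functions \<Omega>"
  shows "\<eta> \<in> H1_closure \<Omega> (test_functions \<Omega>)"
proof -
  have H1: "\<eta> \<in> H1 \<Omega>"
    using test_functions_L2[OF assms] test_functions_L2[OF test_functions_partial_deriv[OF assms]]
      test_functions_has_weak_partial[OF assms] unfolding H1_def by blast
  have z: "(\<lambda>x. 0 :: 'b) \<in> test_functions \<Omega>" by (simp add: test_functions_def cont_diff_const)
  have "partial_deriv i (\<lambda>x::real^'n. 0 :: 'b) = (\<lambda>x. 0)" for i
    by (rule ext, rule trans[OF partial_deriv_eq[OF has_derivative_const]]) simp
  then have "H1_norm \<Omega> (\<lambda>x. \<eta> x - \<eta> x) = 0"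
    unfolding H1_norm_def by (simp add: dirichlet_form_test[OF z] L2_norm_def L2_inner_def)
  then have "\<exists>w\<in>test_functions \<Omega>. H1_norm \<Omega> (\<lambda>x. \<eta> x - w x) < \<epsilon>" if "\<epsilon> > 0" for \<epsilon>
    using that assms by (intro bexI[of _ \<eta>]) auto
  then show ?thesis using H1 unfolding H1_closure_def by blast
qed

lemma first_eigenvalue_rayleigh:
  assumes "first_dirichlet_eigenvalue \<Omega> \<mu>"
  shows "\<mu> \<ge> 0" and "\<And>\<eta> :: real^'n \<Rightarrow> real. \<eta> \<in> test_functions \<Omega> \<Longrightarrow>
      \<mu> * (L2_norm \<Omega> \<eta>)\<^sup>2 \<le> (\<Sum>i\<in>UNIV. (L2_norm \<Omega> (partial_deriv i \<eta>))\<^sup>2)"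
proof -
  have "\<mu> \<in> rayleigh_quotients \<Omega>" using assms unfolding first_dirichlet_eigenvalue_def by blast
  then obtain \<phi> :: "real^'n \<Rightarrow> real" where "\<mu> = dirichlet_form \<Omega> \<phi> \<phi> / (L2_norm \<Omega> \<phi>)\<^sup>2"
    unfolding rayleigh_quotients_def by blast
  then show "\<mu> \<ge> 0" by (simp add: dirichlet_form_self sum_nonneg)
  fix \<eta> :: "real^'n \<Rightarrow> real" assume \<eta>: "\<eta> \<in> test_functions \<Omega>"
  show "\<mu> * (L2_norm \<Omega> \<eta>)\<^sup>2 \<le> (\<Sum>i\<in>UNIV. (L2_norm \<Omega> (partial_deriv i \<eta>))\<^sup>2)"
  proof (cases "L2_norm \<Omega> \<eta> = 0")
    case True
    then show ?thesis by (simp add: sum_nonneg)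
  next
    case False
    then have "dirichlet_form \<Omega> \<eta> \<eta> / (L2_norm \<Omega> \<eta>)\<^sup>2 \<in> rayleigh_quotients \<Omega>"
      using test_functions_H1_closure[OF \<eta>] unfolding rayleigh_quotients_def H10_def by blast
    then have "\<mu> \<le> dirichlet_form \<Omega> \<eta> \<eta> / (L2_norm \<Omega> \<eta>)\<^sup>2"
      using assms unfolding first_dirichlet_eigenvalue_def by blast
    then show ?thesis using False by (simp add: dirichlet_form_test[OF \<eta>] field_simps)
  qed
qed

lemma measure_Omega_pos:
  assumes "L2_norm \<Omega> f \<noteq> 0"
  shows "measure lebesgue \<Omega> > 0"
proof (rule ccontr)
  assume "\<not> measure lebesgue \<Omega> > 0"
  then have "measure lebesgue \<Omega> = 0" by (simp add: order_antisym_conv not_less)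
  moreover have "emeasure lebesgue \<Omega> = ennreal (measure lebesgue \<Omega>)"
    using finite_Omega by (intro emeasure_eq_ennreal_measure) auto
  ultimately have "emeasure lebesgue \<Omega> = 0" by simp
  then have "AE x in lebesgue_on \<Omega>. False"
    by (subst AE_restrict_space_iff) (auto simp: AE_iff_null_sets[symmetric] null_setsI AE_not_in)
  then have "L2_inner \<Omega> f f = 0" unfolding L2_inner_def by (intro integral_eq_zero_AE) auto
  then show False using assms by (simp add: L2_norm_def)
qed

end

theorem corollary2p2:
  fixes \<Omega> :: "(real^'n) set" and n :: nat
    and lam :: "nat \<Rightarrow> real" and v :: "nat \<Rightarrow> real^'n \<Rightarrow> real^'n" and \<mu>1 :: real
  assumes "n = CARD('n)" and "n \<ge> 2"
    and "open \<Omega>" and "emeasure lebesgue \<Omega> < \<infinity>"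
    and "stokes_eigensystem \<Omega> lam v"
    and "first_dirichlet_eigenvalue \<Omega> \<mu>1"
  shows "(\<forall>k\<ge>1. lam k \<ge> real n / (2 + real n) *
            ((2 * pi) ^ n / (unit_ball_vol (real n) * (real n - 1) * measure lebesgue \<Omega>))
              powr (2 / real n) * real k powr (2 / real n)) \<and>
         lam 1 > \<mu>1 \<and>
         \<mu>1 \<ge> real n / (2 + real n) *
            ((2 * pi) ^ n / (unit_ball_vol (real n) * measure lebesgue \<Omega>)) powr (2 / real n)"
proof -
  interpret open_finite_measure \<Omega> by unfold_locales (use assms in auto)
  have ep: "stokes_eigenpair \<Omega> (lam k) (v k)" if "k \<ge> 1" for k
    using assms(5) that unfolding stokes_eigensystem_def by blast
  have orth: "L2_inner \<Omega> (v j) (v k) = (if j = k then 1 else 0)" if "j \<ge> 1" "k \<ge> 1" for j k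
    using assms(5) that unfolding stokes_eigensystem_def by blast
  have vV: "v k \<in> V_space \<Omega>" if "k \<ge> 1" for k using ep[OF that] unfolding stokes_eigenpair_def by blast
  have vn: "(L2_norm \<Omega> (v k))\<^sup>2 = 1" if "k \<ge> 1" for k using orth[OF that that] by (simp add: L2_norm_sq)
  have vD: "dirichlet_form \<Omega> (v k) (v k) = lam k" if "k \<ge> 1" for k
    using ep[OF that] vV[OF that] orth[OF that that] unfolding stokes_eigenpair_def stokes_op_def by simp
  have mono: "lam j \<le> lam k" if "1 \<le> j" "j \<le> k" for j k
    using that(2,1)
  proof (induction rule: dec_induct)
    case (step i)
    then show ?case using assms(5) unfolding stokes_eigensystem_def by (meson le_trans order_trans)
  qed simp
  have Omega_pos: "measure lebesgue \<Omega> > 0"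
    by (rule measure_Omega_pos[of "v 1"]) (use vn[of 1] in auto)
  have n: "real n - 1 > 0" using assms(2) by simp
  have bpos: "unit_ball_vol (real n) > 0" by (rule unit_ball_vol_pos) simp
  have "lam k \<ge> real n / (2 + real n) *
      ((2 * pi) ^ n / (unit_ball_vol (real n) * (real n - 1) * measure lebesgue \<Omega>)) powr (2 / real n)
        * real k powr (2 / real n)" if k: "k \<ge> 1" for k
  proof -
    let ?M = "(real n - 1) * measure lebesgue \<Omega>"
    let ?R = "real n / (2 + real n) * ((2 * pi) ^ n * real k / (unit_ball_vol (real n) * ?M)) powr (2 / real n)"
    have "(\<Sum>j\<in>{1..k}. dirichlet_form \<Omega> (v j) (v j)) \<ge> real k * ?R"
      unfolding assms(1)
    proof (rule berezin_li_yau[where S = "solenoidal_test_functions \<Omega>"])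
      show "solenoidal_test_functions \<Omega> \<subseteq> test_functions \<Omega>" using solenoidal_test by blast
      show "v j \<in> H1_closure \<Omega> (solenoidal_test_functions \<Omega>)" if "j \<in> {1..k}" for j
        using vV[of j] that by (simp add: V_space_def)
      show "real k = (\<Sum>j\<in>{1..k}. (L2_norm \<Omega> (v j))\<^sup>2)" by (simp add: vn)
      show "real k > 0" using k by simp
      show "(real CARD('n) - 1) * measure lebesgue \<Omega> > 0" using n Omega_pos assms(1) by simp
      show "(\<Sum>j\<in>{1..k}. power_spectrum (lebesgue_on \<Omega>) (v j) \<xi>) \<le> (real CARD('n) - 1) * measure lebesgue \<Omega>"
        if "\<xi> \<noteq> 0" for \<xi>
        by (rule solenoidal_spectrum_bound) (use vV orth that in auto)
    qed
    also have "(\<Sum>j\<in>{1..k}. dirichlet_form \<Omega> (v j) (v j)) = (\<Sum>j\<in>{1..k}. lam j)" by (simp add: vD)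
    also have "\<dots> \<le> (\<Sum>j\<in>{1..k}. lam k)" by (intro sum_mono mono) auto
    also have "\<dots> = real k * lam k" by simp
    finally have "?R \<le> lam k" by (rule mult_left_le_imp_le) (use k in simp)
    moreover have "((2 * pi) ^ n * real k / (unit_ball_vol (real n) * ?M)) powr (2 / real n)
        = ((2 * pi) ^ n / (unit_ball_vol (real n) * (real n - 1) * measure lebesgue \<Omega>)) powr (2 / real n)
        * real k powr (2 / real n)"
    proof -
      have "(2 * pi) ^ n * real k / (unit_ball_vol (real n) * ?M)
          = (2 * pi) ^ n / (unit_ball_vol (real n) * (real n - 1) * measure lebesgue \<Omega>) * real k" by simp
      then show ?thesis using n Omega_pos bpos by (simp only: powr_mult)
    qed
    ultimately show ?thesis by (simp only: mult.assoc)
  qed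
  moreover have "lam 1 > \<mu>1"
    using solenoidal_rayleigh_strict[OF vV[of 1] _ first_eigenvalue_rayleigh[OF assms(6)]] vn[of 1] vD[of 1]
    by fastforce
  moreover have "\<mu>1 \<ge> real n / (2 + real n) *
      ((2 * pi) ^ n / (unit_ball_vol (real n) * measure lebesgue \<Omega>)) powr (2 / real n)"
  proof -
    obtain \<phi> where \<phi>: "\<mu>1 = dirichlet_form \<Omega> \<phi> \<phi> / (L2_norm \<Omega> \<phi>)\<^sup>2" "\<phi> \<in> H10 \<Omega>" "L2_norm \<Omega> \<phi> \<noteq> 0"
    proof -
      have "\<mu>1 \<in> rayleigh_quotients \<Omega>" using assms(6) unfolding first_dirichlet_eigenvalue_def by blast
      then show ?thesis using that unfolding rayleigh_quotients_def by blast
    qed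
    let ?N = "(L2_norm \<Omega> \<phi>)\<^sup>2"
    have N: "?N > 0" using \<phi>(3) by simp
    have \<phi>L: "\<phi> \<in> L2 \<Omega>" using \<phi>(2) by (auto simp: H10_def H1_closure_def H1_def)
    \<comment> \<open>A single function, without normalisation: the factor \<open>?N\<close> cancels against the spectrum bound \<open>measure lebesgue \<Omega> * ?N\<close>.\<close>
    have "?N * (real n / (2 + real n) * ((2 * pi) ^ n * ?N / (unit_ball_vol (real n) * (measure lebesgue \<Omega> * ?N))) powr (2 / real n))
        \<le> (\<Sum>j\<in>{()}. dirichlet_form \<Omega> \<phi> \<phi>)"
      unfolding assms(1)
    proof (rule berezin_li_yau[where S = "test_functions \<Omega>"])
      show "\<phi> \<in> H1_closure \<Omega> (test_functions \<Omega>)" using \<phi>(2) by (simp add: H10_def)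
    qed (use N Omega_pos scalar_spectrum_bound[OF \<phi>L] in auto)
    moreover have "(2 * pi) ^ n * ?N / (unit_ball_vol (real n) * (measure lebesgue \<Omega> * ?N))
        = (2 * pi) ^ n / (unit_ball_vol (real n) * measure lebesgue \<Omega>)" using \<phi>(3) by simp
    ultimately show ?thesis unfolding \<phi>(1) using N by (simp add: pos_le_divide_eq mult.commute)
  qed
  ultimately show ?thesis by blast
qed

end
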